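(* Let $\delta$ be a real number and let $\mathcal{P}$ be a finite partition of $\prod_{i=1}^n K_i$ into Borel sets with the property that $$\|\nabla f(\boldsymbol{x},\cdot) - \nabla f(\boldsymbol{y},\cdot)\| = \sup_{\boldsymbol{z}\in\prod_i K_i}|\nabla f(\boldsymbol{x},\boldsymbol{z}) - \nabla f(\boldsymbol{y},\boldsymbol{z})| < \delta n$$ whenever $\boldsymbol{x},\boldsymbol{y}$ lie in the same part of $\mathcal{P}$. Then: (a) $\mathrm{DTC}(\mu) < \mathrm{H}_\mu(\mathcal{P}) + \delta n$; (b) $$\sum_{P\in \mathcal{P}}\mu(P)\cdot \int \mathrm{D}\big(\mu_{|P}\,\big\|\,\xi_{\nabla f(\boldsymbol{y},\cdot)}\big)\ \mu_{|P}(d \boldsymbol{y}) < \mathrm{H}_\mu(\mathcal{P}) + \delta n;$$ (c) $$\sum_{P\in \mathcal{P}}\mu(P)\cdot \int \overline{d_n}\big(\mu_{|P},\xi_{\nabla f(\boldsymbol{y},\cdot)}\big)\ \mu_{|P}(d \boldsymbol{y}) < \sqrt{\frac{1}{2}\Big(\frac{\mathrm{H}_\mu(\mathcal{P})}{n} + \delta\Big)}.$$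
   Context: Setting. Let $n\ge 1$ and $[n]=\{1,\dots,n\}$. Let $(K_1,d_{K_1}),\dots,(K_n,d_{K_n})$ be nonempty, complete, separable metric spaces, all of diameter at most one. For each $i$ let $\lambda_i$ be a fixed Borel probability measure on $K_i$ and $\ast_i\in K_i$ a fixed reference point. Let $f:\prod_{i=1}^n K_i\to\mathbb{R}$ be bounded and continuous, and let $\mu$ be the Gibbs measure $\mu(d\boldsymbol{x}) = \frac1Z e^{f(\boldsymbol{x})}\prod_{i=1}^n\lambda_i(dx_i)$, where $Z$ is the normalizing constant. $\|\cdot\|$ denotes the uniform (sup) norm. Discrete gradient. For $\boldsymbol{x}\in\prod_iK_i$, $i\in[n]$, $y\in K_i$, put $\partial_i f(\boldsymbol{x},y) := f(x_1,\dots,x_{i-1},y,x_{i+1},\dots,x_n) - f(x_1,\dots,x_{i-1},\ast_i,x_{i+1},\dots,x_n)$, and for $\boldsymbol{x},\boldsymbol{y}\in\prod_iK_i$ put $\nabla f(\boldsymbol{x},\boldsymbol{y}) := \sum_{i=1}^n\partial_if(\boldsymbol{x},y_i)$. Product Gibbs measures. A function $g$ on $\prod_iK_i$ is additively separable if $g(\boldsymbol{x})=g_1(x_1)+\dots+g_n(x_n)$ with each $g_i:K_i\to\mathbb{R}$ bounded and continuous. For such $g$, $\xi_g$ denotes the probability measure proportional to $e^{g(\boldsymbol{x})}\prod_i\lambda_i(dx_i)$; it is a product measure. Each $\nabla f(\boldsymbol{x},\cdot)$ is additively separable. Transportation metric. $d_n(\boldsymbol{x},\boldsymbol{y}):=\frac1n\sum_{i=1}^nd_{K_i}(x_i,y_i)$,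 and for Borel probability measures $\nu,\nu'$ on $\prod_iK_i$, $\overline{d_n}(\nu,\nu'):=\inf_\lambda\int d_n(\boldsymbol{x},\boldsymbol{y})\,\lambda(d\boldsymbol{x},d\boldsymbol{y})$, the infimum being over all couplings $\lambda$ of $\nu$ and $\nu'$. Information quantities (natural logarithms). $\mathrm{H}_\mu(\mathcal{P})=-\sum_{P\in\mathcal{P}}\mu(P)\log\mu(P)$. $\mu_{|P}=\mu(\cdot\mid P)$ for $\mu(P)>0$; terms with $\mu(P)=0$ are omitted from the sums. $\mathrm{D}(\nu\|\gamma)=\int\log\frac{d\nu}{d\gamma}\,d\nu$ if $\nu\ll\gamma$ and $+\infty$ otherwise (Kullback--Leibler divergence). For finite-valued random variables $\zeta_1,\dots,\zeta_n$, with $\mathrm{H}$ denoting Shannon (conditional) entropy, the dual total correlation is $\mathrm{DTC}(\zeta_1,\dots,\zeta_n):=\mathrm{H}(\zeta_1,\dots,\zeta_n)-\sum_{i=1}^n\mathrm{H}(\zeta_i\mid\zeta_1,\dots,\zeta_{i-1},\zeta_{i+1},\dots,\zeta_n)$. For random variables $\zeta_i$ valued in general measurable spaces $K_i$, $\mathrm{DTC}(\zeta_1,\dots,\zeta_n):=\sup\mathrm{DTC}([\zeta_1]_{\mathcal{P}_1},\dots,[\zeta_n]_{\mathcal{P}_n})$, the supremum being over all finite measurable partitions $\mathcal{P}_i$ of $K_i$, where $[\zeta_i]_{\mathcal{P}_i}$ is the cell of $\mathcal{P}_i$ containing $\zeta_i$. $\mathrm{DTC}(\mu)$ is the DTC of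 the coordinate variables under $\mu$. *)

theory Defs
  imports "HOL-Probability.Probability"
begin

definition borel_of :: "'a topology \<Rightarrow> 'a measure" where
  "borel_of X = sigma (topspace X) {U. openin X U}"

definition discrete_partial ::
    "(nat \<Rightarrow> 'a) \<Rightarrow> ((nat \<Rightarrow> 'a) \<Rightarrow> real) \<Rightarrow> nat \<Rightarrow> (nat \<Rightarrow> 'a) \<Rightarrow> 'a \<Rightarrow> real" where
  "discrete_partial pt f i x y = f (x(i := y)) - f (x(i := pt i))"

definition discrete_gradient ::
    "nat \<Rightarrow> (nat \<Rightarrow> 'a) \<Rightarrow> ((nat \<Rightarrow> 'a) \<Rightarrow> real) \<Rightarrow> (nat \<Rightarrow> 'a) \<Rightarrow> (nat \<Rightarrow> 'a) \<Rightarrow> real" where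
  "discrete_gradient n pt f x y = (\<Sum>i = 1..n. discrete_partial pt f i x (y i))"

definition gibbs :: "'b measure \<Rightarrow> ('b \<Rightarrow> real) \<Rightarrow> 'b measure" where
  "gibbs M g = density M (\<lambda>x. ennreal (exp (g x) / (\<integral>z. exp (g z) \<partial>M)))"

definition avg_dist :: "nat \<Rightarrow> (nat \<Rightarrow> 'a metric) \<Rightarrow> (nat \<Rightarrow> 'a) \<Rightarrow> (nat \<Rightarrow> 'a) \<Rightarrow> real" where
  "avg_dist n K x y = (\<Sum>i = 1..n. mdist (K i) (x i) (y i)) / real n"

definition couplings :: "'b measure \<Rightarrow> 'b measure \<Rightarrow> ('b \<times> 'b) measure set" where
  "couplings M N = {L. sets L = sets (M \<Otimes>\<^sub>M N) \<and> distr L M fst = M \<and> distr L N snd = N}"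

definition transport_dist ::
    "('b \<Rightarrow> 'b \<Rightarrow> real) \<Rightarrow> 'b measure \<Rightarrow> 'b measure \<Rightarrow> ennreal" where
  "transport_dist c M N = (INF L\<in>couplings M N. \<integral>\<^sup>+ (x, y). ennreal (c x y) \<partial>L)"

(* The library's KL_divergence takes its measures in the opposite order, is real-valued and carries
   no absolute continuity condition. The negative part of log (dN/dG) is always N-integrable, so
   for N absolutely continuous with respect to G non-integrability means the value +infinity.
   Since the divergence of probability measures is nonnegative, the conversion to ennreal
   truncates nothing. *)
definition KL :: "'b measure \<Rightarrow> 'b measure \<Rightarrow> ennreal" where
  "KL N G = (if absolutely_continuous G N \<and> integrable N (entropy_density (exp 1) G N)
             then ennreal (KL_divergence (exp 1) G N) else \<infinity>)"

(* Parts of measure zero contribute nothing, as 0 * ln 0 = 0. *)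
definition partition_entropy :: "'b measure \<Rightarrow> 'b set set \<Rightarrow> real" where
  "partition_entropy M Q = - (\<Sum>P\<in>Q. measure M P * ln (measure M P))"

definition shannon_entropy :: "'b measure \<Rightarrow> ('b \<Rightarrow> 'c) \<Rightarrow> real" where
  "shannon_entropy M X = prob_space.entropy M (exp 1) (count_space (X ` space M)) X"

definition shannon_cond_entropy :: "'b measure \<Rightarrow> ('b \<Rightarrow> 'c) \<Rightarrow> ('b \<Rightarrow> 'd) \<Rightarrow> real" where
  "shannon_cond_entropy M X Y =
     prob_space.conditional_entropy M (exp 1)
       (count_space (X ` space M)) (count_space (Y ` space M)) X Y"

definition DTC_finite :: "'b measure \<Rightarrow> 'i set \<Rightarrow> ('i \<Rightarrow> 'b \<Rightarrow> 'c) \<Rightarrow> real" where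
  "DTC_finite M I Z =
     shannon_entropy M (\<lambda>\<omega>. \<lambda>i\<in>I. Z i \<omega>)
     - (\<Sum>i\<in>I. shannon_cond_entropy M (Z i) (\<lambda>\<omega>. \<lambda>j\<in>I - {i}. Z j \<omega>))"

definition finite_measurable_partition :: "'a measure \<Rightarrow> 'a set set \<Rightarrow> bool" where
  "finite_measurable_partition S Q \<longleftrightarrow> finite Q \<and> Q \<subseteq> sets S \<and> partition_on (space S) Q"

definition cell :: "'a set set \<Rightarrow> 'a \<Rightarrow> 'a set" where
  "cell Q x = (THE C. C \<in> Q \<and> x \<in> C)"

definition DTC ::
    "'b measure \<Rightarrow> 'i set \<Rightarrow> ('i \<Rightarrow> 'a measure) \<Rightarrow> ('i \<Rightarrow> 'b \<Rightarrow> 'a) \<Rightarrow> ereal" where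
  "DTC M I S Z =
     (SUP Q \<in> {Q. \<forall>i\<in>I. finite_measurable_partition (S i) (Q i)}.
        ereal (DTC_finite M I (\<lambda>i \<omega>. cell (Q i) (Z i \<omega>))))"

end

theory Submission
  imports Defs
begin

text \<open>Write \<open>p\<close> for the density of the Gibbs measure \<open>\<mu>\<close> with respect to the product measure. The
  measure \<open>\<xi>\<close> of the gradient at \<open>x\<close> is the product of the one-site conditional laws of \<open>\<mu>\<close> at \<open>x\<close>, so
  the expected value of \<open>log (d\<xi>/d\<mu>)(x)\<close> under \<open>\<mu>\<close> is the dual total correlation \<open>dtc p\<close> computed with
  relative differential entropies. On a part \<open>P\<close> the divergence of \<open>\<mu>\<close> conditioned on \<open>P\<close> from \<open>\<xi>\<close> at
  \<open>y\<close> is \<open>- ln \<mu>(P)\<close> plus an average of \<open>log (d\<mu>/d\<xi>)\<close>; replacing the gradient at \<open>y\<close> by the one at the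
  integration point costs less than \<open>\<delta> n\<close>. Summing over the parts, the left-hand side of (b) plus
  \<open>dtc p\<close> is less than \<open>H(\<P>) + \<delta> n\<close>, and both summands are nonnegative.

  That \<open>dtc p\<close> dominates the dual total correlation of every discretization is proved by averaging
  \<open>p\<close> over the cells of one coordinate at a time; each step decreases \<open>dtc\<close> by the log-sum inequality.
  Part (c) follows from (b) by Marton's transport inequality, in the linearized form
  \<open>cost \<le> c / 2 + D / (4 c n)\<close> for every \<open>c > 0\<close>, which averages over \<open>y\<close> and \<open>P\<close> without Jensen.\<close>


text \<open>Boundedness of \<open>f\<close> puts the density of \<open>\<mu>\<close> between two
  positive constants. Averages over cells keep these bounds at every point, so all logarithms of
  averaged densities are bounded and integrability is never an issue; conditional expectations can
  then be explicit pointwise averages, handled through invariance in a coordinate and adjointness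
  alone. The error \<open>\<delta> n\<close> is paid only once in (b): in log(d\<mu>/d\<xi>) only
  the gradient couples \<open>x\<close> with \<open>y\<close>. The log-normalizer depends on
  \<open>y\<close> alone, and averaging \<open>y\<close> over the same conditional law as
  \<open>x\<close> turns it into its diagonal value. The square root in (c) comes from sqrt (D / (2
  n)) being the minimum over c > 0 of c / 2 + D / (4 c n). One value of c, computed from the
  right-hand side, serves all \<open>y\<close> and all parts. The transport cost need not be shown
  measurable in \<open>y\<close>: it is bounded pointwise by a measurable function, and upper bounds
  pass through the nonnegative integral.\<close>

section \<open>Bounded measurable functions\<close>

definition bmeas :: "'b measure \<Rightarrow> ('b \<Rightarrow> real) set" where
  "bmeas M = {u \<in> borel_measurable M. \<exists>B. \<forall>x\<in>space M. \<bar>u x\<bar> \<le> B}"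

lemma bmeasI: "u \<in> borel_measurable M \<Longrightarrow> (\<And>x. x \<in> space M \<Longrightarrow> \<bar>u x\<bar> \<le> B) \<Longrightarrow> u \<in> bmeas M"
  by (auto simp: bmeas_def)

lemma bmeas_intervalI:
  "u \<in> borel_measurable M \<Longrightarrow> (\<And>x. x \<in> space M \<Longrightarrow> u x \<in> {a..b}) \<Longrightarrow> u \<in> bmeas M"
  by (rule bmeasI[where B="\<bar>a\<bar> + \<bar>b\<bar>"]) fastforce+

lemma bmeas_measurable[measurable_dest]: "u \<in> bmeas M \<Longrightarrow> u \<in> borel_measurable M"
  by (auto simp: bmeas_def)

lemma bmeasE:
  assumes "u \<in> bmeas M"
  obtains B where "u \<in> borel_measurable M" "B \<ge> 0" "\<And>x. x \<in> space M \<Longrightarrow> \<bar>u x\<bar> \<le> B"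
proof -
  obtain B where *: "u \<in> borel_measurable M" "\<forall>x\<in>space M. \<bar>u x\<bar> \<le> B"
    using assms by (auto simp: bmeas_def)
  show thesis
    by (rule that[of "\<bar>B\<bar>"]) (use * in fastforce)+
qed

lemma bmeas_sets_cong: "sets M = sets N \<Longrightarrow> bmeas M = bmeas N"
  using measurable_cong_sets[of M N borel borel] sets_eq_imp_space_eq[of M N]
  by (auto simp: bmeas_def)

lemma bmeas_const[simp, intro]: "(\<lambda>_. c) \<in> bmeas M"
  by (auto simp: bmeas_def)

lemma bmeas_add[intro]: "u \<in> bmeas M \<Longrightarrow> v \<in> bmeas M \<Longrightarrow> (\<lambda>x. u x + v x) \<in> bmeas M"
proof (elim bmeasE)
  fix B C assume [measurable]: "u \<in> borel_measurable M" "v \<in> borel_measurable M"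
    and *: "\<And>x. x \<in> space M \<Longrightarrow> \<bar>u x\<bar> \<le> B" "\<And>x. x \<in> space M \<Longrightarrow> \<bar>v x\<bar> \<le> C"
  show ?thesis
  proof (rule bmeasI)
    show "\<bar>u x + v x\<bar> \<le> B + C" if "x \<in> space M" for x
      using *[OF that] by linarith
  qed simp
qed

lemma bmeas_mult[intro]: "u \<in> bmeas M \<Longrightarrow> v \<in> bmeas M \<Longrightarrow> (\<lambda>x. u x * v x) \<in> bmeas M"
proof (elim bmeasE)
  fix B C assume [measurable]: "u \<in> borel_measurable M" "v \<in> borel_measurable M"
    and *: "\<And>x. x \<in> space M \<Longrightarrow> \<bar>u x\<bar> \<le> B" "\<And>x. x \<in> space M \<Longrightarrow> \<bar>v x\<bar> \<le> C" "B \<ge> 0" "C \<ge> 0"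
  show ?thesis
  proof (rule bmeasI)
    show "\<bar>u x * v x\<bar> \<le> B * C" if "x \<in> space M" for x
      unfolding abs_mult using *(1,2)[OF that] *(3,4) by (intro mult_mono) auto
  qed simp
qed

lemma bmeas_uminus[intro]: "u \<in> bmeas M \<Longrightarrow> (\<lambda>x. - u x) \<in> bmeas M"
  using bmeas_mult[of "\<lambda>_. -1" M u] by simp

lemma bmeas_diff[intro]: "u \<in> bmeas M \<Longrightarrow> v \<in> bmeas M \<Longrightarrow> (\<lambda>x. u x - v x) \<in> bmeas M"
  using bmeas_add[of u M "\<lambda>x. - v x"] by auto

lemma bmeas_sum[intro]: "(\<And>i. i \<in> A \<Longrightarrow> u i \<in> bmeas M) \<Longrightarrow> (\<lambda>x. \<Sum>i\<in>A. u i x) \<in> bmeas M"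
  by (induction A rule: infinite_finite_induct) auto

lemma bmeas_abs: "v \<in> bmeas N \<Longrightarrow> (\<lambda>x. \<bar>v x\<bar>) \<in> bmeas N"
proof (elim bmeasE)
  fix B assume "v \<in> borel_measurable N" "\<And>x. x \<in> space N \<Longrightarrow> \<bar>v x\<bar> \<le> B"
  then show ?thesis by (intro bmeasI[where B=B]) auto
qed

lemma bmeas_compose: "u \<in> bmeas N \<Longrightarrow> g \<in> measurable M N \<Longrightarrow> (\<lambda>x. u (g x)) \<in> bmeas M"
  by (elim bmeasE, rule bmeasI) (auto dest: measurable_space)

lemma bmeas_indicator[intro]: "A \<in> sets M \<Longrightarrow> (indicator A :: 'b \<Rightarrow> real) \<in> bmeas M"
  by (rule bmeasI[where B=1]) (auto simp: indicator_def)

lemma bmeas_cong: "u \<in> bmeas M \<Longrightarrow> (\<And>x. x \<in> space M \<Longrightarrow> u x = v x) \<Longrightarrow> v \<in> bmeas M"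
  using measurable_cong[of M u v] by (auto simp: bmeas_def)

lemma bmeas_exp: "u \<in> bmeas M \<Longrightarrow> (\<lambda>x. exp (u x)) \<in> bmeas M"
proof (elim bmeasE)
  fix B assume [measurable]: "u \<in> borel_measurable M"
    and *: "\<And>x. x \<in> space M \<Longrightarrow> \<bar>u x\<bar> \<le> B"
  show ?thesis
    by (rule bmeas_intervalI[where a="0" and b="exp B"]) (use * in \<open>fastforce\<close>)+
qed

lemma bmeas_ln:
  assumes "u \<in> borel_measurable M" "m > 0" "\<And>x. x \<in> space M \<Longrightarrow> u x \<in> {m..B}"
  shows "(\<lambda>x. ln (u x)) \<in> bmeas M"
proof (rule bmeas_intervalI[where a="ln m" and b="ln B"])
  show "ln (u x) \<in> {ln m..ln B}" if "x \<in> space M" for x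
    using assms(3)[OF that] assms(2) by auto
qed (use assms in simp)

lemma bmeas_divide:
  assumes "u \<in> bmeas M" "v \<in> borel_measurable M" "m > 0" "\<And>x. x \<in> space M \<Longrightarrow> v x \<ge> m"
  shows "(\<lambda>x. u x / v x) \<in> bmeas M"
proof -
  have "(\<lambda>x. inverse (v x)) \<in> bmeas M"
  proof (rule bmeas_intervalI[where a=0 and b="inverse m"])
    show "inverse (v x) \<in> {0..inverse m}" if "x \<in> space M" for x
      using assms(4)[OF that] assms(3) by (auto simp: field_simps)
  qed (use assms in simp)
  from bmeas_mult[OF assms(1) this] show ?thesis
    by (simp add: field_simps)
qed

text \<open>From \<open>ln s \<le> s - 1\<close>, applied to 1/t below and to t above. The value t =
  0 is harmless because \<open>ln 0 = 0\<close>; it does occur, since the density of a conditioned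
  measure vanishes off its part.\<close>

lemma xlnx_bound:
  fixes t :: real
  assumes "0 \<le> t" "t \<le> B"
  shows "\<bar>t * ln t\<bar> \<le> 1 + B * B"
proof (cases "t = 0")
  case False
  then have t: "t > 0" using assms by simp
  have "ln (1/t) \<le> 1/t - 1" using t by (intro ln_le_minus_one) simp
  then have "- ln t \<le> 1/t - 1" using t by (simp add: ln_div)
  then have "t * - ln t \<le> t * (1/t - 1)" using t by (intro mult_left_mono) auto
  then have 1: "- (t * ln t) \<le> 1" using t by (simp add: algebra_simps)
  have "ln t \<le> t" using ln_le_minus_one[OF t] by simp
  then have "t * ln t \<le> t * t" using t by simp
  moreover have "t * t \<le> B * B" using assms by (intro mult_mono) auto
  ultimately show ?thesis using 1 by (smt (verit) zero_le_square)
qed simp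

lemma bmeas_xlnx:
  assumes "u \<in> bmeas M" "\<And>x. x \<in> space M \<Longrightarrow> u x \<ge> 0"
  shows "(\<lambda>x. u x * ln (u x)) \<in> bmeas M"
proof -
  obtain B where [measurable]: "u \<in> borel_measurable M" and B: "\<And>x. x \<in> space M \<Longrightarrow> \<bar>u x\<bar> \<le> B"
    using bmeasE[OF assms(1)] by metis
  show ?thesis
    by (rule bmeasI[where B="1 + B * B"]) (use assms(2) B xlnx_bound in force)+
qed

lemma (in finite_measure) integrable_bmeas[intro]: "u \<in> bmeas M \<Longrightarrow> integrable M u"
proof (elim bmeasE)
  fix B assume "u \<in> borel_measurable M" "\<And>x. x \<in> space M \<Longrightarrow> \<bar>u x\<bar> \<le> B"
  then show ?thesis
    by (intro integrable_const_bound[where B=B] AE_I2) auto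
qed

lemma (in prob_space) integral_in_interval:
  assumes "u \<in> borel_measurable M" "\<And>x. x \<in> space M \<Longrightarrow> u x \<in> {a..b}"
  shows "(\<integral>x. u x \<partial>M) \<in> {a..(b::real)}"
proof -
  have "integrable M u"
    by (rule integrable_bmeas, rule bmeas_intervalI[OF assms])
  then have "(\<integral>x. a \<partial>M) \<le> (\<integral>x. u x \<partial>M)" "(\<integral>x. u x \<partial>M) \<le> (\<integral>x. b \<partial>M)"
    by (intro integral_mono; use assms(2) in force)+
  then show ?thesis by (simp add: prob_space)
qed

subsection \<open>Averaging over the cells of a partition\<close>

lemma cell_eq:
  assumes "partition_on A Q" "C \<in> Q" "s \<in> C"
  shows "cell Q s = C"
  unfolding cell_def
  by (rule the_equality) (use assms in \<open>auto simp: partition_on_def disjoint_def\<close>)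

lemma cell_in:
  assumes "partition_on A Q" "s \<in> A"
  shows "cell Q s \<in> Q" "s \<in> cell Q s"
proof -
  obtain C where "C \<in> Q" "s \<in> C" using assms by (auto simp: partition_on_def)
  with cell_eq[OF assms(1) this] show "cell Q s \<in> Q" "s \<in> cell Q s" by auto
qed

lemma finite_measurable_partitionD:
  assumes "finite_measurable_partition N Q"
  shows "finite Q" "Q \<subseteq> sets N" "partition_on (space N) Q"
  using assms by (auto simp: finite_measurable_partition_def)

lemma uniform_measure_eq_density:
  assumes "measure N C > 0"
  shows "uniform_measure N C = density N (\<lambda>x. ennreal (indicator C x / measure N C))"
proof -
  have "emeasure N C = ennreal (measure N C)"
    using assms measure_zero_top[of N C] by (intro emeasure_eq_ennreal_measure) auto
  then show ?thesis
    unfolding uniform_measure_def using assms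
    by (intro arg_cong[where f="density N"] ext)
      (simp add: divide_ennreal indicator_def flip: ennreal_1)
qed

lemma integral_uniform_measure:
  fixes g :: "_ \<Rightarrow> real"
  assumes "measure N C > 0" "g \<in> borel_measurable N" "C \<in> sets N"
  shows "(\<integral>x. g x \<partial>uniform_measure N C) = (\<integral>x. indicator C x * g x \<partial>N) / measure N C"
  unfolding uniform_measure_eq_density[OF assms(1)]
  by (subst integral_density) (use assms in \<open>auto simp: field_simps\<close>)

text \<open>On a null cell the conditional law is undefined; falling back to \<open>N\<close> keeps averages of a
  positive function bounded away from zero everywhere.\<close>

definition kern :: "'a measure \<Rightarrow> 'a set set \<Rightarrow> 'a \<Rightarrow> 'a measure" where
  "kern N Q s = (if measure N (cell Q s) = 0 then N else uniform_measure N (cell Q s))"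

lemma sets_kern[simp, measurable_cong]: "sets (kern N Q s) = sets N"
  by (auto simp: kern_def)

lemma space_kern[simp]: "space (kern N Q s) = space N"
  by (auto simp: kern_def)

lemma (in prob_space) prob_space_kern: "prob_space (kern M Q s)"
  unfolding kern_def using prob_space_axioms
  by (auto simp: emeasure_eq_measure intro!: prob_space_uniform_measure)

lemma kern_cong: "cell Q s = cell Q t \<Longrightarrow> kern N Q s = kern N Q t"
  by (simp add: kern_def)

text \<open>Makes integrating out a coordinate a special case of averaging over cells, so that
  \<open>marg\<close> inherits every result on \<open>avg\<close>.\<close>

lemma (in prob_space) kern_trivial:
  assumes "s \<in> space M"
  shows "kern M {space M} s = M"
proof -
  have "partition_on (space M) {space M}" using not_empty by (auto simp: partition_on_def)
  then have "cell {space M} s = space M" using assms by (intro cell_eq) auto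
  moreover have "uniform_measure M (space M) = M"
    by (rule measure_eqI) (auto simp: emeasure_space_1 divide_ennreal_def)
  ultimately show ?thesis by (simp add: kern_def)
qed

lemma (in prob_space) trivial_partition: "finite_measurable_partition M {space M}"
  using not_empty by (auto simp: finite_measurable_partition_def partition_on_def)

lemma partition_sum_indicator:
  assumes "finite Q" "partition_on A Q" "s \<in> A"
  shows "(\<Sum>C\<in>Q. indicator C s * F C) = (F (cell Q s) :: real)"
proof -
  have "C = cell Q s \<longleftrightarrow> s \<in> C" if "C \<in> Q" for C
    using cell_eq[OF assms(2) that] cell_in[OF assms(2,3)] by blast
  then have "(\<Sum>C\<in>Q. indicator C s * F C) = (\<Sum>C\<in>Q. if C = cell Q s then F C else 0)"
    by (intro sum.cong refl) (simp add: indicator_def)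
  also have "\<dots> = F (cell Q s)"
    using assms cell_in[OF assms(2,3)] by simp
  finally show ?thesis .
qed

text \<open>The map to the cell takes values in a set of sets without a useful sigma-algebra.
  Writing the function as a finite sum of indicators over the cells replaces the
  composition.\<close>

lemma measurable_cell_dependent:
  assumes Q: "finite_measurable_partition N Q"
    and g: "g \<in> measurable M N"
    and F: "\<And>C. C \<in> Q \<Longrightarrow> F C \<in> borel_measurable M"
  shows "(\<lambda>x. F (cell Q (g x)) x :: real) \<in> borel_measurable M"
proof -
  note Q' = finite_measurable_partitionD[OF Q]
  have [measurable]: "\<And>C. C \<in> Q \<Longrightarrow> C \<in> sets N" using Q' by auto
  note g[measurable] F[measurable]
  have "(\<lambda>x. \<Sum>C\<in>Q. indicator C (g x) * F C x) \<in> borel_measurable M"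
    by (intro borel_measurable_sum) measurable
  then show ?thesis
    by (rule measurable_cong[THEN iffD1, rotated])
       (use Q' measurable_space[OF g] in \<open>subst partition_sum_indicator[where F="\<lambda>C. F C _"]; simp\<close>)
qed

text \<open>This is the defining property of the conditional expectation given the sigma-algebra
  generated by \<open>Q\<close>, with a function \<open>h\<close> constant on cells as test
  function. The integral splits over the finitely many cells.\<close>

lemma (in prob_space) integral_kern:
  fixes g h :: "'a \<Rightarrow> real"
  assumes Q: "finite_measurable_partition M Q" and g: "g \<in> bmeas M" and h: "h \<in> bmeas M"
    and hQ: "\<And>s t. s \<in> space M \<Longrightarrow> t \<in> space M \<Longrightarrow> cell Q s = cell Q t \<Longrightarrow> h s = h t"
  shows "(\<integral>s. (\<integral>y. g y \<partial>kern M Q s) * h s \<partial>M) = (\<integral>s. g s * h s \<partial>M)"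
proof -
  note Q' = finite_measurable_partitionD[OF Q]
  define rep where "rep = (\<lambda>C. SOME s. s \<in> C \<and> s \<in> space M)"
  have rep: "rep C \<in> C \<and> rep C \<in> space M" if "C \<in> Q" for C
  proof -
    have "C \<noteq> {}" "C \<subseteq> space M" using Q'(3) that by (auto simp: partition_on_def)
    then have "\<exists>s. s \<in> C \<and> s \<in> space M" by auto
    then show ?thesis unfolding rep_def by (rule someI_ex)
  qed
  have cell_rep: "cell Q (rep C) = C" if "C \<in> Q" for C
    using rep[OF that] cell_eq[OF Q'(3)] that by auto
  have *: "(\<integral>s. F s \<partial>M) = (\<Sum>C\<in>Q. \<integral>s. indicator C s * F s \<partial>M)" if "F \<in> bmeas M" for F :: "'a \<Rightarrow> real"
  proof -
    have "(\<integral>s. F s \<partial>M) = (\<integral>s. (\<Sum>C\<in>Q. indicator C s * F s) \<partial>M)"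
      using Q' by (intro Bochner_Integration.integral_cong refl, subst partition_sum_indicator) simp_all
    also have "\<dots> = (\<Sum>C\<in>Q. \<integral>s. indicator C s * F s \<partial>M)"
      using Q' that by (intro Bochner_Integration.integral_sum integrable_bmeas bmeas_mult) auto
    finally show ?thesis .
  qed
  have cavg: "(\<lambda>s. \<integral>y. g y \<partial>kern M Q s) \<in> bmeas M"
  proof -
    obtain B where B: "g \<in> borel_measurable M" "\<And>x. x \<in> space M \<Longrightarrow> \<bar>g x\<bar> \<le> B"
      using bmeasE[OF g] by metis
    have "(\<lambda>s. \<integral>y. g y \<partial>kern M Q s) \<in> borel_measurable M"
    proof -
      define J where "J = (\<lambda>C. \<integral>y. g y \<partial>(if measure M C = 0 then M else uniform_measure M C))"
      have "(\<lambda>s. \<integral>y. g y \<partial>kern M Q s) = (\<lambda>s. J (cell Q s))"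
        by (simp add: kern_def J_def)
      then show ?thesis
        using measurable_cell_dependent[OF Q measurable_ident, where F="\<lambda>C s. J C"] by (simp add: id_def)
    qed
    moreover have "(\<integral>y. g y \<partial>kern M Q s) \<in> {-B..B}" for s
      using B by (intro prob_space.integral_in_interval[OF prob_space_kern]) force+
    ultimately show ?thesis by (intro bmeas_intervalI)
  qed
  have "(\<integral>s. indicator C s * ((\<integral>y. g y \<partial>kern M Q s) * h s) \<partial>M) = (\<integral>s. indicator C s * (g s * h s) \<partial>M)"
    if C: "C \<in> Q" for C
  proof -
    have CM: "C \<in> sets M" using C Q' by auto
    have cC: "cell Q s = cell Q (rep C)" if "s \<in> C" for s
      using cell_eq[OF Q'(3) C] rep[OF C] that by simp
    have hC: "h s = h (rep C)" if "s \<in> C" for s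
      using cC[OF that] rep[OF C] that sets.sets_into_space[OF CM] by (intro hQ) auto
    have kC: "kern M Q s = kern M Q (rep C)" if "s \<in> C" for s
      using cC[OF that] by (rule kern_cong)
    have "(\<integral>s. indicator C s * ((\<integral>y. g y \<partial>kern M Q s) * h s) \<partial>M)
        = (\<integral>s. ((\<integral>y. g y \<partial>kern M Q (rep C)) * h (rep C)) * indicator C s \<partial>M)"
      by (intro Bochner_Integration.integral_cong refl) (simp add: indicator_def hC kC)
    also have "\<dots> = (\<integral>y. g y \<partial>kern M Q (rep C)) * h (rep C) * measure M C"
      using CM by simp
    also have "\<dots> = (\<integral>y. indicator C y * g y \<partial>M) * h (rep C)"
    \<comment> \<open>On a null cell both sides are zero, so the fallback in \<open>kern\<close>
      does not disturb the identity.\<close>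
    proof (cases "measure M C = 0")
      case True
      then have "AE s in M. s \<notin> C"
        using CM by (intro AE_iff_measurable[THEN iffD2, of C])
          (auto simp: emeasure_eq_measure dest: sets.sets_into_space)
      then have "(\<integral>y. indicator C y * g y \<partial>M) = (\<integral>y. 0 \<partial>M)"
        using g CM by (intro integral_cong_AE) (auto simp: indicator_def)
      then show ?thesis using True by simp
    next
      case False
      then have "measure M C > 0" by (simp add: zero_less_measure_iff)
      then show ?thesis
        using integral_uniform_measure[OF _ _ CM, of g] False g by (auto simp: kern_def cell_rep[OF C])
    qed
    also have "\<dots> = (\<integral>s. indicator C s * g s * h (rep C) \<partial>M)"
      by simp
    also have "\<dots> = (\<integral>s. indicator C s * (g s * h s) \<partial>M)"
      by (intro Bochner_Integration.integral_cong refl) (simp add: indicator_def hC)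
    finally show ?thesis .
  qed
  then show ?thesis
    using *[OF bmeas_mult[OF cavg h]] *[OF bmeas_mult[OF g h]] by simp
qed

subsection \<open>Relative entropy under averaging of coordinates\<close>

text \<open>The function a ln (a/b) is convex and homogeneous of degree one, so its graph lies above
  its tangent plane at (\<alpha>, \<beta>), which is the left-hand side. As this side is linear in
  (a, b), it can be integrated against averages.\<close>

lemma log_sum_tangent:
  fixes a b \<alpha> \<beta> :: real
  assumes "a > 0" "b > 0" "\<alpha> > 0" "\<beta> > 0"
  shows "a * ln \<alpha> - a * ln \<beta> + a - b * (\<alpha> / \<beta>) \<le> a * ln a - a * ln b"
proof -
  have "ln ((b * \<alpha>) / (a * \<beta>)) \<le> (b * \<alpha>) / (a * \<beta>) - 1"
    using assms by (intro ln_le_minus_one) auto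
  then have "a * (ln b + ln \<alpha> - ln a - ln \<beta>) \<le> a * ((b * \<alpha>) / (a * \<beta>) - 1)"
    using assms by (intro mult_left_mono) (auto simp: ln_mult ln_div)
  moreover have "a * ((b * \<alpha>) / (a * \<beta>) - 1) = b * (\<alpha> / \<beta>) - a"
    using assms by (simp add: field_simps)
  ultimately show ?thesis by (simp add: algebra_simps)
qed

context finite_product_prob_space
begin

abbreviation "\<Omega> \<equiv> PiM I M"

lemma update_space: "x \<in> space \<Omega> \<Longrightarrow> k \<in> I \<Longrightarrow> y \<in> space (M k) \<Longrightarrow> x(k := y) \<in> space \<Omega>"
  by (auto simp: space_PiM PiE_iff extensional_def)

lemma component_space: "x \<in> space \<Omega> \<Longrightarrow> k \<in> I \<Longrightarrow> x k \<in> space (M k)"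
  by (auto simp: space_PiM PiE_iff)

lemma measurable_update:
  assumes "k \<in> I" "f \<in> measurable N \<Omega>" "g \<in> measurable N (M k)"
  shows "(\<lambda>w. (f w)(k := g w)) \<in> measurable N \<Omega>"
  using assms by (intro measurable_fun_upd[where J=I]) auto

lemma bmeas_section:
  assumes "u \<in> bmeas \<Omega>" "x \<in> space \<Omega>" "k \<in> I"
  shows "(\<lambda>y. u (x(k := y))) \<in> bmeas (M k)"
    by (rule bmeas_compose[OF assms(1)], rule measurable_update[OF assms(3)],
    rule measurable_const[OF assms(2)], rule measurable_ident_sets[OF refl])

text \<open>Under \<open>\<Omega>\<close> this is the conditional expectation of \<open>u\<close>
  given the other coordinates and the cell of the \<open>k\<close>-th one.\<close>

definition avg :: "'a \<Rightarrow> 'b set set \<Rightarrow> (('a \<Rightarrow> 'b) \<Rightarrow> real) \<Rightarrow> ('a \<Rightarrow> 'b) \<Rightarrow> real" where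
  "avg k q u x = (\<integral>y. u (x(k := y)) \<partial>kern (M k) q (x k))"

definition marg :: "'a \<Rightarrow> (('a \<Rightarrow> 'b) \<Rightarrow> real) \<Rightarrow> ('a \<Rightarrow> 'b) \<Rightarrow> real" where
  "marg k u x = (\<integral>y. u (x(k := y)) \<partial>M k)"

text \<open>Pointwise counterpart of measurability with respect to the other coordinates and the
  cell of the \<open>k\<close>-th one. With the trivial partition it means independence of
  coordinate \<open>k\<close>.\<close>

definition invariant :: "'a \<Rightarrow> 'b set set \<Rightarrow> (('a \<Rightarrow> 'b) \<Rightarrow> real) \<Rightarrow> bool" where
  "invariant k q h \<longleftrightarrow> (\<forall>x\<in>space \<Omega>. \<forall>s\<in>space (M k). \<forall>t\<in>space (M k).
     cell q s = cell q t \<longrightarrow> h (x(k := s)) = h (x(k := t)))"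

abbreviation "cells i q \<equiv> finite_measurable_partition (M i) q"
abbreviation "triv i \<equiv> {space (M i)}"

lemma cells_triv: "cells k (triv k)"
  by (rule M.trivial_partition)

lemma marg_eq_avg: "x \<in> space \<Omega> \<Longrightarrow> k \<in> I \<Longrightarrow> marg k u x = avg k (triv k) u x"
  unfolding marg_def avg_def by (simp add: M.kern_trivial component_space)

text \<open>Valid at every point, null cells included, because \<open>kern\<close> is always a
  probability measure. A positive lower bound therefore survives any number of averages.\<close>

lemma avg_interval:
  assumes "u \<in> borel_measurable \<Omega>" "\<And>x. x \<in> space \<Omega> \<Longrightarrow> u x \<in> {a..b}" "x \<in> space \<Omega>" "k \<in> I"
  shows "avg k q u x \<in> {a..b}"
  unfolding avg_def
proof (rule prob_space.integral_in_interval[OF M.prob_space_kern])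
  show "(\<lambda>y. u (x(k := y))) \<in> borel_measurable (kern (M k) q (x k))"
    using measurable_compose[OF measurable_update[OF assms(4), of "\<lambda>_. x" "M k" "\<lambda>y. y"] assms(1)] assms(3)
    by (simp add: measurable_cong_sets[OF sets_kern refl])
qed (use assms update_space in auto)

lemma avg_measurable:
  assumes "u \<in> borel_measurable \<Omega>" "k \<in> I" "cells k q"
  shows "avg k q u \<in> borel_measurable \<Omega>"
proof -
  define F where "F = (\<lambda>C x. \<integral>y. u (x(k := y)) \<partial>(if measure (M k) C = 0 then M k else uniform_measure (M k) C))"
  have "F C \<in> borel_measurable \<Omega>" for C
  proof -
    define N where "N = (if measure (M k) C = 0 then M k else uniform_measure (M k) C)"
    have [measurable_cong]: "sets N = sets (M k)" by (auto simp: N_def)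
    interpret N: prob_space N
      unfolding N_def using M.prob_space_axioms
      by (auto simp: M.emeasure_eq_measure intro!: prob_space_uniform_measure)
    have "(\<lambda>x. \<integral>y. u (x(k := y)) \<partial>N) \<in> borel_measurable \<Omega>"
    proof (rule N.borel_measurable_lebesgue_integral)
      have "(\<lambda>w. (fst w)(k := snd w)) \<in> measurable (\<Omega> \<Otimes>\<^sub>M N) \<Omega>"
        using assms(2) by (intro measurable_update) measurable
      then show "(\<lambda>(x, y). u (x(k := y))) \<in> borel_measurable (\<Omega> \<Otimes>\<^sub>M N)"
        using assms(1) by (simp add: split_beta')
    qed
    then show ?thesis unfolding F_def N_def[symmetric] .
  qed
  then have "(\<lambda>x. F (cell q (x k)) x) \<in> borel_measurable \<Omega>"
    by (rule measurable_cell_dependent[OF assms(3), where g="\<lambda>x. x k" and F=F and M=\<Omega>,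
      OF measurable_component_singleton[OF assms(2)]])
  moreover have "(\<lambda>x. F (cell q (x k)) x) = avg k q u"
    unfolding F_def avg_def kern_def fun_eq_iff by (intro allI refl)
  ultimately show ?thesis by (simp only:)
qed

lemma avg_bmeas: 
  assumes "u \<in> bmeas \<Omega>" "k \<in> I" "cells k q"
  shows "avg k q u \<in> bmeas \<Omega>"
proof -
  obtain B where B: "u \<in> borel_measurable \<Omega>" "\<And>x. x \<in> space \<Omega> \<Longrightarrow> \<bar>u x\<bar> \<le> B"
    using bmeasE[OF assms(1)] by metis
  show ?thesis
    by (rule bmeas_intervalI[where a="-B" and b=B], rule avg_measurable[OF B(1) assms(2,3)],
      rule avg_interval) (use assms B in force)+
qed

lemma marg_bmeas: "u \<in> bmeas \<Omega> \<Longrightarrow> k \<in> I \<Longrightarrow> marg k u \<in> bmeas \<Omega>"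
  by (rule bmeas_cong[OF avg_bmeas[OF _ _ cells_triv]]) (auto simp: marg_eq_avg)

lemma integral_marg:
  assumes u: "u \<in> bmeas \<Omega>" and k: "k \<in> I"
  shows "(\<integral>x. marg k u x \<partial>\<Omega>) = (\<integral>x. u x \<partial>\<Omega>)"
proof -
  define J where "J = I - {k}"
  have J: "finite J" "k \<notin> J" "I = insert k J" using k finite_index by (auto simp: J_def)
  have *: "(\<integral>x. v x \<partial>\<Omega>) = (\<integral>x. (\<integral>y. v (x(k := y)) \<partial>M k) \<partial>PiM J M)" if "v \<in> bmeas \<Omega>" for v :: "_ \<Rightarrow> real"
    using product_integral_insert[OF J(1,2), of v] integrable_bmeas[OF that] J(3) by simp
  show ?thesis
    unfolding *[OF u] *[OF marg_bmeas[OF u k]] by (simp add: marg_def M.prob_space)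
qed

lemma avg_invariant: "invariant k q (avg k q u)"
  unfolding invariant_def avg_def
proof (intro ballI impI)
  fix x s t assume "cell q s = cell q t"
  then have "kern (M k) q s = kern (M k) q t" by (rule kern_cong)
  then show "(\<integral>y. u (x(k := s, k := y)) \<partial>kern (M k) q ((x(k := s)) k))
      = (\<integral>y. u (x(k := t, k := y)) \<partial>kern (M k) q ((x(k := t)) k))"
    by simp
qed

lemma marg_invariant: "invariant k q (marg k u)"
  unfolding invariant_def marg_def by simp

lemma invariant_avg:
  assumes "invariant k q u" "i \<noteq> k" "i \<in> I"
  shows "invariant k q (avg i r u)"
  unfolding invariant_def
proof (intro ballI impI)
  fix x s t assume *: "x \<in> space \<Omega>" "s \<in> space (M k)" "t \<in> space (M k)" "cell q s = cell q t"
  have "u (x(k := s, i := y)) = u (x(k := t, i := y))" if "y \<in> space (M i)" for y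
  proof -
    have "x(k := s, i := y) = x(i := y, k := s)" "x(k := t, i := y) = x(i := y, k := t)"
      using assms(2) by (auto simp: fun_eq_iff)
    moreover have "u (x(i := y, k := s)) = u (x(i := y, k := t))"
      using assms(1) update_space[OF *(1) assms(3) that] *(2-4) unfolding invariant_def by blast
    ultimately show ?thesis by simp
  qed
  then show "avg i r u (x(k := s)) = avg i r u (x(k := t))"
    unfolding avg_def using assms(2) by (auto intro!: Bochner_Integration.integral_cong)
qed

lemma invariant_cong:
  assumes "invariant k q u" "\<And>x. x \<in> space \<Omega> \<Longrightarrow> u x = v x" "k \<in> I"
  shows "invariant k q v"
  using assms update_space unfolding invariant_def by metis

text \<open>Both integrals are fibred along coordinate \<open>k\<close>; on each fibre
  \<open>h\<close> is constant on cells and \<open>integral_kern\<close> applies.\<close>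

lemma avg_adjoint:
  assumes u: "u \<in> bmeas \<Omega>" and h: "h \<in> bmeas \<Omega>" and k: "k \<in> I" and q: "cells k q"
    and inv: "invariant k q h"
  shows "(\<integral>x. avg k q u x * h x \<partial>\<Omega>) = (\<integral>x. u x * h x \<partial>\<Omega>)"
proof -
  have "(\<integral>x. avg k q u x * h x \<partial>\<Omega>) = (\<integral>x. marg k (\<lambda>x. avg k q u x * h x) x \<partial>\<Omega>)"
    by (intro integral_marg[symmetric] bmeas_mult avg_bmeas u h k q)
  also have "\<dots> = (\<integral>x. marg k (\<lambda>x. u x * h x) x \<partial>\<Omega>)"
  proof (rule Bochner_Integration.integral_cong[OF refl])
    fix x assume x: "x \<in> space \<Omega>"
    show "marg k (\<lambda>x. avg k q u x * h x) x = marg k (\<lambda>x. u x * h x) x"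
    proof -
      have "h (x(k := s)) = h (x(k := t))"
        if "s \<in> space (M k)" "t \<in> space (M k)" "cell q s = cell q t" for s t
        using inv x that unfolding invariant_def by blast
      from M.integral_kern[OF q bmeas_section[OF u x k] bmeas_section[OF h x k] this]
      show ?thesis unfolding marg_def avg_def fun_upd_upd fun_upd_same by blast
    qed
  qed
  also have "\<dots> = (\<integral>x. u x * h x \<partial>\<Omega>)"
    by (intro integral_marg bmeas_mult u h k)
  finally show ?thesis .
qed

lemma marg_adjoint:
  assumes "u \<in> bmeas \<Omega>" "h \<in> bmeas \<Omega>" "k \<in> I" "invariant k (triv k) h"
  shows "(\<integral>x. marg k u x * h x \<partial>\<Omega>) = (\<integral>x. u x * h x \<partial>\<Omega>)"
  using avg_adjoint[OF assms(1,2,3) cells_triv assms(4)] assms(3)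
  by (simp add: marg_eq_avg cong: Bochner_Integration.integral_cong)

text \<open>Fubini: the kernel for one coordinate depends only on that coordinate, which averaging
  over the other leaves untouched.\<close>

lemma avg_commute:
  assumes u: "u \<in> bmeas \<Omega>" and ij: "i \<noteq> j" "i \<in> I" "j \<in> I" and x: "x \<in> space \<Omega>"
  shows "avg i q (avg j r u) x = avg j r (avg i q u) x"
proof -
  define A where "A = kern (M i) q (x i)"
  define B where "B = kern (M j) r (x j)"
  interpret A: prob_space A unfolding A_def by (rule M.prob_space_kern)
  interpret B: prob_space B unfolding B_def by (rule M.prob_space_kern)
  interpret AB: pair_prob_space A B ..
  have [measurable_cong]: "sets A = sets (M i)" "sets B = sets (M j)" by (auto simp: A_def B_def)
  have "(\<lambda>w. x(i := fst w, j := snd w)) \<in> measurable (A \<Otimes>\<^sub>M B) \<Omega>"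
    using ij(2,3) x by (intro measurable_update measurable_const) measurable
  then have "(\<lambda>(y, z). u (x(i := y, j := z))) \<in> bmeas (A \<Otimes>\<^sub>M B)"
    using bmeas_compose[OF u] by (simp add: split_beta')
  then have "integrable (A \<Otimes>\<^sub>M B) (\<lambda>(y, z). u (x(i := y, j := z)))"
    by (rule AB.integrable_bmeas)
  from AB.Fubini_integral[OF this]
  show ?thesis
    using ij(1) unfolding avg_def A_def B_def
    by (simp only: fun_upd_other[OF ij(1)] fun_upd_other[OF ij(1)[symmetric]] fun_upd_twist[OF ij(1)] split)
qed

lemma marg_avg_same:
  assumes u: "u \<in> bmeas \<Omega>" and k: "k \<in> I" and q: "cells k q" and x: "x \<in> space \<Omega>"
  shows "marg k (avg k q u) x = marg k u x"
  using M.integral_kern[OF q bmeas_section[OF u x k], of "\<lambda>_. 1"]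
  unfolding marg_def avg_def by simp

text \<open>For a probability density \<open>u\<close> this is the divergence of
  \<open>density \<Omega> u\<close> from \<open>\<Omega>\<close>, that is, minus the differential
  entropy.\<close>

definition Ent where "Ent u = (\<integral>x. u x * ln (u x) \<partial>\<Omega>)"

lemma Ent_cong: "(\<And>x. x \<in> space \<Omega> \<Longrightarrow> u x = v x) \<Longrightarrow> Ent u = Ent v"
  unfolding Ent_def by (intro Bochner_Integration.integral_cong) auto

lemma invariant_ln: "invariant k q u \<Longrightarrow> invariant k q (\<lambda>x. ln (u x))"
  unfolding invariant_def by metis

lemma invariant_divide:
  "invariant k q u \<Longrightarrow> invariant k q v \<Longrightarrow> invariant k q (\<lambda>x. u x / v x)"
  unfolding invariant_def by metis

text \<open>The difference on the right is the integral of p ln (p/b) with \<open>b\<close> the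
  marginal in coordinate \<open>i\<close>, and averaging over coordinate \<open>j\<close> maps the
  pair (p, b) to (\<alpha>, \<beta>). This is the data processing inequality for that map: the
  tangent inequality is integrated, and adjointness evaluates each term.\<close>

lemma Ent_avg_step:
  assumes p: "p \<in> borel_measurable \<Omega>" "m > 0" "\<And>x. x \<in> space \<Omega> \<Longrightarrow> p x \<in> {m..B}"
    and ij: "i \<noteq> j" "i \<in> I" "j \<in> I" and q: "cells j q"
  shows "Ent (avg j q p) - Ent (marg i (avg j q p)) \<le> Ent p - Ent (marg i p)"
proof -
  define b where "b = avg i (triv i) p"
  define \<alpha> where "\<alpha> = avg j q p"
  define \<beta> where "\<beta> = avg i (triv i) \<alpha>"
  note triv = cells_triv
  have pb: "p \<in> bmeas \<Omega>" using p(1,3) by (rule bmeas_intervalI)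
  have meas: "b \<in> borel_measurable \<Omega>" "\<alpha> \<in> borel_measurable \<Omega>" "\<beta> \<in> borel_measurable \<Omega>"
    unfolding b_def \<alpha>_def \<beta>_def by (intro avg_measurable p triv ij q)+
  have int: "b x \<in> {m..B}" "\<alpha> x \<in> {m..B}" "\<beta> x \<in> {m..B}" if "x \<in> space \<Omega>" for x
  proof -
    have \<alpha>: "\<alpha> x \<in> {m..B}" if "x \<in> space \<Omega>" for x
      unfolding \<alpha>_def by (rule avg_interval[OF p(1,3) that ij(3)])
    show "b x \<in> {m..B}" "\<alpha> x \<in> {m..B}" "\<beta> x \<in> {m..B}"
      unfolding b_def \<beta>_def
      using avg_interval[OF p(1,3) that ij(2)] avg_interval[OF meas(2) \<alpha> that ij(2)] \<alpha>[OF that] by auto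
  qed
  have bm: "b \<in> bmeas \<Omega>" "\<alpha> \<in> bmeas \<Omega>" "\<beta> \<in> bmeas \<Omega>"
    using bmeas_intervalI meas int by blast+
  have lm: "(\<lambda>x. ln (b x)) \<in> bmeas \<Omega>" "(\<lambda>x. ln (\<alpha> x)) \<in> bmeas \<Omega>" "(\<lambda>x. ln (\<beta> x)) \<in> bmeas \<Omega>"
    "(\<lambda>x. ln (p x)) \<in> bmeas \<Omega>"
    using bmeas_ln meas int p by blast+
  have rm: "(\<lambda>x. \<alpha> x / \<beta> x) \<in> bmeas \<Omega>"
    using bmeas_divide[OF bm(2) meas(3) p(2)] int by auto
  \<comment> \<open>\<open>\<beta>\<close> arises from \<open>\<alpha>\<close> by averaging over
    \<open>i\<close> and from \<open>b\<close> by averaging over \<open>j\<close>; both descriptions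
    are needed to move averages across the logarithms.\<close>
  have \<beta>_eq: "\<beta> x = avg j q b x" if "x \<in> space \<Omega>" for x
    unfolding \<beta>_def b_def \<alpha>_def using that by (intro avg_commute pb ij)
  have inv_b: "invariant i (triv i) b" and inv_\<alpha>: "invariant j q \<alpha>" and inv_\<beta>: "invariant i (triv i) \<beta>"
    unfolding b_def \<alpha>_def \<beta>_def by (rule avg_invariant)+
  have inv_\<beta>': "invariant j q \<beta>"
    unfolding \<beta>_def by (intro invariant_avg inv_\<alpha> ij)
  have 1: "(\<integral>x. p x * ln (b x) \<partial>\<Omega>) = Ent b"
    using avg_adjoint[OF pb lm(1) ij(2) triv[of i] invariant_ln[OF inv_b]] unfolding b_def Ent_def by simp
  have 2: "(\<integral>x. p x * ln (\<alpha> x) \<partial>\<Omega>) = Ent \<alpha>"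
    using avg_adjoint[OF pb lm(2) ij(3) q invariant_ln[OF inv_\<alpha>]] unfolding \<alpha>_def Ent_def by simp
  have 3: "(\<integral>x. p x * ln (\<beta> x) \<partial>\<Omega>) = Ent \<beta>"
    using avg_adjoint[OF pb lm(3) ij(3) q invariant_ln[OF inv_\<beta>']]
      avg_adjoint[OF bm(2) lm(3) ij(2) triv[of i] invariant_ln[OF inv_\<beta>]]
    unfolding Ent_def \<alpha>_def[symmetric] \<beta>_def[symmetric] by simp
  \<comment> \<open>The slope \<open>\<alpha> / \<beta>\<close> is invariant in \<open>j\<close>, so
    \<open>b\<close> may be replaced by its average \<open>\<beta>\<close>, which cancels the
    denominator. The two linear terms of the tangent inequality then cancel each other.\<close>
  have 4: "(\<integral>x. b x * (\<alpha> x / \<beta> x) \<partial>\<Omega>) = (\<integral>x. p x \<partial>\<Omega>)"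
  proof -
    have "(\<integral>x. b x * (\<alpha> x / \<beta> x) \<partial>\<Omega>) = (\<integral>x. avg j q b x * (\<alpha> x / \<beta> x) \<partial>\<Omega>)"
      by (intro avg_adjoint[symmetric] bm rm ij q invariant_divide inv_\<alpha> inv_\<beta>')
    also have "\<dots> = (\<integral>x. \<alpha> x * 1 \<partial>\<Omega>)"
      using int p(2) by (intro Bochner_Integration.integral_cong refl) (force simp flip: \<beta>_eq)
    also have "\<dots> = (\<integral>x. p x * 1 \<partial>\<Omega>)"
      unfolding \<alpha>_def by (intro avg_adjoint pb ij q) (auto simp: invariant_def)
    finally show ?thesis by simp
  qed
  have "(\<integral>x. p x * ln (\<alpha> x) - p x * ln (\<beta> x) + p x - b x * (\<alpha> x / \<beta> x) \<partial>\<Omega>)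
      \<le> (\<integral>x. p x * ln (p x) - p x * ln (b x) \<partial>\<Omega>)"
  proof (rule integral_mono)
    show "p x * ln (\<alpha> x) - p x * ln (\<beta> x) + p x - b x * (\<alpha> x / \<beta> x) \<le> p x * ln (p x) - p x * ln (b x)"
      if "x \<in> space \<Omega>" for x
      using int[OF that] p(3)[OF that] p(2) by (intro log_sum_tangent) auto
  qed (intro integrable_bmeas bmeas_add bmeas_diff bmeas_mult pb lm bm rm)+
  also have "(\<integral>x. p x * ln (\<alpha> x) - p x * ln (\<beta> x) + p x - b x * (\<alpha> x / \<beta> x) \<partial>\<Omega>) = Ent \<alpha> - Ent \<beta>"
    by (subst Bochner_Integration.integral_diff Bochner_Integration.integral_add;
        (intro integrable_bmeas bmeas_add bmeas_diff bmeas_mult pb lm bm rm)?)+ (simp add: 2 3 4[simplified])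
  also have "(\<integral>x. p x * ln (p x) - p x * ln (b x) \<partial>\<Omega>) = Ent p - Ent b"
    by (subst Bochner_Integration.integral_diff;
        (intro integrable_bmeas bmeas_mult pb lm)?) (simp add: 1 Ent_def)
  also have "Ent b = Ent (marg i p)"
    unfolding b_def by (rule Ent_cong) (simp add: marg_eq_avg ij)
  also have "Ent \<beta> = Ent (marg i (avg j q p))"
    unfolding \<beta>_def \<alpha>_def by (rule Ent_cong) (simp add: marg_eq_avg ij)
  finally show ?thesis unfolding \<alpha>_def .
qed

text \<open>For a density \<open>u\<close> this is the dual total correlation, the differential entropies
  being taken relative to \<open>\<Omega>\<close>.\<close>

definition dtc where "dtc u = (real (card I) - 1) * Ent u - (\<Sum>i\<in>I. Ent (marg i u))"

text \<open>Adapted to averaging over \<open>j\<close>: the differences with i distinct from j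
  decrease by \<open>Ent_avg_step\<close>, while the last term does not change, because integrating
  out \<open>j\<close> absorbs the average.\<close>

lemma dtc_eq:
  assumes "j \<in> I"
  shows "dtc u = (\<Sum>i\<in>I - {j}. Ent u - Ent (marg i u)) - Ent (marg j u)"
proof -
  have "real (card (I - {j})) = real (card I) - 1"
    using assms finite_index by (simp add: card_Diff_singleton) (metis One_nat_def Suc_leI card_gt_0_iff empty_iff of_nat_1 of_nat_diff)
  then show ?thesis
    using assms finite_index unfolding dtc_def by (simp add: sum_subtractf sum.remove)
qed

lemma dtc_avg:
  assumes p: "p \<in> borel_measurable \<Omega>" "m > 0" "\<And>x. x \<in> space \<Omega> \<Longrightarrow> p x \<in> {m..B}"
    and j: "j \<in> I" and q: "cells j q"
  shows "dtc (avg j q p) \<le> dtc p"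
proof -
  have "Ent (marg j (avg j q p)) = Ent (marg j p)"
    by (intro Ent_cong marg_avg_same bmeas_intervalI[OF p(1,3)] j q)
  moreover have "(\<Sum>i\<in>I - {j}. Ent (avg j q p) - Ent (marg i (avg j q p)))
      \<le> (\<Sum>i\<in>I - {j}. Ent p - Ent (marg i p))"
    by (intro sum_mono Ent_avg_step[OF p(1,2,3)]) (use j q in auto)
  ultimately show ?thesis unfolding dtc_eq[OF j] by linarith
qed

text \<open>With \<open>js\<close> listing \<open>I\<close> this is the conditional expectation
  given the cells of all coordinates; with trivial partitions it integrates everything out.\<close>

definition avgs where "avgs Q js u = foldr (\<lambda>j. avg j (Q j)) js u"

lemma avgs_simps[simp]: "avgs Q [] u = u" "avgs Q (j # js) u = avg j (Q j) (avgs Q js u)"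
  by (auto simp: avgs_def)

lemma avgs_bounds:
  assumes p: "p \<in> borel_measurable \<Omega>" "\<And>x. x \<in> space \<Omega> \<Longrightarrow> p x \<in> {m..B}"
    and Q: "\<And>i. i \<in> I \<Longrightarrow> cells i (Q i)" and "set js \<subseteq> I"
  shows "avgs Q js p \<in> borel_measurable \<Omega> \<and> (\<forall>x\<in>space \<Omega>. avgs Q js p x \<in> {m..B})"
  using assms(4)
proof (induction js)
  case (Cons j js)
  then have "avgs Q js p \<in> borel_measurable \<Omega>" "\<And>x. x \<in> space \<Omega> \<Longrightarrow> avgs Q js p x \<in> {m..B}" "j \<in> I"
    by auto
  then show ?case unfolding avgs_simps using avg_measurable avg_interval Q by blast
qed (use p in auto)

lemma dtc_avgs:
  assumes p: "p \<in> borel_measurable \<Omega>" "m > 0" "\<And>x. x \<in> space \<Omega> \<Longrightarrow> p x \<in> {m..B}"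
    and Q: "\<And>i. i \<in> I \<Longrightarrow> cells i (Q i)" and "set js \<subseteq> I"
  shows "dtc (avgs Q js p) \<le> dtc p"
  using assms(5)
proof (induction js)
  case (Cons j js)
  have "dtc (avg j (Q j) (avgs Q js p)) \<le> dtc (avgs Q js p)"
    by (rule dtc_avg[OF _ p(2)]) (use avgs_bounds[OF p(1,3) Q, of js] Cons Q in auto)
  then show ?case using Cons by simp
qed simp

lemma avgs_invariant:
  assumes "set js \<subseteq> I" "j \<in> set js"
  shows "invariant j (Q j) (avgs Q js p)"
  using assms
proof (induction js)
  case (Cons k js)
  then show ?case
    by (cases "k = j") (auto intro: avg_invariant invariant_avg)
qed simp

lemma avgs_adjoint:
  assumes p: "p \<in> bmeas \<Omega>" and Q: "\<And>i. i \<in> I \<Longrightarrow> cells i (Q i)" and "set js \<subseteq> I"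
    and h: "h \<in> bmeas \<Omega>" "\<And>j. j \<in> I \<Longrightarrow> invariant j (Q j) h"
  shows "avgs Q js p \<in> bmeas \<Omega> \<and> (\<integral>x. avgs Q js p x * h x \<partial>\<Omega>) = (\<integral>x. p x * h x \<partial>\<Omega>)"
  using assms(3)
proof (induction js)
  case (Cons j js)
  then show ?case
    using avg_adjoint[of "avgs Q js p" h j "Q j"] h Q avg_bmeas[of "avgs Q js p" j "Q j"] by auto
qed (use p in auto)

text \<open>One coordinate is changed at a time, through hybrid points that follow \<open>y\<close>
  on \<open>J\<close> and \<open>x\<close> elsewhere. Each change stays within a cell.\<close>

lemma invariant_all_eq:
  assumes inv: "\<And>i. i \<in> I \<Longrightarrow> invariant i (Q i) u"
    and xy: "x \<in> space \<Omega>" "y \<in> space \<Omega>" "\<And>i. i \<in> I \<Longrightarrow> cell (Q i) (x i) = cell (Q i) (y i)"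
  shows "u x = u y"
proof -
  have "u (\<lambda>i. if i \<in> J then y i else x i) = u x \<and> (\<lambda>i. if i \<in> J then y i else x i) \<in> space \<Omega>"
    if "finite J" "J \<subseteq> I" for J
    using that
  proof (induction J)
    case (insert k J)
    define z where "z = (\<lambda>i. if i \<in> J then y i else x i)"
    have z: "u z = u x" "z \<in> space \<Omega>" using insert by (auto simp: z_def)
    have k: "k \<in> I" using insert by auto
    have "(\<lambda>i. if i \<in> insert k J then y i else x i) = z(k := y k)"
      by (auto simp: z_def)
    moreover have "u (z(k := y k)) = u (z(k := x k))"
      using inv[OF k] z(2) xy(3)[OF k] component_space[OF xy(1) k] component_space[OF xy(2) k]
      unfolding invariant_def by metis
    moreover have "z(k := x k) = z" using insert by (auto simp: z_def)
    moreover have "z(k := y k) \<in> space \<Omega>"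
      by (intro update_space z k component_space xy)
    ultimately show ?case using z by metis
  qed (use xy in auto)
  from this[OF finite_index order_refl]
  moreover have "(\<lambda>i. if i \<in> I then y i else x i) = y"
    using xy by (auto simp: space_PiM PiE_iff extensional_def)
  ultimately show ?thesis by auto
qed

definition box where "box Q x = (\<Pi>\<^sub>E i\<in>I. cell (Q i) (x i))"

lemma box_sets:
  assumes "\<And>i. i \<in> I \<Longrightarrow> cells i (Q i)" "x \<in> space \<Omega>"
  shows "box Q x \<in> sets \<Omega>"
  unfolding box_def
proof (intro sets_PiM_I_finite finite_index)
  show "cell (Q i) (x i) \<in> sets (M i)" if "i \<in> I" for i
    using finite_measurable_partitionD(2)[OF assms(1)[OF that]]
      cell_in(1)[OF finite_measurable_partitionD(3)[OF assms(1)[OF that]] component_space[OF assms(2) that]]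
    by (rule subsetD)
qed

lemma box_mem_iff:
  assumes "\<And>i. i \<in> I \<Longrightarrow> cells i (Q i)" "x \<in> space \<Omega>" "y \<in> space \<Omega>"
  shows "y \<in> box Q x \<longleftrightarrow> (\<forall>i\<in>I. cell (Q i) (y i) = cell (Q i) (x i))"
proof -
  have "y i \<in> cell (Q i) (x i) \<longleftrightarrow> cell (Q i) (y i) = cell (Q i) (x i)" if "i \<in> I" for i
  proof -
    note p = finite_measurable_partitionD(3)[OF assms(1)[OF that]]
    show ?thesis
      using cell_in[OF p component_space[OF assms(2) that]] cell_in[OF p component_space[OF assms(3) that]]
        cell_eq[OF p, of "cell (Q i) (x i)" "y i"] by auto
  qed
  moreover have "y \<in> extensional I" using assms(3) by (auto simp: space_PiM PiE_iff)
  ultimately show ?thesis by (auto simp: box_def PiE_iff)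
qed

text \<open>The indicator of the box is itself invariant and so admissible as \<open>h\<close>,
  while \<open>u\<close> is constant on the box. The product form avoids division by the measure of
  a possibly null box.\<close>

lemma invariant_value:
  assumes Q: "\<And>i. i \<in> I \<Longrightarrow> cells i (Q i)"
    and inv: "\<And>i. i \<in> I \<Longrightarrow> invariant i (Q i) u"
    and adj: "\<And>h. h \<in> bmeas \<Omega> \<Longrightarrow> (\<And>i. i \<in> I \<Longrightarrow> invariant i (Q i) h) \<Longrightarrow>
      (\<integral>x. u x * h x \<partial>\<Omega>) = (\<integral>x. p x * h x \<partial>\<Omega>)"
    and x: "x \<in> space \<Omega>"
  shows "u x * measure \<Omega> (box Q x) = (\<integral>y. p y * indicator (box Q x) y \<partial>\<Omega>)"
proof -
  have 1: "(\<integral>y. u y * indicator (box Q x) y \<partial>\<Omega>) = (\<integral>y. p y * indicator (box Q x) y \<partial>\<Omega>)"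
  proof (rule adj)
    show "indicat_real (box Q x) \<in> bmeas \<Omega>"
      using box_sets[OF Q x] by auto
    show "invariant i (Q i) (indicat_real (box Q x))" if "i \<in> I" for i
      unfolding invariant_def indicator_def
      using box_mem_iff[OF Q x] update_space that by (auto simp: fun_upd_def)
  qed
  have "(\<integral>y. u y * indicator (box Q x) y \<partial>\<Omega>) = (\<integral>y. u x * indicator (box Q x) y \<partial>\<Omega>)"
    by (intro Bochner_Integration.integral_cong refl)
      (auto simp: indicator_def box_mem_iff[OF Q x] intro!: invariant_all_eq[OF inv x, symmetric])
  also have "\<dots> = u x * measure \<Omega> (box Q x)"
    using box_sets[OF Q x] by simp
  finally show ?thesis using 1 by simp
qed

end

subsection \<open>Dual total correlation of discretizations\<close>

lemma simple_functionI_fibres: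
  assumes "finite (X ` space M)"
    "\<And>x. x \<in> space M \<Longrightarrow> {y \<in> space M. X y = X x} \<in> sets M"
  shows "simple_function M X"
  unfolding simple_function_def
proof (intro conjI ballI assms(1))
  fix v assume "v \<in> X ` space M"
  then obtain x where "x \<in> space M" "v = X x" by auto
  moreover have "X -` {X x} \<inter> space M = {y \<in> space M. X y = X x}" by auto
  ultimately show "X -` {v} \<inter> space M \<in> sets M" using assms(2) by simp
qed

lemma restrict_eq_iff: "restrict f A = restrict g A \<longleftrightarrow> (\<forall>x\<in>A. f x = g x)"
  by (metis restrict_apply' restrict_ext)

lemma (in prob_space) simple_bmeas:
  assumes "simple_function M X"
  shows "(\<lambda>x. F (X x) :: real) \<in> bmeas M"
proof -
  have sf: "simple_function M (\<lambda>x. F (X x))" using simple_function_compose1[OF assms] .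
  then have "finite ((\<lambda>x. \<bar>F (X x)\<bar>) ` space M)"
    using finite_imageI[OF simple_functionD(1)[OF sf], of abs] by (simp add: image_image)
  then show ?thesis
    by (intro bmeasI[where B="Max ((\<lambda>x. \<bar>F (X x)\<bar>) ` space M)"] borel_measurable_simple_function sf) auto
qed

lemma (in prob_space) integral_simple:
  assumes "simple_function M X"
  shows "(\<integral>x. F (X x) \<partial>M) = (\<Sum>v\<in>X ` space M. measure M (X -` {v} \<inter> space M) * (F v :: real))"
proof -
  note fin = simple_functionD(1)[OF assms] and ms = simple_functionD(2)[OF assms]
  have "(\<integral>x. F (X x) \<partial>M) = (\<integral>x. (\<Sum>v\<in>X ` space M. F v * indicator (X -` {v} \<inter> space M) x) \<partial>M)"
  proof (rule Bochner_Integration.integral_cong[OF refl])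
    fix x assume x: "x \<in> space M"
    have "(\<Sum>v\<in>X ` space M. F v * indicator (X -` {v} \<inter> space M) x) = (\<Sum>v\<in>X ` space M. if v = X x then F v else 0)"
      using x by (intro sum.cong refl) (auto simp: indicator_def)
    then show "F (X x) = (\<Sum>v\<in>X ` space M. F v * indicator (X -` {v} \<inter> space M) x)"
      using fin x by simp
  qed
  also have "\<dots> = (\<Sum>v\<in>X ` space M. \<integral>x. F v * indicator (X -` {v} \<inter> space M) x \<partial>M)"
    using ms by (intro Bochner_Integration.integral_sum integrable_bmeas bmeas_mult) auto
  finally show ?thesis using ms by (simp add: mult.commute)
qed

text \<open>In this form entropy visibly depends only on the fibres of \<open>X\<close>, so
  variables with different types but equal fibres can be exchanged.\<close>

lemma (in prob_space) shannon_entropy_eq: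
  assumes "simple_function M X"
  shows "shannon_entropy M X = - (\<integral>x. ln (measure M {y \<in> space M. X y = X x}) \<partial>M)"
proof -
  interpret information_space M "exp 1" by standard simp
  have "shannon_entropy M X = - (\<Sum>v\<in>X ` space M. measure M (X -` {v} \<inter> space M) * ln (measure M (X -` {v} \<inter> space M)))"
    unfolding shannon_entropy_def
    using entropy_simple_distributed[OF simple_distributedI[OF assms measure_nonneg refl]]
    by (simp add: log_def)
  also have "(\<Sum>v\<in>X ` space M. measure M (X -` {v} \<inter> space M) * ln (measure M (X -` {v} \<inter> space M)))
      = (\<integral>x. ln (measure M (X -` {X x} \<inter> space M)) \<partial>M)"
    by (rule integral_simple[OF assms, symmetric])
  also have "(\<lambda>x. X -` {X x} \<inter> space M) = (\<lambda>x. {y \<in> space M. X y = X x})" by auto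
  finally show ?thesis by (metis (no_types, lifting))
qed

lemma (in prob_space) shannon_cond_entropy_eq:
  assumes "simple_function M X" "simple_function M Y"
  shows "shannon_cond_entropy M X Y = shannon_entropy M (\<lambda>x. (Y x, X x)) - shannon_entropy M Y"
proof -
  interpret information_space M "exp 1" by standard simp
  show ?thesis
    unfolding shannon_entropy_def shannon_cond_entropy_def
    using entropy_chain_rule[OF assms(2,1)] by simp
qed

context finite_product_prob_space
begin

lemma cell_triv: "s \<in> space (M i) \<Longrightarrow> cell (triv i) s = space (M i)"
  by (rule cell_eq[OF finite_measurable_partitionD(3)[OF cells_triv]]) auto

lemma cell_triv_comp: "x \<in> space \<Omega> \<Longrightarrow> i \<in> I \<Longrightarrow> cell (triv i) (x i) = space (M i)"
  by (intro cell_triv component_space)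

text \<open>Each partition has finitely many null cells. Almost everywhere the logarithm of a
  product of cell measures then splits into a sum.\<close>

lemma AE_cell_pos:
  assumes Q: "\<And>i. i \<in> I \<Longrightarrow> cells i (Q i)"
  shows "AE x in \<Omega>. \<forall>i\<in>I. measure (M i) (cell (Q i) (x i)) > 0"
proof (intro AE_finite_allI finite_index AE_component)
  fix i assume i: "i \<in> I"
  note Q' = finite_measurable_partitionD[OF Q[OF i]]
  define N where "N = \<Union>{C\<in>Q i. measure (M i) C = 0}"
  have "N \<in> null_sets (M i)"
    unfolding N_def using Q' by (intro null_sets.finite_Union) (auto simp: null_sets_def M.emeasure_eq_measure)
  then have "AE s in M i. s \<notin> N" by (rule AE_not_in)
  then show "AE s in M i. measure (M i) (cell (Q i) s) > 0"
  proof (rule AE_mp, intro AE_I2 impI)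
    fix s assume "s \<in> space (M i)" "s \<notin> N"
    then show "measure (M i) (cell (Q i) s) > 0"
      using cell_in[OF Q'(3)] by (auto simp: N_def zero_less_measure_iff)
  qed
qed

end

locale product_density = finite_product_prob_space M I
  for M :: "'i \<Rightarrow> 'a measure" and I +
  fixes p :: "('i \<Rightarrow> 'a) \<Rightarrow> real" and m B :: real
  assumes p_measurable: "p \<in> borel_measurable (PiM I M)"
    and m_pos: "m > 0"
    and p_bounds: "\<And>x. x \<in> space (PiM I M) \<Longrightarrow> p x \<in> {m..B}"
    and p_integral: "(\<integral>x. p x \<partial>PiM I M) = 1"
begin

definition "\<mu> = density \<Omega> (\<lambda>x. ennreal (p x))"

lemma sets_\<mu>[simp, measurable_cong]: "sets \<mu> = sets \<Omega>" and space_\<mu>[simp]: "space \<mu> = space \<Omega>"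
  by (auto simp: \<mu>_def)

lemma p_bmeas: "p \<in> bmeas \<Omega>"
  using p_measurable p_bounds by (rule bmeas_intervalI)

lemma p_pos: "x \<in> space \<Omega> \<Longrightarrow> p x > 0"
  using p_bounds[of x] m_pos by auto

lemma bmeas_\<mu>: "bmeas \<mu> = bmeas \<Omega>"
  by (rule bmeas_sets_cong) simp

lemma integral_\<mu>: "g \<in> borel_measurable \<Omega> \<Longrightarrow> (\<integral>x. g x \<partial>\<mu>) = (\<integral>x. p x * (g x :: real) \<partial>\<Omega>)"
  unfolding \<mu>_def using p_measurable p_pos
  by (subst integral_density) (auto intro!: AE_I2 less_imp_le)

sublocale \<mu>: prob_space \<mu>
proof
  have "emeasure \<mu> (space \<mu>) = (\<integral>\<^sup>+x. ennreal (p x) \<partial>\<Omega>)"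
    unfolding \<mu>_def using p_measurable by (subst emeasure_density) (auto intro!: nn_integral_cong)
  also have "\<dots> = ennreal (\<integral>x. p x \<partial>\<Omega>)"
    using p_bmeas p_pos by (intro nn_integral_eq_integral integrable_bmeas AE_I2 less_imp_le) auto
  finally show "emeasure \<mu> (space \<mu>) = 1" by (simp add: p_integral)
qed

lemma measure_\<mu>: "A \<in> sets \<Omega> \<Longrightarrow> measure \<mu> A = (\<integral>x. p x * indicator A x \<partial>\<Omega>)"
  using integral_\<mu>[of "indicator A"] sets.sets_into_space[of A \<Omega>]
  by (simp add: Int_absorb2)

lemma AE_\<mu>: "AE x in \<Omega>. P x \<Longrightarrow> AE x in \<mu>. P x"
  unfolding \<mu>_def using p_measurable by (subst AE_density) (auto elim!: eventually_mono)

text \<open>Forgetting the coordinates outside \<open>J\<close> is the same as giving them the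
  trivial partition, so the fibres of every partial discretization are boxes in all
  coordinates.\<close>

lemma simple_cells:
  assumes Q: "\<And>i. i \<in> I \<Longrightarrow> cells i (Q i)" and J: "J \<subseteq> I"
  shows "simple_function \<mu> (\<lambda>x. \<lambda>i\<in>J. cell (Q i) (x i))"
    and "x \<in> space \<Omega> \<Longrightarrow> {y \<in> space \<mu>. (\<lambda>i\<in>J. cell (Q i) (y i)) = (\<lambda>i\<in>J. cell (Q i) (x i))}
      = box (\<lambda>i. if i \<in> J then Q i else triv i) x"
proof -
  let ?R = "\<lambda>i. if i \<in> J then Q i else triv i"
  have R: "\<And>i. i \<in> I \<Longrightarrow> cells i (?R i)" using Q cells_triv by auto
  show *: "{y \<in> space \<mu>. (\<lambda>i\<in>J. cell (Q i) (y i)) = (\<lambda>i\<in>J. cell (Q i) (x i))} = box ?R x"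
    if x: "x \<in> space \<Omega>" for x
  proof -
    have "y \<in> box ?R x \<longleftrightarrow> (\<lambda>i\<in>J. cell (Q i) (y i)) = (\<lambda>i\<in>J. cell (Q i) (x i))" if y: "y \<in> space \<Omega>" for y
    proof -
      have "y \<in> box ?R x \<longleftrightarrow> (\<forall>i\<in>I. cell (?R i) (y i) = cell (?R i) (x i))"
        by (rule box_mem_iff[where Q="?R", OF R x y])
      also have "\<dots> \<longleftrightarrow> (\<forall>i\<in>J. cell (Q i) (y i) = cell (Q i) (x i))"
        using J cell_triv_comp[OF x] cell_triv_comp[OF y] by auto
      finally show ?thesis unfolding restrict_def fun_eq_iff by auto
    qed
    moreover have "box ?R x \<subseteq> space \<Omega>"
      using sets.sets_into_space box_sets[where Q="?R", OF R x] by blast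
    ultimately show ?thesis by auto
  qed
  show "simple_function \<mu> (\<lambda>x. \<lambda>i\<in>J. cell (Q i) (x i))"
  proof (rule simple_functionI_fibres)
    have "(\<lambda>x. \<lambda>i\<in>J. cell (Q i) (x i)) ` space \<mu> \<subseteq> PiE J Q"
      using J cell_in(1)[OF finite_measurable_partitionD(3)[OF Q]] component_space by fastforce
    moreover have "finite (PiE J Q)"
      using finite_subset[OF J finite_index] finite_measurable_partitionD(1)[OF Q] J by (intro finite_PiE) auto
    ultimately show "finite ((\<lambda>x. \<lambda>i\<in>J. cell (Q i) (x i)) ` space \<mu>)" by (rule finite_subset)
    show "{y \<in> space \<mu>. (\<lambda>i\<in>J. cell (Q i) (y i)) = (\<lambda>i\<in>J. cell (Q i) (x i))} \<in> sets \<mu>" if "x \<in> space \<mu>" for x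
      using * box_sets[where Q="?R", OF R] that by simp
  qed
qed

text \<open>The hypotheses \<open>inv\<close> and \<open>adj\<close> say that \<open>u\<close> is
  the conditional expectation of \<open>p\<close> given the cells in \<open>J\<close>. Its value is
  the ratio of the \<open>\<mu>\<close>-measure to the \<open>\<Omega>\<close>-measure of the box,
  almost everywhere; taking logarithms and integrating against \<open>\<mu>\<close> yields the
  entropy and one correction per coordinate of \<open>J\<close>.\<close>

lemma Ent_cells:
  assumes Q: "\<And>i. i \<in> I \<Longrightarrow> cells i (Q i)" and J: "J \<subseteq> I"
    and R: "R = (\<lambda>i. if i \<in> J then Q i else triv i)"
    and u: "u \<in> borel_measurable \<Omega>" "\<And>x. x \<in> space \<Omega> \<Longrightarrow> u x \<in> {m..B}"
    and inv: "\<And>i. i \<in> I \<Longrightarrow> invariant i (R i) u"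
    and adj: "\<And>h. h \<in> bmeas \<Omega> \<Longrightarrow> (\<And>i. i \<in> I \<Longrightarrow> invariant i (R i) h) \<Longrightarrow>
      (\<integral>x. u x * h x \<partial>\<Omega>) = (\<integral>x. p x * h x \<partial>\<Omega>)"
  shows "Ent u = - shannon_entropy \<mu> (\<lambda>x. \<lambda>i\<in>J. cell (Q i) (x i))
      - (\<Sum>i\<in>J. \<integral>x. ln (measure (M i) (cell (Q i) (x i))) \<partial>\<mu>)"
proof -
  have R': "\<And>i. i \<in> I \<Longrightarrow> cells i (R i)" using Q cells_triv by (auto simp: R)
  have lu: "(\<lambda>x. ln (u x)) \<in> bmeas \<Omega>" using bmeas_ln[OF u(1) m_pos u(2)] .
  have "Ent u = (\<integral>x. ln (u x) \<partial>\<mu>)"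
    unfolding Ent_def using adj[OF lu] invariant_ln inv lu by (simp add: integral_\<mu> bmeas_measurable)
  let ?W = "\<lambda>x. \<lambda>i\<in>J. cell (Q i) (x i)"
  have sc: "simple_function \<mu> ?W"
    by (rule simple_cells(1)[where Q=Q, OF _ J], rule Q)
  have 1: "shannon_entropy \<mu> ?W = - (\<integral>x. ln (measure \<mu> {y \<in> space \<mu>. ?W y = ?W x}) \<partial>\<mu>)"
    by (rule \<mu>.shannon_entropy_eq[OF sc])
  have b1: "(\<lambda>x. ln (measure \<mu> {y \<in> space \<mu>. ?W y = ?W x})) \<in> bmeas \<mu>"
    by (rule \<mu>.simple_bmeas[OF sc, where F="\<lambda>w. ln (measure \<mu> {y \<in> space \<mu>. ?W y = w})"])
  have b2: "(\<lambda>x. ln (measure (M i) (cell (Q i) (x i)))) \<in> bmeas \<mu>" if "i \<in> J" for i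
  proof -
    have "(\<lambda>x. ln (measure (M i) (?W x i))) \<in> bmeas \<mu>"
      by (rule \<mu>.simple_bmeas[OF sc, where F="\<lambda>w. ln (measure (M i) (w i))"])
    then show ?thesis using that by simp
  qed
  have pos: "AE x in \<mu>. \<forall>i\<in>I. measure (M i) (cell (R i) (x i)) > 0"
    by (rule AE_\<mu>, rule AE_cell_pos, rule R')
  have "AE x in \<mu>. ln (measure \<mu> {y \<in> space \<mu>. ?W y = ?W x})
      = ln (u x) + (\<Sum>i\<in>J. ln (measure (M i) (cell (Q i) (x i))))"
    using pos AE_space
  proof eventually_elim
    case (elim x)
    then have x: "x \<in> space \<Omega>" by simp
    have eq: "{y \<in> space \<mu>. ?W y = ?W x} = box R x" unfolding R by (rule simple_cells(2)[where Q=Q, OF _ J x], rule Q)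
    have pr: "measure \<Omega> (box R x) = (\<Prod>i\<in>I. measure (M i) (cell (R i) (x i)))"
      unfolding box_def
    proof (rule prob_times)
      fix i assume i: "i \<in> I"
      show "cell (R i) (x i) \<in> sets (M i)"
        using cell_in(1)[OF finite_measurable_partitionD(3)[OF R'[OF i]] component_space[OF x i]]
          finite_measurable_partitionD(2)[OF R'[OF i]] by blast
    qed
    have "measure \<mu> (box R x) = u x * measure \<Omega> (box R x)"
    proof -
      have "box R x \<in> sets \<Omega>" by (rule box_sets[OF _ x], rule R')
      then have "measure \<mu> (box R x) = (\<integral>y. p y * indicator (box R x) y \<partial>\<Omega>)" by (rule measure_\<mu>)
      also have "\<dots> = u x * measure \<Omega> (box R x)"
        by (rule invariant_value[where Q=R and u=u, OF _ _ _ x, symmetric]) (fact R', fact inv, fact adj)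
      finally show ?thesis .
    qed
    moreover have "u x > 0" using u(2)[OF x] m_pos by auto
    moreover have "measure \<Omega> (box R x) > 0"
      unfolding pr using elim by (intro prod_pos) auto
    ultimately have "ln (measure \<mu> (box R x)) = ln (u x) + ln (measure \<Omega> (box R x))"
      by (simp add: ln_mult)
    also have "ln (measure \<Omega> (box R x)) = (\<Sum>i\<in>I. ln (measure (M i) (cell (R i) (x i))))"
      unfolding pr using elim finite_index by (intro ln_prod) auto
    \<comment> \<open>Outside \<open>J\<close> the cell is the whole factor and contributes
      \<open>ln 1\<close>.\<close>
    also have "\<dots> = (\<Sum>i\<in>J. ln (measure (M i) (cell (Q i) (x i))))"
      using finite_index J cell_triv_comp[OF x]
      by (intro sum.mono_neutral_cong_right) (auto simp: R M.prob_space)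
    finally show ?case unfolding eq .
  qed
  then have "(\<integral>x. ln (measure \<mu> {y \<in> space \<mu>. ?W y = ?W x}) \<partial>\<mu>)
      = (\<integral>x. ln (u x) + (\<Sum>i\<in>J. ln (measure (M i) (cell (Q i) (x i)))) \<partial>\<mu>)"
    using lu b1 b2 unfolding bmeas_\<mu>[symmetric]
    by (intro integral_cong_AE bmeas_measurable bmeas_add bmeas_sum)
  also have "\<dots> = (\<integral>x. ln (u x) \<partial>\<mu>) + (\<Sum>i\<in>J. \<integral>x. ln (measure (M i) (cell (Q i) (x i))) \<partial>\<mu>)"
    using lu b2 unfolding bmeas_\<mu>[symmetric]
    by (simp add: Bochner_Integration.integral_add Bochner_Integration.integral_sum \<mu>.integrable_bmeas bmeas_sum)
  finally show ?thesis using 1 \<open>Ent u = _\<close> by simp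
qed

text \<open>For the fully averaged density \<open>g\<close> there is equality with
  \<open>dtc g\<close>: each correction \<open>l j\<close> occurs card I - 1 times with either sign
  and cancels. The inequality is the decrease of \<open>dtc\<close> under averaging.\<close>

theorem DTC_finite_le_dtc:
  assumes Q: "\<And>i. i \<in> I \<Longrightarrow> cells i (Q i)"
  shows "DTC_finite \<mu> I (\<lambda>i x. cell (Q i) (x i)) \<le> dtc p"
proof -
  obtain js where js: "set js = I" using finite_list[OF finite_index] by blast
  define g where "g = avgs Q js p"
  define H where "H = (\<lambda>J. shannon_entropy \<mu> (\<lambda>x. \<lambda>i\<in>J. cell (Q i) (x i)))"
  define l where "l = (\<lambda>i. \<integral>x. ln (measure (M i) (cell (Q i) (x i))) \<partial>\<mu>)"
  have g: "g \<in> borel_measurable \<Omega>" "\<And>x. x \<in> space \<Omega> \<Longrightarrow> g x \<in> {m..B}"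
    using avgs_bounds[OF p_measurable p_bounds Q, of js] js by (auto simp: g_def)
  have gb: "g \<in> bmeas \<Omega>" using g by (rule bmeas_intervalI)
  have ginv: "invariant i (Q i) g" if "i \<in> I" for i
    unfolding g_def using that js by (intro avgs_invariant) auto
  have gadj: "(\<integral>x. g x * h x \<partial>\<Omega>) = (\<integral>x. p x * h x \<partial>\<Omega>)"
    if "h \<in> bmeas \<Omega>" "\<And>i. i \<in> I \<Longrightarrow> invariant i (Q i) h" for h
    unfolding g_def using avgs_adjoint[OF p_bmeas Q _ that, of js] js by auto
  have Eg: "Ent g = - H I - (\<Sum>i\<in>I. l i)"
    unfolding H_def l_def
    by (rule Ent_cells[where R="\<lambda>i. if i \<in> I then Q i else triv i", OF Q order_refl refl g])
      (auto intro: ginv gadj)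
  have Em: "Ent (marg i g) = - H (I - {i}) - (\<Sum>j\<in>I - {i}. l j)" if i: "i \<in> I" for i
    unfolding H_def l_def
  proof (rule Ent_cells[where R="\<lambda>j. if j \<in> I - {i} then Q j else triv j", OF Q Diff_subset refl])
    show "marg i g \<in> borel_measurable \<Omega>"
      using marg_bmeas[OF gb i] by (rule bmeas_measurable)
    show "marg i g x \<in> {m..B}" if "x \<in> space \<Omega>" for x
      using avg_interval[OF g that i] by (simp add: marg_eq_avg that i)
    show "invariant j (if j \<in> I - {i} then Q j else triv j) (marg i g)" if "j \<in> I" for j
    proof (cases "j = i")
      case False
      then have "invariant j (Q j) (avg i (triv i) g)"
        by (intro invariant_avg ginv that i) auto
      then have "invariant j (Q j) (marg i g)"
        by (rule invariant_cong) (simp_all add: marg_eq_avg i that)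
      then show ?thesis using False that by simp
    qed (simp add: marg_invariant)
    show "(\<integral>x. marg i g x * h x \<partial>\<Omega>) = (\<integral>x. p x * h x \<partial>\<Omega>)"
      if h: "h \<in> bmeas \<Omega>" "\<And>j. j \<in> I \<Longrightarrow> invariant j (if j \<in> I - {i} then Q j else triv j) h" for h
    proof -
      have hi: "invariant i (triv i) h" using h(2)[OF i] by simp
      have "cell (triv i) s = cell (triv i) t" if "s \<in> space (M i)" "t \<in> space (M i)" for s t
        using that by (simp add: cell_triv)
      \<comment> \<open>Any two points share the trivial cell, so independence of coordinate
        \<open>i\<close> is stronger than invariance on the cells of \<open>Q i\<close>. This allows
        \<open>gadj\<close> to be used for \<open>h\<close>.\<close>
      then have hQ: "invariant i (Q i) h" using hi unfolding invariant_def by blast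
      have "(\<integral>x. marg i g x * h x \<partial>\<Omega>) = (\<integral>x. g x * h x \<partial>\<Omega>)"
        by (rule marg_adjoint[OF gb h(1) i hi])
      also have "\<dots> = (\<integral>x. p x * h x \<partial>\<Omega>)"
        using h(2) hQ by (intro gadj h(1)) (metis DiffI empty_iff insert_iff)
      finally show ?thesis .
    qed
  qed
  have cond: "shannon_cond_entropy \<mu> (\<lambda>x. cell (Q i) (x i)) (\<lambda>x. \<lambda>j\<in>I - {i}. cell (Q j) (x j)) = H I - H (I - {i})"
    if i: "i \<in> I" for i
  proof -
    let ?W = "\<lambda>J x. \<lambda>j\<in>J. cell (Q j) (x j)"
    note sW = simple_cells(1)[OF Q]
    have sI: "simple_function \<mu> (?W I)" and sI': "simple_function \<mu> (?W (I - {i}))"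
      by (rule sW; simp)+
    have si: "simple_function \<mu> (\<lambda>x. cell (Q i) (x i))"
      using simple_function_compose1[OF sI, of "\<lambda>w. w i"] i by simp
    \<comment> \<open>The pair from the chain rule and the tuple over all of \<open>I\<close> have
      the same fibres, hence the same entropy.\<close>
    have "((?W (I - {i}) y, cell (Q i) (y i)) = (?W (I - {i}) x, cell (Q i) (x i))) \<longleftrightarrow> ?W I y = ?W I x" for x y
      using i unfolding prod.inject restrict_eq_iff by auto
    then have "shannon_entropy \<mu> (\<lambda>x. (?W (I - {i}) x, cell (Q i) (x i))) = H I"
      unfolding H_def \<mu>.shannon_entropy_eq[OF sI] \<mu>.shannon_entropy_eq[OF simple_function_Pair[OF sI' si]]
      by presburger
    then show ?thesis
      unfolding \<mu>.shannon_cond_entropy_eq[OF si sI'] H_def by simp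
  qed
  have "dtc g = DTC_finite \<mu> I (\<lambda>i x. cell (Q i) (x i))"
  proof -
    have "(\<Sum>j\<in>I - {i}. l j) = (\<Sum>j\<in>I. l j) - l i" if "i \<in> I" for i
      using finite_index that by (simp add: sum_diff1)
    then have "dtc g = (real (card I) - 1) * (- H I - (\<Sum>i\<in>I. l i)) - (\<Sum>i\<in>I. - H (I - {i}) - ((\<Sum>j\<in>I. l j) - l i))"
      unfolding dtc_def Eg by (simp add: Em cong: sum.cong)
    also have "\<dots> = H I - (\<Sum>i\<in>I. H I - H (I - {i}))"
      by (simp add: sum.distrib sum_subtractf sum_negf algebra_simps)
    also have "\<dots> = DTC_finite \<mu> I (\<lambda>i x. cell (Q i) (x i))"
      unfolding DTC_finite_def using cond by (simp add: H_def)
    finally show ?thesis .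
  qed
  moreover have "dtc g \<le> dtc p"
    unfolding g_def by (rule dtc_avgs[OF p_measurable m_pos p_bounds Q]) (use js in auto)
  ultimately show ?thesis by simp
qed

text \<open>\<open>dtc p\<close> dominates the dual total correlation of the trivial discretization,
  whose variables are constant and have entropy zero.\<close>

lemma dtc_nonneg: "dtc p \<ge> 0"
proof -
  have "DTC_finite \<mu> I (\<lambda>i x. cell (triv i) (x i)) = 0"
  proof -
    let ?Z = "\<lambda>i x. cell (triv i) (x i)"
      have z: "shannon_entropy \<mu> X = 0" if "simple_function \<mu> X" "\<And>x y. x \<in> space \<Omega> \<Longrightarrow> y \<in> space \<Omega> \<Longrightarrow> X x = X y" for X :: "_ \<Rightarrow> 'z"
    proof -
      have "(\<integral>x. ln (measure \<mu> {y \<in> space \<mu>. X y = X x}) \<partial>\<mu>) = (\<integral>x. 0 \<partial>\<mu>)"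
      proof (rule Bochner_Integration.integral_cong[OF refl])
        fix x assume "x \<in> space \<mu>"
        then have "X y = X x" if "y \<in> space \<mu>" for y
          using that space_\<mu> \<open>\<And>x y. x \<in> space \<Omega> \<Longrightarrow> y \<in> space \<Omega> \<Longrightarrow> X x = X y\<close>[of y x] by simp
        then have "{y \<in> space \<mu>. X y = X x} = space \<mu>" by blast
        then show "ln (measure \<mu> {y \<in> space \<mu>. X y = X x}) = 0" by (simp only: \<mu>.prob_space ln_one)
      qed
      then show ?thesis using \<mu>.shannon_entropy_eq[OF that(1)] by simp
    qed
    let ?W = "\<lambda>J x. \<lambda>j\<in>J. cell (triv j) (x j)"
    have sW: "simple_function \<mu> (?W J)" if "J \<subseteq> I" for J
      by (rule simple_cells(1)[OF cells_triv that])
    have WI: "shannon_entropy \<mu> (?W J) = 0" if "J \<subseteq> I" for J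
      by (rule z[OF sW[OF that]]) (use that in \<open>auto simp: restrict_eq_iff cell_triv_comp\<close>)
    have "shannon_cond_entropy \<mu> (?Z i) (?W (I - {i})) = 0" if i: "i \<in> I" for i
    proof -
      have si: "simple_function \<mu> (?Z i)"
        using simple_function_compose1[OF sW[OF order_refl], of "\<lambda>w. w i"] i by simp
      have sI': "simple_function \<mu> (?W (I - {i}))" by (rule sW) auto
      have "shannon_entropy \<mu> (\<lambda>x. (?W (I - {i}) x, ?Z i x)) = 0"
        by (rule z[OF simple_function_Pair[OF sI' si]]) (use i in \<open>auto simp: restrict_eq_iff cell_triv_comp\<close>)
      then show ?thesis
        unfolding \<mu>.shannon_cond_entropy_eq[OF si sI'] using WI by simp
    qed
    then show ?thesis unfolding DTC_finite_def using WI by simp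
  qed
  then show ?thesis using DTC_finite_le_dtc[where Q=triv, OF cells_triv] by simp
qed

end

subsection \<open>A linearized Pinsker inequality\<close>

text \<open>A rearrangement of 3 (t - 1)^2 <= 2 (t + 2) (t ln t - t + 1). Isolating the logarithm
  makes the derivative of the difference rational, and it has the sign of (t - 1)^3, so the minimum
  is at t = 1, where both sides vanish.\<close>

lemma pinsker_log:
  fixes t :: real
  assumes "t > 0"
  shows "(t - 1) * (5 * t + 1) / (t\<^sup>2 + 2 * t) \<le> 2 * ln t"
proof -
  define F where "F = (\<lambda>t::real. 2 * ln t - (t - 1) * (5 * t + 1) / (t\<^sup>2 + 2 * t))"
  have D: "(F has_real_derivative 2 * (x - 1)^3 / (x\<^sup>2 + 2 * x)\<^sup>2) (at x)" if "x > 0" for x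
  proof -
    have nz: "x\<^sup>2 + 2 * x \<noteq> 0" using that by (simp add: add_pos_pos less_imp_neq[symmetric])
    have "2 / x - (((5 * x + 1) + (x - 1) * 5) * (x\<^sup>2 + 2 * x) - (x - 1) * (5 * x + 1) * (2 * x + 2)) / ((x\<^sup>2 + 2 * x) * (x\<^sup>2 + 2 * x))
        = 2 * (x - 1)^3 / (x\<^sup>2 + 2 * x)\<^sup>2"
      using that nz by (simp add: divide_simps) (simp add: algebra_simps power2_eq_square power3_eq_cube)
    moreover have "(F has_real_derivative 2 / x - (((5 * x + 1) + (x - 1) * 5) * (x\<^sup>2 + 2 * x) - (x - 1) * (5 * x + 1) * (2 * x + 2)) / ((x\<^sup>2 + 2 * x) * (x\<^sup>2 + 2 * x))) (at x)"
      unfolding F_def using that nz by (auto intro!: derivative_eq_intros)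
    ultimately show ?thesis by simp
  qed
  have "F t \<ge> F 1"
  proof (cases "t \<ge> 1")
    case True
    show ?thesis
    proof (rule DERIV_nonneg_imp_nondecreasing[OF True])
      show "\<exists>y. (F has_real_derivative y) (at x) \<and> 0 \<le> y" if "1 \<le> x" "x \<le> t" for x
        using D[of x] that by (intro exI[of _ "2 * (x - 1)^3 / (x\<^sup>2 + 2 * x)\<^sup>2"]) auto
    qed
  next
    case False
    show ?thesis
    proof (rule DERIV_nonpos_imp_nonincreasing[of t 1])
      show "\<exists>y. (F has_real_derivative y) (at x) \<and> y \<le> 0" if "t \<le> x" "x \<le> 1" for x
      proof -
        have "(x - 1)^3 \<le> 0" using that by (simp add: power_le_zero_eq)
        then show ?thesis
          using D[of x] that assms by (intro exI[of _ "2 * (x - 1)^3 / (x\<^sup>2 + 2 * x)\<^sup>2"]) (auto intro!: divide_nonpos_nonneg)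
      qed
    qed (use False in auto)
  qed
  then show ?thesis by (simp add: F_def)
qed

text \<open>The quadratic estimate for \<open>W\<close>, scaled by \<open>v\<close>, is combined
  with the arithmetic-geometric mean inequality; keeping \<open>c\<close> free leaves a bound that
  can be integrated without Cauchy-Schwarz.\<close>

lemma pinsker_pointwise:
  fixes u v c :: real
  assumes "u \<ge> 0" "v > 0" "c > 0"
  shows "\<bar>u - v\<bar> \<le> c * (u + 2 * v) / 3 + (u * ln u - u * ln v - u + v) / (2 * c)"
proof -
  define W where "W = u * ln u - u * ln v - u + v"
  have W: "3 * (u - v)\<^sup>2 \<le> 2 * (u + 2 * v) * W"
  proof (cases "u = 0")
    case True
    then show ?thesis using assms by (simp add: W_def power2_eq_square)
  next
    case False
    then have u: "u > 0" using assms by simp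
    define t where "t = u / v"
    have t: "t > 0" "u = t * v" using u assms by (auto simp: t_def)
    have Wt: "W = v * (t * ln t - t + 1)"
      using t assms by (simp add: W_def ln_mult algebra_simps)
    have "(t - 1) * (5 * t + 1) \<le> 2 * ln t * (t\<^sup>2 + 2 * t)"
      using pinsker_log[OF t(1)] t by (simp add: divide_le_eq add_pos_pos)
    then have "3 * (t - 1)\<^sup>2 \<le> 2 * (t + 2) * (t * ln t - t + 1)"
      by (simp add: power2_eq_square algebra_simps)
    then have "v\<^sup>2 * (3 * (t - 1)\<^sup>2) \<le> v\<^sup>2 * (2 * (t + 2) * (t * ln t - t + 1))"
      by (intro mult_left_mono) auto
    then show ?thesis unfolding Wt t(2) by (simp add: power2_eq_square algebra_simps)
  qed
  have pos: "u + 2 * v > 0" using assms by simp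
  \<comment> \<open>The weight (u + 2 v) / 3 has the same integral as \<open>v\<close> whenever
    \<open>u\<close> and \<open>v\<close> have equal integrals, and it makes the quadratic term at
    most W / (2 c).\<close>
  define A where "A = c * (u + 2 * v) / 3"
  have A: "A > 0" using pos assms by (simp add: A_def)
  have "(u - v)\<^sup>2 / (4 * A) \<le> W / (2 * c)"
  proof -
    have "(u - v)\<^sup>2 / (4 * A) = 3 * (u - v)\<^sup>2 / (4 * c * (u + 2 * v))"
      using assms pos by (simp add: A_def field_simps)
    also have "\<dots> \<le> 2 * (u + 2 * v) * W / (4 * c * (u + 2 * v))"
      using W assms pos by (intro divide_right_mono) auto
    also have "\<dots> = W / (2 * c)" using pos assms by (simp add: divide_simps)
    finally show ?thesis .
  qed
  moreover have "\<bar>u - v\<bar> \<le> A + (u - v)\<^sup>2 / (4 * A)"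
  proof -
    have "0 \<le> (2 * A - \<bar>u - v\<bar>)\<^sup>2" by simp
    then have "4 * A * \<bar>u - v\<bar> \<le> 4 * A * A + (u - v)\<^sup>2"
      by (simp add: power2_eq_square algebra_simps)
    then show ?thesis using A by (simp add: field_simps power2_eq_square)
  qed
  ultimately show ?thesis unfolding A_def W_def by linarith
qed

text \<open>The pointwise inequality with v = a, integrated; the terms - u + v drop out because
  \<open>a\<close> is the mean. Mean zero is separate, as v > 0 is required there.\<close>

lemma (in prob_space) abs_deviation_le:
  fixes r :: "'a \<Rightarrow> real"
  assumes r: "r \<in> bmeas M" "\<And>s. s \<in> space M \<Longrightarrow> r s \<ge> 0" and c: "c > 0"
    and a: "a = (\<integral>s. r s \<partial>M)"
  shows "(\<integral>s. \<bar>r s - a\<bar> \<partial>M) \<le> c * a + ((\<integral>s. r s * ln (r s) \<partial>M) - a * ln a) / (2 * c)"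
proof -
  have a0: "a \<ge> 0" unfolding a using r(2) by (intro integral_nonneg_AE AE_I2) auto
  note [measurable] = bmeas_measurable[OF r(1)]
  have rl: "(\<lambda>s. r s * ln (r s)) \<in> bmeas M" using bmeas_xlnx[OF r] .
  show ?thesis
  proof (cases "a = 0")
    case True
    have "AE s in M. r s = 0"
      using integral_nonneg_eq_0_iff_AE[OF integrable_bmeas[OF r(1)]] True a r by auto
    then have "(\<integral>s. \<bar>r s - a\<bar> \<partial>M) = (\<integral>s. 0 \<partial>M)" "(\<integral>s. r s * ln (r s) \<partial>M) = (\<integral>s. 0 \<partial>M)"
      using True by (intro integral_cong_AE; auto)+
    then show ?thesis using True by simp
  next
    case False
    then have ap: "a > 0" using a0 by simp
    obtain B where B: "\<And>s. s \<in> space M \<Longrightarrow> \<bar>r s\<bar> \<le> B" using bmeasE[OF r(1)] by metis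
    have "(\<integral>s. \<bar>r s - a\<bar> \<partial>M) \<le> (\<integral>s. (c / 3 - ln a / (2 * c) - 1 / (2 * c)) * r s + r s * ln (r s) / (2 * c) + (2 * c * a / 3 + a / (2 * c)) \<partial>M)"
    proof (rule integral_mono)
      show "integrable M (\<lambda>s. \<bar>r s - a\<bar>)"
        by (intro integrable_abs integrable_bmeas bmeas_diff r) auto
      show "integrable M (\<lambda>s. (c / 3 - ln a / (2 * c) - 1 / (2 * c)) * r s + r s * ln (r s) / (2 * c) + (2 * c * a / 3 + a / (2 * c)))"
        unfolding divide_inverse by (intro integrable_bmeas bmeas_add bmeas_mult rl[unfolded divide_inverse] r bmeas_const)
      show "\<bar>r s - a\<bar> \<le> (c / 3 - ln a / (2 * c) - 1 / (2 * c)) * r s + r s * ln (r s) / (2 * c) + (2 * c * a / 3 + a / (2 * c))"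
        if "s \<in> space M" for s
        using pinsker_pointwise[OF r(2)[OF that] ap c] c by (simp add: algebra_simps add_divide_distrib diff_divide_distrib)
    qed
    also have "\<dots> = (c / 3 - ln a / (2 * c) - 1 / (2 * c)) * a + (\<integral>s. r s * ln (r s) \<partial>M) / (2 * c) + (2 * c * a / 3 + a / (2 * c))"
      using integrable_bmeas[OF r(1)] integrable_bmeas[OF rl] by (simp add: prob_space a)
    also have "\<dots> = c * a + ((\<integral>s. r s * ln (r s) \<partial>M) - a * ln a) / (2 * c)"
      using c by (simp add: field_simps)
    finally show ?thesis .
  qed
qed

subsection \<open>Moving a density to its mean\<close>

text \<open>Models one fibre of a density along a coordinate. Hence \<open>r\<close> need not be
  normalized: its mean is the value of the marginal density on that fibre.\<close>

locale mean_density = prob_space +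
  fixes r :: "'a \<Rightarrow> real"
  assumes r_bmeas: "r \<in> bmeas M" and r_nonneg: "\<And>s. s \<in> space M \<Longrightarrow> r s \<ge> 0"
begin

definition "mean = (\<integral>s. r s \<partial>M)"
definition "shortfall s = max 0 (mean - r s)"
definition "surplus s = max 0 (r s - mean)"
definition "deficit = (\<integral>s. shortfall s \<partial>M)"

text \<open>From a point \<open>s\<close> of the law with density \<open>r\<close>, stay with probability \<open>stay s\<close>, and otherwise
  move to a point drawn from the normalized density \<open>shortfall\<close>.\<close>

definition "stay s = (if deficit = 0 \<or> r s = 0 then 1 else min 1 (mean / r s))"
definition "move s y = (1 - stay s) * (shortfall y / deficit)"

lemma r_measurable[measurable]: "r \<in> borel_measurable M"
  using r_bmeas by (rule bmeas_measurable)

lemma mean_nonneg: "mean \<ge> 0"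
  unfolding mean_def using r_nonneg by (intro integral_nonneg_AE AE_I2) auto

lemma deficit_nonneg: "deficit \<ge> 0"
  unfolding deficit_def by (intro integral_nonneg_AE AE_I2) (simp add: shortfall_def)

lemma stay_range: "s \<in> space M \<Longrightarrow> 0 \<le> stay s \<and> stay s \<le> 1"
  using mean_nonneg r_nonneg[of s] by (auto simp: stay_def)

lemma shortfall_nonneg[simp]: "shortfall s \<ge> 0" and surplus_nonneg[simp]: "surplus s \<ge> 0"
  by (auto simp: shortfall_def surplus_def)

lemma bmeas_max0: "g \<in> bmeas M \<Longrightarrow> (\<lambda>s. max 0 (g s)) \<in> bmeas M"
proof (elim bmeasE)
  fix B assume "g \<in> borel_measurable M" "\<And>s. s \<in> space M \<Longrightarrow> \<bar>g s\<bar> \<le> B"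
  then show ?thesis by (intro bmeasI[where B=B]) fastforce+
qed

lemma excess_bmeas: "shortfall \<in> bmeas M" "surplus \<in> bmeas M"
  unfolding shortfall_def[abs_def] surplus_def[abs_def]
  by (intro bmeas_max0 bmeas_diff r_bmeas bmeas_const)+

lemma excess_measurable[measurable]: "shortfall \<in> borel_measurable M" "surplus \<in> borel_measurable M"
  using excess_bmeas by (auto dest: bmeas_measurable)

text \<open>Deviations from the mean integrate to zero. Surplus and shortfall thus balance, so that
  the excess mass exactly fills the gaps.\<close>

lemma deficit_eq: "(\<integral>s. surplus s \<partial>M) = deficit"
proof -
  have "(\<integral>s. surplus s \<partial>M) - deficit = (\<integral>s. surplus s - shortfall s \<partial>M)"
    unfolding deficit_def using excess_bmeas by (simp add: integrable_bmeas)
  also have "\<dots> = (\<integral>s. r s - mean \<partial>M)"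
    by (intro Bochner_Integration.integral_cong) (auto simp: shortfall_def surplus_def)
  also have "\<dots> = 0" using integrable_bmeas[OF r_bmeas] by (simp add: prob_space mean_def)
  finally show ?thesis by simp
qed

lemma deficit_abs: "(\<integral>s. \<bar>r s - mean\<bar> \<partial>M) = 2 * deficit"
proof -
  have "(\<integral>s. \<bar>r s - mean\<bar> \<partial>M) = (\<integral>s. surplus s + shortfall s \<partial>M)"
    by (intro Bochner_Integration.integral_cong) (auto simp: shortfall_def surplus_def)
  then show ?thesis
    using excess_bmeas deficit_eq by (simp add: integrable_bmeas deficit_def)
qed

lemma nn_deficit: "(\<integral>\<^sup>+s. ennreal (shortfall s) \<partial>M) = ennreal deficit"
  "(\<integral>\<^sup>+s. ennreal (surplus s) \<partial>M) = ennreal deficit"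
  using excess_bmeas deficit_eq
  by (simp_all add: nn_integral_eq_integral integrable_bmeas deficit_def)

lemma stay_measurable[measurable]: "stay \<in> borel_measurable M"
  unfolding stay_def by measurable

lemma move_integral:
  assumes "F \<in> borel_measurable M" "s \<in> space M"
  shows "(\<integral>\<^sup>+y. ennreal (move s y) * F y \<partial>M)
    = ennreal (1 - stay s) * (ennreal (1 / deficit) * (\<integral>\<^sup>+y. ennreal (shortfall y) * F y \<partial>M))"
proof -
  note assms(1)[measurable]
  have "ennreal (move s y) * F y = ennreal (1 - stay s) * (ennreal (1 / deficit) * (ennreal (shortfall y) * F y))" for y
  proof -
    have "move s y = (1 - stay s) * ((1 / deficit) * shortfall y)" by (simp add: move_def)
    moreover have 1: "0 \<le> 1 - stay s" and 2: "0 \<le> 1 / deficit"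
      using stay_range[OF assms(2)] deficit_nonneg by auto
    ultimately have "ennreal (move s y) = ennreal (1 - stay s) * (ennreal (1 / deficit) * ennreal (shortfall y))"
      by (simp only: ennreal_mult[OF 1 mult_nonneg_nonneg[OF 2 shortfall_nonneg]] ennreal_mult[OF 2 shortfall_nonneg])
    then show ?thesis by (simp only: mult.assoc)
  qed
  then show ?thesis by (simp add: nn_integral_cmult)
qed

lemma total_mass:
  assumes "s \<in> space M"
  shows "ennreal (stay s) + (\<integral>\<^sup>+y. ennreal (move s y) \<partial>M) = 1"
proof -
  have "(\<integral>\<^sup>+y. ennreal (move s y) \<partial>M) = ennreal (1 - stay s)"
  proof (cases "deficit = 0")
    case False
    then show ?thesis
      using move_integral[of "\<lambda>_. 1", OF _ assms] nn_deficit stay_range[OF assms] deficit_nonneg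
      by (simp add: ennreal_mult[symmetric])
  qed (simp add: move_def stay_def)
  then show ?thesis using stay_range[OF assms] by (simp add: ennreal_plus[symmetric] del: ennreal_plus)
qed

lemma r_mult_stay:
  assumes "deficit \<noteq> 0" "s \<in> space M"
  shows "r s * stay s = min (r s) mean" "r s * (1 - stay s) = surplus s"
  using assms r_nonneg[OF assms(2)] mean_nonneg
  by (auto simp: stay_def surplus_def min_def max_def field_simps)

text \<open>The mass left in place has density min (r, mean), and the moved mass is spread with
  density \<open>shortfall\<close>; these add up to the constant mean. With deficit zero,
  \<open>r\<close> equals its mean almost everywhere and nothing moves.\<close>

lemma push_forward:
  assumes F[measurable]: "F \<in> borel_measurable M"
  shows "(\<integral>\<^sup>+s. ennreal (r s) * (ennreal (stay s) * F s + (\<integral>\<^sup>+y. ennreal (move s y) * F y \<partial>M)) \<partial>M)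
    = (\<integral>\<^sup>+s. ennreal mean * F s \<partial>M)"
proof (cases "deficit = 0")
  case True
  have "AE s in M. shortfall s = 0" "AE s in M. surplus s = 0"
    using integral_nonneg_eq_0_iff_AE[OF integrable_bmeas[OF excess_bmeas(1)]]
      integral_nonneg_eq_0_iff_AE[OF integrable_bmeas[OF excess_bmeas(2)]] True deficit_eq
    by (auto simp: deficit_def)
  then have "AE s in M. r s = mean" by eventually_elim (auto simp: shortfall_def surplus_def max_def split: if_splits)
  then show ?thesis
    using True by (intro nn_integral_cong_AE) (auto simp: stay_def move_def elim!: eventually_mono)
next
  case False
  define K where "K = ennreal (1 / deficit) * (\<integral>\<^sup>+y. ennreal (shortfall y) * F y \<partial>M)"
  have "(\<integral>\<^sup>+s. ennreal (r s) * (ennreal (stay s) * F s + (\<integral>\<^sup>+y. ennreal (move s y) * F y \<partial>M)) \<partial>M)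
     = (\<integral>\<^sup>+s. ennreal (min (r s) mean) * F s + ennreal (surplus s) * K \<partial>M)"
  proof (rule nn_integral_cong)
    fix s assume s: "s \<in> space M"
    show "ennreal (r s) * (ennreal (stay s) * F s + (\<integral>\<^sup>+y. ennreal (move s y) * F y \<partial>M))
      = ennreal (min (r s) mean) * F s + ennreal (surplus s) * K"
      unfolding move_integral[OF F s] K_def[symmetric] r_mult_stay[OF False s, symmetric]
      using stay_range[OF s] r_nonneg[OF s] by (simp add: ennreal_mult distrib_left mult.assoc)
  qed
  also have "\<dots> = (\<integral>\<^sup>+s. ennreal (min (r s) mean) * F s \<partial>M) + ennreal deficit * K"
    by (simp add: nn_integral_add nn_integral_multc nn_deficit)
  also have "ennreal deficit * K = (\<integral>\<^sup>+y. ennreal (shortfall y) * F y \<partial>M)"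
    unfolding K_def using deficit_nonneg False
    by (simp add: mult.assoc[symmetric] ennreal_mult[symmetric])
  also have "(\<integral>\<^sup>+s. ennreal (min (r s) mean) * F s \<partial>M) + (\<integral>\<^sup>+y. ennreal (shortfall y) * F y \<partial>M)
     = (\<integral>\<^sup>+s. (ennreal (min (r s) mean) + ennreal (shortfall s)) * F s \<partial>M)"
    by (simp add: nn_integral_add distrib_right)
  also have "\<dots> = (\<integral>\<^sup>+s. ennreal mean * F s \<partial>M)"
  proof (rule nn_integral_cong)
    fix s assume s: "s \<in> space M"
    have "ennreal (min (r s) mean) + ennreal (shortfall s) = ennreal (min (r s) mean + shortfall s)"
      using r_nonneg[OF s] mean_nonneg by (intro ennreal_plus[symmetric]) (auto simp: min_def)
    also have "min (r s) mean + shortfall s = mean" by (auto simp: shortfall_def)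
    finally show "(ennreal (min (r s) mean) + ennreal (shortfall s)) * F s = ennreal mean * F s" by simp
  qed
  finally show ?thesis .
qed

text \<open>The density of the mass that leaves is the surplus, whose integral is the
  deficit.\<close>

lemma moved_mass:
  "(\<integral>\<^sup>+s. ennreal (r s) * (\<integral>\<^sup>+y. ennreal (move s y) \<partial>M) \<partial>M) \<le> ennreal deficit"
proof (cases "deficit = 0")
  case False
  have "(\<integral>\<^sup>+s. ennreal (r s) * (\<integral>\<^sup>+y. ennreal (move s y) \<partial>M) \<partial>M) = (\<integral>\<^sup>+s. ennreal (surplus s) \<partial>M)"
  proof (rule nn_integral_cong)
    fix s assume s: "s \<in> space M"
    have "(\<integral>\<^sup>+y. ennreal (move s y) \<partial>M) = ennreal (1 - stay s)"
      using move_integral[of "\<lambda>_. 1", OF _ s] nn_deficit stay_range[OF s] deficit_nonneg False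
      by (simp add: ennreal_mult[symmetric])
    then show "ennreal (r s) * (\<integral>\<^sup>+y. ennreal (move s y) \<partial>M) = ennreal (surplus s)"
      using r_mult_stay[OF False s] r_nonneg[OF s] stay_range[OF s] by (simp add: ennreal_mult[symmetric])
  qed
  then show ?thesis by (simp add: nn_deficit)
qed (simp add: move_def stay_def)

end


subsection \<open>Transport to a product measure, one coordinate at a time\<close>

context finite_product_prob_space
begin

text \<open>Resampling one coordinate from its own factor preserves \<open>\<Omega>\<close>. Both
  sides reduce to the remaining coordinates, where the extra integration is against a probability
  measure.\<close>

lemma nn_integral_update:
  assumes g: "g \<in> borel_measurable \<Omega>" and k: "k \<in> I"
  shows "(\<integral>\<^sup>+x. g x \<partial>\<Omega>) = (\<integral>\<^sup>+x. (\<integral>\<^sup>+y. g (x(k := y)) \<partial>M k) \<partial>\<Omega>)"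
proof -
  define J where "J = I - {k}"
  have J: "finite J" "k \<notin> J" "I = insert k J" using k finite_index by (auto simp: J_def)
  have *: "(\<integral>\<^sup>+x. v x \<partial>\<Omega>) = (\<integral>\<^sup>+x. (\<integral>\<^sup>+y. v (x(k := y)) \<partial>M k) \<partial>PiM J M)" if "v \<in> borel_measurable \<Omega>" for v
    using product_nn_integral_insert[OF J(1,2), of v] that J(3) by simp
  have "(\<lambda>x. \<integral>\<^sup>+y. g (x(k := y)) \<partial>M k) \<in> borel_measurable \<Omega>"
  proof (rule M.borel_measurable_nn_integral)
    have "(\<lambda>w. (fst w)(k := snd w)) \<in> measurable (\<Omega> \<Otimes>\<^sub>M M k) \<Omega>"
      using k by (intro measurable_update) measurable
    then show "(\<lambda>(x, y). g (x(k := y))) \<in> borel_measurable (\<Omega> \<Otimes>\<^sub>M M k)"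
      using g by (simp add: split_beta')
  qed
  from *[OF this] show ?thesis
    unfolding *[OF g] by (simp add: M.emeasure_space_1)
qed

text \<open>The second component of \<open>L\<close> is passed through the explicit Markov kernel
  stay/move along coordinate \<open>k\<close>, so couplings are composed without disintegration. The
  first marginal is unaffected, and by \<open>C_le\<close> only the moved mass, half an L1 distance,
  adds to the cost.\<close>

lemma transport_step:
  assumes u: "u \<in> bmeas \<Omega>" "\<And>x. x \<in> space \<Omega> \<Longrightarrow> u x \<ge> 0" and k: "k \<in> I"
    and L: "L \<in> couplings \<nu> (density \<Omega> u)" and \<nu>: "sets \<nu> = sets \<Omega>"
    and C: "C \<in> borel_measurable (\<Omega> \<Otimes>\<^sub>M \<Omega>)"
    and C_le: "\<And>x x' y. x \<in> space \<Omega> \<Longrightarrow> x' \<in> space \<Omega> \<Longrightarrow> y \<in> space (M k) \<Longrightarrow>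
      C (x, x'(k := y)) \<le> C (x, x') + 1"
  shows "\<exists>L'\<in>couplings \<nu> (density \<Omega> (marg k u)).
    (\<integral>\<^sup>+w. C w \<partial>L') \<le> (\<integral>\<^sup>+w. C w \<partial>L) + ennreal ((\<integral>x. \<bar>u x - marg k u x\<bar> \<partial>\<Omega>) / 2)"
proof -
  define r where "r = (\<lambda>x y. u (x(k := y)))"
  define \<alpha> where "\<alpha> = (\<lambda>x. mean_density.stay (M k) (r x) (x k))"
  define \<beta> where "\<beta> = (\<lambda>x. mean_density.move (M k) (r x) (x k))"
  have md: "mean_density (M k) (r x)" if "x \<in> space \<Omega>" for x
  proof
    show "r x \<in> bmeas (M k)" unfolding r_def by (rule bmeas_section[OF u(1) that k])
    show "r x s \<ge> 0" if "s \<in> space (M k)" for s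
      unfolding r_def by (intro u update_space k that \<open>x \<in> space \<Omega>\<close>)
  qed
  have mean: "mean_density.mean (M k) (r x) = marg k u x" if "x \<in> space \<Omega>" for x
    unfolding mean_density.mean_def[OF md[OF that]] unfolding marg_def r_def ..
  have r_upd: "r (x(k := y)) = r x" for x y by (simp add: r_def)
  have r_self: "r x (x k) = u x" for x by (simp add: r_def)
  have mu: "marg k u \<in> borel_measurable \<Omega>" using marg_bmeas[OF u(1) k] by (rule bmeas_measurable)
  have um: "u \<in> borel_measurable \<Omega>" using u(1) by (rule bmeas_measurable)
  have upd: "(\<lambda>w. (fst w)(k := snd w)) \<in> measurable (\<Omega> \<Otimes>\<^sub>M M k) \<Omega>"
    using k by (intro measurable_update) measurable
  \<comment> \<open>\<open>stay\<close> and \<open>move\<close> are defined fibre by fibre;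
    rewriting them through \<open>marg k u\<close> and \<open>def\<close> exhibits their joint
    measurability in the base point.\<close>
  define def where "def = (\<lambda>x. mean_density.deficit (M k) (r x))"
  have def_meas: "def \<in> borel_measurable \<Omega>"
  proof -
    have "(\<lambda>x. \<integral>s. max 0 (marg k u x - u (x(k := s))) \<partial>M k) \<in> borel_measurable \<Omega>"
    proof (rule M.borel_measurable_lebesgue_integral)
      have "(\<lambda>w. u ((fst w)(k := snd w))) \<in> borel_measurable (\<Omega> \<Otimes>\<^sub>M M k)"
        by (rule measurable_compose[OF upd um])
      moreover have "(\<lambda>w. marg k u (fst w)) \<in> borel_measurable (\<Omega> \<Otimes>\<^sub>M M k)"
        by (rule measurable_compose[OF measurable_fst mu])
      ultimately show "(\<lambda>(x, s). max 0 (marg k u x - u (x(k := s)))) \<in> borel_measurable (\<Omega> \<Otimes>\<^sub>M M k)"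
        unfolding split_beta' by (intro borel_measurable_max borel_measurable_diff borel_measurable_const)
    qed
    moreover have "(\<integral>s. max 0 (marg k u x - u (x(k := s))) \<partial>M k) = def x" if "x \<in> space \<Omega>" for x
      unfolding def_def mean_density.deficit_def[OF md[OF that]] mean_density.shortfall_def[OF md[OF that]] mean[OF that]
      unfolding r_def ..
    ultimately show ?thesis by (rule measurable_cong[THEN iffD1, rotated])
  qed
  have \<alpha>_eq: "\<alpha> x = (if def x = 0 \<or> u x = 0 then 1 else min 1 (marg k u x / u x))" if "x \<in> space \<Omega>" for x
    unfolding \<alpha>_def mean_density.stay_def[OF md[OF that]] mean[OF that] r_self def_def ..
  have \<alpha>_meas: "\<alpha> \<in> borel_measurable \<Omega>"
  proof -
    note mu[measurable] um[measurable] def_meas[measurable]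
    have "(\<lambda>x. if def x = 0 \<or> u x = 0 then 1 else min 1 (marg k u x / u x)) \<in> borel_measurable \<Omega>"
      by measurable
    then show ?thesis by (rule measurable_cong[THEN iffD1, rotated]) (simp add: \<alpha>_eq)
  qed
  have \<beta>_eq: "\<beta> x y = (1 - \<alpha> x) * (max 0 (marg k u x - u (x(k := y))) / def x)" if "x \<in> space \<Omega>" for x y
    unfolding \<beta>_def mean_density.move_def[OF md[OF that]] mean_density.shortfall_def[OF md[OF that]]
      mean[OF that] \<alpha>_def def_def by (simp add: r_def)
  have \<beta>_meas: "(\<lambda>w. \<beta> (fst w) (snd w)) \<in> borel_measurable (\<Omega> \<Otimes>\<^sub>M M k)"
  proof -
    have [measurable]: "(\<lambda>w. u ((fst w)(k := snd w))) \<in> borel_measurable (\<Omega> \<Otimes>\<^sub>M M k)"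
      by (rule measurable_compose[OF upd um])
    note mu[measurable] \<alpha>_meas[measurable] def_meas[measurable]
    have "(\<lambda>w. (1 - \<alpha> (fst w)) * (max 0 (marg k u (fst w) - u ((fst w)(k := snd w))) / def (fst w)))
        \<in> borel_measurable (\<Omega> \<Otimes>\<^sub>M M k)"
      by measurable
    then show ?thesis
      by (rule measurable_cong[THEN iffD1, rotated]) (auto simp: \<beta>_eq space_pair_measure)
  qed
  have total: "ennreal (\<alpha> x) + (\<integral>\<^sup>+y. ennreal (\<beta> x y) \<partial>M k) = 1" if "x \<in> space \<Omega>" for x
    unfolding \<alpha>_def \<beta>_def by (rule mean_density.total_mass[OF md[OF that] component_space[OF that k]])
  \<comment> \<open>The randomness of the kernel is a point \<open>y\<close> of \<open>M k\<close>
    with a flag: \<open>True\<close> keeps the point with weight \<open>\<alpha>\<close>,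
    \<open>False\<close> replaces coordinate \<open>k\<close> by \<open>y\<close> with weight
    \<open>\<beta>\<close>. As \<open>M k\<close> has mass one, the weight \<open>\<alpha>\<close>
    integrates to itself.\<close>
  define Bo where "Bo = count_space (UNIV :: bool set)"
  interpret Bo: sigma_finite_measure Bo
    unfolding Bo_def by (rule sigma_finite_measure_count_space_countable) simp
  interpret MB: pair_sigma_finite "M k" Bo ..
  have sL: "sets L = sets (\<Omega> \<Otimes>\<^sub>M \<Omega>)"
    and Lf: "distr L \<nu> fst = \<nu>" and Ls: "distr L (density \<Omega> u) snd = density \<Omega> u"
  proof -
    have "sets L = sets (\<nu> \<Otimes>\<^sub>M density \<Omega> u)" using L by (simp add: couplings_def)
    also have "\<dots> = sets (\<Omega> \<Otimes>\<^sub>M \<Omega>)" using \<nu> by (intro sets_pair_measure_cong) auto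
    finally show "sets L = sets (\<Omega> \<Otimes>\<^sub>M \<Omega>)" .
  qed (use L in \<open>auto simp: couplings_def\<close>)
  have spL: "space L = space \<Omega> \<times> space \<Omega>"
    using sets_eq_imp_space_eq[OF sL] by (simp add: space_pair_measure)
  define wt where "wt = (\<lambda>w::(('a \<Rightarrow> 'b) \<times> ('a \<Rightarrow> 'b)) \<times> ('b \<times> bool).
    ennreal (if snd (snd w) then \<alpha> (snd (fst w)) else \<beta> (snd (fst w)) (fst (snd w))))"
  define mv where "mv = (\<lambda>w::(('a \<Rightarrow> 'b) \<times> ('a \<Rightarrow> 'b)) \<times> ('b \<times> bool).
    (fst (fst w), if snd (snd w) then snd (fst w) else (snd (fst w))(k := fst (snd w))))"
  let ?S = "L \<Otimes>\<^sub>M (M k \<Otimes>\<^sub>M Bo)"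
  have f11: "(\<lambda>w. fst (fst w)) \<in> measurable ?S \<Omega>" and f12: "(\<lambda>w. snd (fst w)) \<in> measurable ?S \<Omega>"
  proof -
    have "fst \<in> measurable ?S (\<Omega> \<Otimes>\<^sub>M \<Omega>)"
      using measurable_fst[of L "M k \<Otimes>\<^sub>M Bo"] measurable_cong_sets[OF refl sL] by blast
    then show "(\<lambda>w. fst (fst w)) \<in> measurable ?S \<Omega>" "(\<lambda>w. snd (fst w)) \<in> measurable ?S \<Omega>"
      by (rule measurable_compose[OF _ measurable_fst], rule measurable_compose[OF _ measurable_snd])
  qed
  have f21: "(\<lambda>w. fst (snd w)) \<in> measurable ?S (M k)"
    by (rule measurable_compose[OF measurable_snd measurable_fst])
  have f22: "{w \<in> space ?S. snd (snd w)} \<in> sets ?S"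
  proof -
    have "(\<lambda>w. snd (snd w)) \<in> measurable ?S (count_space UNIV)"
      using measurable_compose[OF measurable_snd measurable_snd, of L "M k" Bo] unfolding Bo_def .
    then show ?thesis by measurable
  qed
  have wt_meas: "wt \<in> borel_measurable ?S"
  proof -
    have "(\<lambda>w. \<beta> (snd (fst w)) (fst (snd w))) \<in> borel_measurable ?S"
      using measurable_compose[OF measurable_Pair[OF f12 f21] \<beta>_meas] by simp
    then have "(\<lambda>w. if snd (snd w) then \<alpha> (snd (fst w)) else \<beta> (snd (fst w)) (fst (snd w))) \<in> borel_measurable ?S"
      by (intro measurable_If measurable_compose[OF f12 \<alpha>_meas] f22)
    then show ?thesis unfolding wt_def by (rule measurable_compose[OF _ measurable_ennreal])
  qed
  have mv_meas: "mv \<in> measurable ?S (\<Omega> \<Otimes>\<^sub>M \<Omega>)"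
    unfolding mv_def by (intro measurable_Pair f11 measurable_If f12 f22 measurable_update k f21)
  define L' where "L' = distr (density ?S wt) (\<Omega> \<Otimes>\<^sub>M \<Omega>) mv"
  have int: "(\<integral>\<^sup>+w. F w \<partial>L') = (\<integral>\<^sup>+w. ennreal (\<alpha> (snd w)) * F w
      + (\<integral>\<^sup>+y. ennreal (\<beta> (snd w) y) * F (fst w, (snd w)(k := y)) \<partial>M k) \<partial>L)"
    if F: "F \<in> borel_measurable (\<Omega> \<Otimes>\<^sub>M \<Omega>)" for F
  proof -
    have Fm: "(\<lambda>w. F (mv w)) \<in> borel_measurable ?S" by (rule measurable_compose[OF mv_meas F])
    have "(\<integral>\<^sup>+w. F w \<partial>L') = (\<integral>\<^sup>+w. wt w * F (mv w) \<partial>?S)"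
      unfolding L'_def using mv_meas wt_meas Fm F
      by (subst nn_integral_distr) (simp_all add: nn_integral_density)
    also have "\<dots> = (\<integral>\<^sup>+w. (\<integral>\<^sup>+v. wt (w, v) * F (mv (w, v)) \<partial>(M k \<Otimes>\<^sub>M Bo)) \<partial>L)"
      using wt_meas Fm by (intro MB.nn_integral_fst[symmetric]) simp
    also have "\<dots> = (\<integral>\<^sup>+w. ennreal (\<alpha> (snd w)) * F w
      + (\<integral>\<^sup>+y. ennreal (\<beta> (snd w) y) * F (fst w, (snd w)(k := y)) \<partial>M k) \<partial>L)"
    proof (rule nn_integral_cong)
      fix w assume w: "w \<in> space L"
      then have w2: "snd w \<in> space \<Omega>" "fst w \<in> space \<Omega>" by (auto simp: spL)
      have sec: "(\<lambda>v. wt (w, v) * F (mv (w, v))) \<in> borel_measurable (M k \<Otimes>\<^sub>M Bo)"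
        using measurable_compose[OF measurable_Pair1'[OF w] borel_measurable_times_ennreal[OF wt_meas Fm]] by simp
      have "(\<integral>\<^sup>+v. wt (w, v) * F (mv (w, v)) \<partial>(M k \<Otimes>\<^sub>M Bo))
          = (\<integral>\<^sup>+y. (\<integral>\<^sup>+b. wt (w, (y, b)) * F (mv (w, (y, b))) \<partial>Bo) \<partial>M k)"
        by (intro Bo.nn_integral_fst[symmetric] sec)
      also have "\<dots> = (\<integral>\<^sup>+y. ennreal (\<alpha> (snd w)) * F w + ennreal (\<beta> (snd w) y) * F (fst w, (snd w)(k := y)) \<partial>M k)"
        unfolding Bo_def
        by (subst nn_integral_count_space_finite) (auto simp: wt_def mv_def UNIV_bool add.commute)
      also have "\<dots> = ennreal (\<alpha> (snd w)) * F w + (\<integral>\<^sup>+y. ennreal (\<beta> (snd w) y) * F (fst w, (snd w)(k := y)) \<partial>M k)"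
      proof (subst nn_integral_add)
        have "(\<lambda>y. \<beta> (snd w) y) \<in> borel_measurable (M k)"
          using measurable_compose[OF measurable_Pair1'[OF w2(1)] \<beta>_meas] by simp
        moreover have "(\<lambda>y. F (fst w, (snd w)(k := y))) \<in> borel_measurable (M k)"
          by (rule measurable_compose[OF _ F], rule measurable_Pair[OF measurable_const[OF w2(2)]],
            rule measurable_update[OF k measurable_const[OF w2(1)] measurable_ident_sets[OF refl]])
        ultimately show "(\<lambda>y. ennreal (\<beta> (snd w) y) * F (fst w, (snd w)(k := y))) \<in> borel_measurable (M k)"
          by (intro borel_measurable_times_ennreal measurable_compose[OF _ measurable_ennreal])
      qed (simp_all add: M.emeasure_space_1)
      finally show "(\<integral>\<^sup>+v. wt (w, v) * F (mv (w, v)) \<partial>(M k \<Otimes>\<^sub>M Bo)) = \<dots>" .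
    qed
    finally show ?thesis .
  qed
  have beta_sec: "(\<lambda>y. ennreal (\<beta> x y)) \<in> borel_measurable (M k)" if "x \<in> space \<Omega>" for x
    using measurable_compose[OF measurable_compose[OF measurable_Pair1'[OF that] \<beta>_meas] measurable_ennreal] by simp
  have sL': "sets L' = sets (\<Omega> \<Otimes>\<^sub>M \<Omega>)" by (simp add: L'_def)
  have fst_meas: "fst \<in> measurable L' \<nu>" "snd \<in> measurable L' (density \<Omega> (marg k u))"
    using measurable_cong_sets[OF sL' \<nu>] measurable_cong_sets[OF sL' sets_density[of \<Omega> "marg k u"]] by auto
  have fstL: "fst \<in> measurable L \<nu>" "snd \<in> measurable L (density \<Omega> u)"
    using measurable_cong_sets[OF sL \<nu>] measurable_cong_sets[OF sL sets_density[of \<Omega> u]] by auto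
  have "L' \<in> couplings \<nu> (density \<Omega> (marg k u))"
    unfolding couplings_def
  proof (intro CollectI conjI)
    show "sets L' = sets (\<nu> \<Otimes>\<^sub>M density \<Omega> (marg k u))"
      unfolding sL' using \<nu> by (intro sets_pair_measure_cong) auto
    show "distr L' \<nu> fst = \<nu>"
    proof (rule measure_eqI)
      fix A assume "A \<in> sets (distr L' \<nu> fst)"
      then have A: "A \<in> sets \<nu>" "A \<in> sets \<Omega>" using \<nu> by auto
      have "emeasure (distr L' \<nu> fst) A = (\<integral>\<^sup>+x. indicator A x \<partial>distr L' \<nu> fst)"
        using A by simp
      also have "\<dots> = (\<integral>\<^sup>+w. indicator A (fst w) \<partial>L')"
        using A by (intro nn_integral_distr fst_meas) auto
      also have "\<dots> = (\<integral>\<^sup>+w. ennreal (\<alpha> (snd w)) * indicator A (fst w)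
          + (\<integral>\<^sup>+y. ennreal (\<beta> (snd w) y) * indicator A (fst w) \<partial>M k) \<partial>L)"
        using A by (subst int) auto
      also have "\<dots> = (\<integral>\<^sup>+w. indicator A (fst w) \<partial>L)"
      proof (rule nn_integral_cong)
        fix w assume "w \<in> space L"
        then have w: "snd w \<in> space \<Omega>" by (auto simp: spL)
        show "ennreal (\<alpha> (snd w)) * indicator A (fst w) + (\<integral>\<^sup>+y. ennreal (\<beta> (snd w) y) * indicator A (fst w) \<partial>M k)
            = indicator A (fst w)"
          unfolding nn_integral_multc[OF beta_sec[OF w]] distrib_right[symmetric] total[OF w] by simp
      qed
      also have "\<dots> = (\<integral>\<^sup>+x. indicator A x \<partial>distr L \<nu> fst)"
        using A by (intro nn_integral_distr[symmetric] fstL) auto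
      also have "\<dots> = emeasure \<nu> A" unfolding Lf using A by simp
      finally show "emeasure (distr L' \<nu> fst) A = emeasure \<nu> A" .
    qed simp
    show "distr L' (density \<Omega> (marg k u)) snd = density \<Omega> (marg k u)"
    proof (rule measure_eqI)
      fix A assume "A \<in> sets (distr L' (density \<Omega> (marg k u)) snd)"
      then have A: "A \<in> sets \<Omega>" by auto
      define G where "G = (\<lambda>x. ennreal (\<alpha> x) * indicator A x
          + (\<integral>\<^sup>+y. ennreal (\<beta> x y) * indicator A (x(k := y)) \<partial>M k))"
      have G: "G \<in> borel_measurable \<Omega>"
      proof -
        have "(\<lambda>x. \<integral>\<^sup>+y. ennreal (\<beta> x y) * indicator A (x(k := y)) \<partial>M k) \<in> borel_measurable \<Omega>"
        proof (rule M.borel_measurable_nn_integral)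
          have "(\<lambda>w. indicator A ((fst w)(k := snd w)) :: ennreal) \<in> borel_measurable (\<Omega> \<Otimes>\<^sub>M M k)"
            using A by (intro measurable_compose[OF upd]) auto
          then show "(\<lambda>(x, y). ennreal (\<beta> x y) * indicator A (x(k := y))) \<in> borel_measurable (\<Omega> \<Otimes>\<^sub>M M k)"
            unfolding split_beta'
            by (intro borel_measurable_times_ennreal measurable_compose[OF \<beta>_meas measurable_ennreal])
        qed
        then show ?thesis
          unfolding G_def using A
          by (intro borel_measurable_add borel_measurable_times_ennreal
            measurable_compose[OF \<alpha>_meas measurable_ennreal]) auto
      qed
      have "emeasure (distr L' (density \<Omega> (marg k u)) snd) A = (\<integral>\<^sup>+x. indicator A x \<partial>distr L' (density \<Omega> (marg k u)) snd)"
        using A by simp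
      also have "\<dots> = (\<integral>\<^sup>+w. indicator A (snd w) \<partial>L')"
        using A by (intro nn_integral_distr fst_meas) auto
      also have "\<dots> = (\<integral>\<^sup>+w. G (snd w) \<partial>L)"
        unfolding G_def using A by (subst int) auto
      also have "\<dots> = (\<integral>\<^sup>+x. G x \<partial>distr L (density \<Omega> u) snd)"
        using G by (intro nn_integral_distr[symmetric] fstL) auto
      also have "\<dots> = (\<integral>\<^sup>+x. ennreal (u x) * G x \<partial>\<Omega>)"
        unfolding Ls using G um by (intro nn_integral_density) auto
      \<comment> \<open>Resampling coordinate \<open>k\<close> produces an inner integral over one
        fibre, where \<open>push_forward\<close> replaces \<open>u\<close> by its mean.\<close>
      also have "\<dots> = (\<integral>\<^sup>+x. (\<integral>\<^sup>+s. ennreal (u (x(k := s))) * G (x(k := s)) \<partial>M k) \<partial>\<Omega>)"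
        using G um by (intro nn_integral_update k) auto
      also have "\<dots> = (\<integral>\<^sup>+x. (\<integral>\<^sup>+s. ennreal (marg k u x) * indicator A (x(k := s)) \<partial>M k) \<partial>\<Omega>)"
      proof (rule nn_integral_cong)
        fix x assume x: "x \<in> space \<Omega>"
        have "(\<lambda>s. indicator A (x(k := s)) :: ennreal) \<in> borel_measurable (M k)"
          using A by (intro measurable_compose[OF measurable_update[OF k measurable_const[OF x] measurable_ident_sets[OF refl]]]) auto
        from mean_density.push_forward[OF md[OF x] this]
        show "(\<integral>\<^sup>+s. ennreal (u (x(k := s))) * G (x(k := s)) \<partial>M k)
            = (\<integral>\<^sup>+s. ennreal (marg k u x) * indicator A (x(k := s)) \<partial>M k)"
          unfolding G_def \<alpha>_def \<beta>_def mean[OF x] r_upd fun_upd_same fun_upd_upd by (simp only: r_def)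
      qed
      also have "\<dots> = (\<integral>\<^sup>+x. (\<integral>\<^sup>+s. ennreal (marg k u (x(k := s))) * indicator A (x(k := s)) \<partial>M k) \<partial>\<Omega>)"
        by (simp add: marg_def)
      also have "\<dots> = (\<integral>\<^sup>+x. ennreal (marg k u x) * indicator A x \<partial>\<Omega>)"
        using A mu by (intro nn_integral_update[symmetric] k) auto
      also have "\<dots> = emeasure (density \<Omega> (marg k u)) A"
        using A mu by (subst emeasure_density) auto
      finally show "emeasure (distr L' (density \<Omega> (marg k u)) snd) A = emeasure (density \<Omega> (marg k u)) A" .
    qed simp
  qed
  moreover have "(\<integral>\<^sup>+w. C w \<partial>L') \<le> (\<integral>\<^sup>+w. C w \<partial>L) + ennreal ((\<integral>x. \<bar>u x - marg k u x\<bar> \<partial>\<Omega>) / 2)"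
  proof -
    define H where "H = (\<lambda>x. \<integral>\<^sup>+y. ennreal (\<beta> x y) \<partial>M k)"
    have H: "H \<in> borel_measurable \<Omega>"
      unfolding H_def
      by (rule M.borel_measurable_nn_integral)
        (use measurable_compose[OF \<beta>_meas measurable_ennreal] in \<open>simp add: split_beta'\<close>)
    have "(\<integral>\<^sup>+w. C w \<partial>L') \<le> (\<integral>\<^sup>+w. C w + H (snd w) \<partial>L)"
      unfolding int[OF C]
    proof (rule nn_integral_mono)
      fix w assume "w \<in> space L"
      then have w: "snd w \<in> space \<Omega>" "fst w \<in> space \<Omega>" by (auto simp: spL)
      have "(\<integral>\<^sup>+y. ennreal (\<beta> (snd w) y) * C (fst w, (snd w)(k := y)) \<partial>M k)
          \<le> (\<integral>\<^sup>+y. ennreal (\<beta> (snd w) y) * (C w + 1) \<partial>M k)"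
        by (intro nn_integral_mono mult_left_mono) (use C_le[OF w(2,1)] in auto)
      also have "\<dots> = H (snd w) * (C w + 1)"
        unfolding H_def by (rule nn_integral_multc[OF beta_sec[OF w(1)]])
      finally have "ennreal (\<alpha> (snd w)) * C w + (\<integral>\<^sup>+y. ennreal (\<beta> (snd w) y) * C (fst w, (snd w)(k := y)) \<partial>M k)
          \<le> ennreal (\<alpha> (snd w)) * C w + H (snd w) * (C w + 1)"
        by (intro add_left_mono)
      \<comment> \<open>The kernel has total mass one, so the old cost is restored and only the
        probability \<open>H\<close> of moving is added.\<close>
      also have "\<dots> = (ennreal (\<alpha> (snd w)) + H (snd w)) * C w + H (snd w)"
        by (simp add: distrib_left distrib_right add.assoc)
      also have "\<dots> = C w + H (snd w)"
        using total[OF w(1)] by (simp add: H_def)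
      finally show "ennreal (\<alpha> (snd w)) * C w + (\<integral>\<^sup>+y. ennreal (\<beta> (snd w) y) * C (fst w, (snd w)(k := y)) \<partial>M k)
          \<le> C w + H (snd w)" .
    qed
    also have "\<dots> = (\<integral>\<^sup>+w. C w \<partial>L) + (\<integral>\<^sup>+w. H (snd w) \<partial>L)"
    proof (rule nn_integral_add)
      show "C \<in> borel_measurable L" using C measurable_cong_sets[OF sL refl] by blast
      show "(\<lambda>w. H (snd w)) \<in> borel_measurable L"
        using measurable_compose[OF fstL(2)] H by simp
    qed
    also have "(\<integral>\<^sup>+w. H (snd w) \<partial>L) = (\<integral>\<^sup>+x. H x \<partial>distr L (density \<Omega> u) snd)"
      using H by (intro nn_integral_distr[symmetric] fstL) auto
    also have "\<dots> = (\<integral>\<^sup>+x. ennreal (u x) * H x \<partial>\<Omega>)"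
      unfolding Ls using H um by (intro nn_integral_density) auto
    also have "\<dots> = (\<integral>\<^sup>+x. (\<integral>\<^sup>+s. ennreal (u (x(k := s))) * H (x(k := s)) \<partial>M k) \<partial>\<Omega>)"
      using H um by (intro nn_integral_update k) auto
    also have "\<dots> \<le> (\<integral>\<^sup>+x. ennreal (def x) \<partial>\<Omega>)"
    proof (rule nn_integral_mono)
      fix x assume x: "x \<in> space \<Omega>"
      from mean_density.moved_mass[OF md[OF x]]
      show "(\<integral>\<^sup>+s. ennreal (u (x(k := s))) * H (x(k := s)) \<partial>M k) \<le> ennreal (def x)"
        unfolding H_def \<beta>_def def_def r_upd fun_upd_same by (simp only: r_def)
    qed
    \<comment> \<open>The deficit is half the absolute deviation of the fibre, which accounts for
      the factor 1/2.\<close>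
    also have "\<dots> = (\<integral>\<^sup>+x. ennreal (marg k (\<lambda>x. \<bar>u x - marg k u x\<bar>) x / 2) \<partial>\<Omega>)"
    proof (rule nn_integral_cong)
      fix x assume x: "x \<in> space \<Omega>"
      have "marg k (\<lambda>x. \<bar>u x - marg k u x\<bar>) x = 2 * def x"
        using mean_density.deficit_abs[OF md[OF x]] mean[OF x] by (simp add: marg_def def_def r_def)
      then show "ennreal (def x) = ennreal (marg k (\<lambda>x. \<bar>u x - marg k u x\<bar>) x / 2)" by simp
    qed
    also have "\<dots> = ennreal ((\<integral>x. \<bar>u x - marg k u x\<bar> \<partial>\<Omega>) / 2)"
    proof -
      have D: "(\<lambda>x. u x - marg k u x) \<in> bmeas \<Omega>"
        by (intro bmeas_diff u marg_bmeas k)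
      have ab: "(\<lambda>x. \<bar>u x - marg k u x\<bar>) \<in> bmeas \<Omega>"
        by (rule bmeas_abs[OF D])
      have "(\<lambda>x. marg k (\<lambda>x. \<bar>u x - marg k u x\<bar>) x * (1 / 2)) \<in> bmeas \<Omega>"
        by (intro bmeas_mult marg_bmeas ab k bmeas_const)
      then have "(\<integral>\<^sup>+x. ennreal (marg k (\<lambda>x. \<bar>u x - marg k u x\<bar>) x * (1 / 2)) \<partial>\<Omega>)
          = ennreal (\<integral>x. marg k (\<lambda>x. \<bar>u x - marg k u x\<bar>) x * (1 / 2) \<partial>\<Omega>)"
        by (intro nn_integral_eq_integral integrable_bmeas AE_I2) (auto simp: marg_def)
      then show ?thesis using integral_marg[OF ab k] by simp
    qed
    finally show ?thesis by (simp add: add_left_mono)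
  qed
  ultimately show ?thesis by blast
qed

end

section \<open>Marton's inequality by coordinate steps\<close>

context finite_product_prob_space
begin

text \<open>\<open>abs_deviation_le\<close> on each fibre with one common \<open>c\<close>,
  integrated over the fibres. The fibre entropies then add up to an entropy difference, which
  telescopes along a chain.\<close>

lemma Ent_marg_step:
  assumes u: "u \<in> bmeas \<Omega>" "\<And>x. x \<in> space \<Omega> \<Longrightarrow> u x \<ge> 0" and k: "k \<in> I" and c: "c > 0"
  shows "(\<integral>x. \<bar>u x - marg k u x\<bar> \<partial>\<Omega>) \<le> c * (\<integral>x. u x \<partial>\<Omega>) + (Ent u - Ent (marg k u)) / (2 * c)"
proof -
  have mb: "marg k u \<in> bmeas \<Omega>" by (rule marg_bmeas[OF u(1) k])
  have m0: "marg k u x \<ge> 0" if "x \<in> space \<Omega>" for x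
    unfolding marg_def using u(2) update_space[OF that k] by (intro integral_nonneg_AE AE_I2) auto
  have ab: "(\<lambda>x. \<bar>u x - marg k u x\<bar>) \<in> bmeas \<Omega>"
    by (intro bmeas_abs bmeas_diff u mb)
  have ul: "(\<lambda>x. u x * ln (u x)) \<in> bmeas \<Omega>" and ml: "(\<lambda>x. marg k u x * ln (marg k u x)) \<in> bmeas \<Omega>"
    using bmeas_xlnx[OF u] bmeas_xlnx[OF mb m0] by auto
  have mul: "marg k (\<lambda>x. u x * ln (u x)) \<in> bmeas \<Omega>"
    by (rule marg_bmeas[OF ul k])
  have "(\<integral>x. \<bar>u x - marg k u x\<bar> \<partial>\<Omega>) = (\<integral>x. marg k (\<lambda>x. \<bar>u x - marg k u x\<bar>) x \<partial>\<Omega>)"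
    by (rule integral_marg[OF ab k, symmetric])
  also have "\<dots> \<le> (\<integral>x. c * marg k u x + (marg k (\<lambda>x. u x * ln (u x)) x - marg k u x * ln (marg k u x)) * (1 / (2 * c)) \<partial>\<Omega>)"
  proof (rule integral_mono)
    show "marg k (\<lambda>x. \<bar>u x - marg k u x\<bar>) x
        \<le> c * marg k u x + (marg k (\<lambda>x. u x * ln (u x)) x - marg k u x * ln (marg k u x)) * (1 / (2 * c))"
      if x: "x \<in> space \<Omega>" for x
      using M.abs_deviation_le[OF bmeas_section[OF u(1) x k] u(2)[OF update_space[OF x k]] c refl]
      by (simp add: marg_def)
  qed (intro integrable_bmeas marg_bmeas ab k bmeas_add bmeas_mult bmeas_diff bmeas_const mb mul ml)+
  also have "\<dots> = c * (\<integral>x. u x \<partial>\<Omega>) + (Ent u - Ent (marg k u)) / (2 * c)"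
    using integrable_bmeas[OF mb] integrable_bmeas[OF mul] integrable_bmeas[OF ml]
    by (simp add: integral_marg[OF u(1) k] integral_marg[OF ul k] Ent_def)
  finally show ?thesis .
qed

text \<open>Starts from the diagonal coupling and applies \<open>transport_step\<close> per
  coordinate. The real bound \<open>b\<close> is carried along because the entropy differences must
  be added as reals: \<open>ennreal\<close> would truncate negative ones.\<close>

lemma transport_chain:
  assumes h: "h \<in> borel_measurable \<Omega>" "\<And>x. x \<in> space \<Omega> \<Longrightarrow> h x \<in> {0..B}" and c: "c > 0"
    and C: "C \<in> borel_measurable (\<Omega> \<Otimes>\<^sub>M \<Omega>)"
    and C_diag: "\<And>x. x \<in> space \<Omega> \<Longrightarrow> C (x, x) = 0"
    and C_le: "\<And>x x' k y. x \<in> space \<Omega> \<Longrightarrow> x' \<in> space \<Omega> \<Longrightarrow> k \<in> I \<Longrightarrow> y \<in> space (M k) \<Longrightarrow>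
      C (x, x'(k := y)) \<le> C (x, x') + 1"
    and js: "set js \<subseteq> I"
  shows "\<exists>L\<in>couplings (density \<Omega> h) (density \<Omega> (avgs triv js h)). \<exists>b\<ge>0. (\<integral>\<^sup>+w. C w \<partial>L) \<le> ennreal b \<and>
    b \<le> real (length js) * (c * (\<integral>x. h x \<partial>\<Omega>) / 2) + (Ent h - Ent (avgs triv js h)) / (4 * c)"
  using js
proof (induction js)
  case Nil
  define L where "L = distr (density \<Omega> h) (\<Omega> \<Otimes>\<^sub>M \<Omega>) (\<lambda>x. (x, x))"
  have diag: "(\<lambda>x. (x, x)) \<in> measurable (density \<Omega> h) (\<Omega> \<Otimes>\<^sub>M \<Omega>)"
    by (rule measurable_Pair) (simp_all add: measurable_ident_sets)
  have "L \<in> couplings (density \<Omega> h) (density \<Omega> h)"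
    unfolding couplings_def
  proof (intro CollectI conjI)
    show "sets L = sets (density \<Omega> h \<Otimes>\<^sub>M density \<Omega> h)"
      unfolding L_def sets_distr by (intro sets_pair_measure_cong) auto
    have f: "fst \<in> measurable (\<Omega> \<Otimes>\<^sub>M \<Omega>) (density \<Omega> h)" "snd \<in> measurable (\<Omega> \<Otimes>\<^sub>M \<Omega>) (density \<Omega> h)"
      using measurable_cong_sets[OF refl sets_density[of \<Omega> h]] by auto
    show "distr L (density \<Omega> h) fst = density \<Omega> h" "distr L (density \<Omega> h) snd = density \<Omega> h"
      unfolding L_def distr_distr[OF f(1) diag] distr_distr[OF f(2) diag] by (simp_all add: comp_def distr_id2)
  qed
  moreover have "(\<integral>\<^sup>+w. C w \<partial>L) = 0"
  proof -
    have "(\<integral>\<^sup>+w. C w \<partial>L) = (\<integral>\<^sup>+x. C (x, x) \<partial>density \<Omega> h)"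
      unfolding L_def by (rule nn_integral_distr[OF diag]) (use C in simp)
    also have "\<dots> = (\<integral>\<^sup>+x. 0 \<partial>density \<Omega> h)" by (intro nn_integral_cong) (simp add: C_diag)
    finally show ?thesis by simp
  qed
  ultimately show ?case by (intro bexI[of _ L] exI[of _ 0]) auto
next
  case (Cons j js)
  define u where "u = avgs triv js h"
  define u' where "u' = avgs triv (j # js) h"
  have j: "j \<in> I" and js: "set js \<subseteq> I" using Cons.prems by auto
  have hb: "h \<in> bmeas \<Omega>" using h by (rule bmeas_intervalI)
  have u: "u \<in> borel_measurable \<Omega>" "\<And>x. x \<in> space \<Omega> \<Longrightarrow> u x \<in> {0..B}"
    unfolding u_def using avgs_bounds[OF h cells_triv js] by auto
  have ub: "u \<in> bmeas \<Omega>" using u by (rule bmeas_intervalI)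
  have u0: "\<And>x. x \<in> space \<Omega> \<Longrightarrow> u x \<ge> 0" using u(2) by simp
  have iu: "(\<integral>x. u x \<partial>\<Omega>) = (\<integral>x. h x \<partial>\<Omega>)"
    unfolding u_def using avgs_adjoint[OF hb cells_triv js, of "\<lambda>_. 1"] by (simp add: invariant_def)
  have eq: "marg j u x = u' x" if "x \<in> space \<Omega>" for x
    unfolding u'_def avgs_simps u_def[symmetric] by (rule marg_eq_avg[OF that j])
  have dens: "density \<Omega> (\<lambda>x. ennreal (marg j u x)) = density \<Omega> (\<lambda>x. ennreal (u' x))"
    using bmeas_measurable[OF marg_bmeas[OF ub j]] bmeas_measurable[OF bmeas_cong[OF marg_bmeas[OF ub j] eq]]
    by (intro density_cong AE_I2) (auto simp: eq)
  obtain L b where L: "L \<in> couplings (density \<Omega> h) (density \<Omega> u)" "b \<ge> 0" "(\<integral>\<^sup>+w. C w \<partial>L) \<le> ennreal b"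
    "b \<le> real (length js) * (c * (\<integral>x. h x \<partial>\<Omega>) / 2) + (Ent h - Ent u) / (4 * c)"
    using Cons.IH[OF js] unfolding u_def by blast
  define e where "e = (\<integral>x. \<bar>u x - marg j u x\<bar> \<partial>\<Omega>) / 2"
  have e0: "e \<ge> 0" unfolding e_def by simp
  have e: "e \<le> c * (\<integral>x. h x \<partial>\<Omega>) / 2 + (Ent u - Ent u') / (4 * c)"
  proof -
    have "Ent (marg j u) = Ent u'" by (rule Ent_cong[OF eq])
    then have "(\<integral>x. \<bar>u x - marg j u x\<bar> \<partial>\<Omega>) \<le> c * (\<integral>x. h x \<partial>\<Omega>) + (Ent u - Ent u') / (2 * c)"
      using Ent_marg_step[OF ub u0 j c] iu by simp
    then have "e \<le> (c * (\<integral>x. h x \<partial>\<Omega>) + (Ent u - Ent u') / (2 * c)) / 2"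
      unfolding e_def by (rule divide_right_mono) simp
    also have "\<dots> = c * (\<integral>x. h x \<partial>\<Omega>) / 2 + (Ent u - Ent u') / (4 * c)"
      by (simp add: add_divide_distrib)
    finally show ?thesis .
  qed
  have sd: "sets (density \<Omega> (\<lambda>x. ennreal (h x))) = sets \<Omega>" by simp
  obtain L' where L': "L' \<in> couplings (density \<Omega> h) (density \<Omega> (marg j u))"
    "(\<integral>\<^sup>+w. C w \<partial>L') \<le> (\<integral>\<^sup>+w. C w \<partial>L) + ennreal e"
    using transport_step[OF ub u0 j L(1) sd C C_le[OF _ _ j]] unfolding e_def by blast
  have "(\<integral>\<^sup>+w. C w \<partial>L') \<le> ennreal b + ennreal e"
    using L'(2) L(3) add_right_mono order_trans by blast
  then have "(\<integral>\<^sup>+w. C w \<partial>L') \<le> ennreal (b + e)" using L(2) e0 by simp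
  moreover have "b + e \<le> real (length (j # js)) * (c * (\<integral>x. h x \<partial>\<Omega>) / 2) + (Ent h - Ent u') / (4 * c)"
  proof -
    have "b + e \<le> (real (length js) * (c * (\<integral>x. h x \<partial>\<Omega>) / 2) + (Ent h - Ent u) / (4 * c))
        + (c * (\<integral>x. h x \<partial>\<Omega>) / 2 + (Ent u - Ent u') / (4 * c))"
      using L(4) e by (rule add_mono)
    also have "\<dots> = real (length (j # js)) * (c * (\<integral>x. h x \<partial>\<Omega>) / 2) + (Ent h - Ent u') / (4 * c)"
      by (simp add: algebra_simps diff_divide_distrib)
    finally show ?thesis .
  qed
  moreover have "b + e \<ge> 0" using L(2) e0 by simp
  ultimately show ?case using L'(1) unfolding dens u'_def by blast
qed

text \<open>Each of the card I steps costs c / 2, and the entropies telescope to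
  \<open>Ent h\<close>, as the density with all coordinates integrated out has entropy zero.
  Division by card I normalizes.\<close>

lemma transport_dist_le:
  fixes d :: "'a \<Rightarrow> 'b \<Rightarrow> 'b \<Rightarrow> real"
  assumes h: "h \<in> borel_measurable \<Omega>" "\<And>x. x \<in> space \<Omega> \<Longrightarrow> h x \<in> {0..B}" "(\<integral>x. h x \<partial>\<Omega>) = 1"
    and c: "c > 0" and I: "I \<noteq> {}"
    and d: "\<And>i. i \<in> I \<Longrightarrow> (\<lambda>w. d i (fst w) (snd w)) \<in> borel_measurable (M i \<Otimes>\<^sub>M M i)"
    and d_range: "\<And>i s t. i \<in> I \<Longrightarrow> s \<in> space (M i) \<Longrightarrow> t \<in> space (M i) \<Longrightarrow> 0 \<le> d i s t \<and> d i s t \<le> 1"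
    and d_diag: "\<And>i s. i \<in> I \<Longrightarrow> s \<in> space (M i) \<Longrightarrow> d i s s = 0"
  shows "transport_dist (\<lambda>x y. (\<Sum>i\<in>I. d i (x i) (y i)) / real (card I)) (density \<Omega> h) \<Omega>
    \<le> ennreal (c / 2 + Ent h / (4 * c * real (card I)))"
proof -
  obtain js where js: "set js = I" "distinct js" using finite_distinct_list[OF finite_index] by blast
  have len: "length js = card I" using distinct_card[OF js(2)] js(1) by simp
  have card: "real (card I) > 0" using I finite_index by (simp add: card_gt_0_iff)
  \<comment> \<open>The unnormalized sum is used so that changing one coordinate costs at most
    1.\<close>
  define C where "C = (\<lambda>w. ennreal (\<Sum>i\<in>I. d i (fst w i) (snd w i)))"
  have Cm: "C \<in> borel_measurable (\<Omega> \<Otimes>\<^sub>M \<Omega>)"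
    unfolding C_def
  proof (intro measurable_compose[OF _ measurable_ennreal] borel_measurable_sum)
    fix i assume i: "i \<in> I"
    have "(\<lambda>w. (fst w i, snd w i)) \<in> measurable (\<Omega> \<Otimes>\<^sub>M \<Omega>) (M i \<Otimes>\<^sub>M M i)"
      by (intro measurable_Pair measurable_compose[OF measurable_fst measurable_component_singleton[OF i]]
        measurable_compose[OF measurable_snd measurable_component_singleton[OF i]])
    from measurable_compose[OF this d[OF i]]
    show "(\<lambda>w. d i (fst w i) (snd w i)) \<in> borel_measurable (\<Omega> \<Otimes>\<^sub>M \<Omega>)" by simp
  qed
  have C_diag: "C (x, x) = 0" if "x \<in> space \<Omega>" for x
    unfolding C_def using d_diag component_space[OF that] by simp
  have C_le: "C (x, x'(k := y)) \<le> C (x, x') + 1"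
    if "x \<in> space \<Omega>" "x' \<in> space \<Omega>" "k \<in> I" "y \<in> space (M k)" for x x' k y
  proof -
    have dr: "0 \<le> d i (x i) (x' i)" if "i \<in> I" for i
      using d_range[OF that component_space component_space] \<open>x \<in> space \<Omega>\<close> \<open>x' \<in> space \<Omega>\<close> that by blast
    have "(\<Sum>i\<in>I. d i (x i) ((x'(k := y)) i)) = d k (x k) y + (\<Sum>i\<in>I - {k}. d i (x i) (x' i))"
      using finite_index that by (simp add: sum.remove[of I k])
    also have "\<dots> \<le> 1 + (\<Sum>i\<in>I. d i (x i) (x' i))"
      using d_range[OF that(3) component_space[OF that(1,3)] that(4)] dr[OF that(3)] finite_index that
      by (simp add: sum.remove[of I k])
    finally have "ennreal (\<Sum>i\<in>I. d i (x i) ((x'(k := y)) i)) \<le> ennreal ((\<Sum>i\<in>I. d i (x i) (x' i)) + 1)"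
      by (intro ennreal_leI) simp
    also have "\<dots> = ennreal (\<Sum>i\<in>I. d i (x i) (x' i)) + 1"
      using dr by (subst ennreal_plus) (auto intro: sum_nonneg)
    finally show ?thesis by (simp add: C_def)
  qed
  define v where "v = avgs triv js h"
  obtain L b where L: "L \<in> couplings (density \<Omega> h) (density \<Omega> v)" "b \<ge> 0" "(\<integral>\<^sup>+w. C w \<partial>L) \<le> ennreal b"
    "b \<le> real (card I) * (c / 2) + (Ent h - Ent v) / (4 * c)"
  proof -
    have "\<exists>L\<in>couplings (density \<Omega> h) (density \<Omega> v). \<exists>b\<ge>0. (\<integral>\<^sup>+w. C w \<partial>L) \<le> ennreal b \<and>
      b \<le> real (length js) * (c * (\<integral>x. h x \<partial>\<Omega>) / 2) + (Ent h - Ent v) / (4 * c)"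
      unfolding v_def
      by (rule transport_chain[OF h(1) _ c Cm]) (fact h(2), fact C_diag, fact C_le, simp add: js)
    then show thesis using that unfolding len h(3) mult_1_right by blast
  qed
  have hb: "h \<in> bmeas \<Omega>" using h(1,2) by (rule bmeas_intervalI)
  \<comment> \<open>Independent of every coordinate, \<open>v\<close> is constant, and averaging has
    preserved its integral.\<close>
  have v1: "v x = 1" if x: "x \<in> space \<Omega>" for x
  proof -
    have "v y = v x" if y: "y \<in> space \<Omega>" for y
    proof (rule invariant_all_eq[where Q=triv, OF _ y x])
      show "invariant i (triv i) v" if "i \<in> I" for i
        unfolding v_def by (rule avgs_invariant) (use js that in auto)
      show "cell (triv i) (y i) = cell (triv i) (x i)" if "i \<in> I" for i
        by (simp only: cell_triv_comp[OF x that] cell_triv_comp[OF y that])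
    qed
    then have "(\<integral>y. v y \<partial>\<Omega>) = (\<integral>y. v x \<partial>\<Omega>)" by (intro Bochner_Integration.integral_cong) auto
    moreover have "(\<integral>y. v y \<partial>\<Omega>) = (\<integral>y. h y \<partial>\<Omega>)"
      unfolding v_def using avgs_adjoint[OF hb cells_triv, of js "\<lambda>_. 1"] js by (simp add: invariant_def)
    ultimately show ?thesis using h(3) P.prob_space by simp
  qed
  have Ev: "Ent v = 0"
    using Ent_cong[of v "\<lambda>_. 1"] v1 by (simp add: Ent_def)
  have "density \<Omega> (\<lambda>x. ennreal (v x)) = density \<Omega> (\<lambda>x. 1)"
  proof (rule density_cong)
    show "(\<lambda>x. ennreal (v x)) \<in> borel_measurable \<Omega>"
      using avgs_bounds[OF h(1,2) cells_triv, of js] js unfolding v_def by auto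
  qed (auto simp: v1)
  then have L1: "L \<in> couplings (density \<Omega> h) \<Omega>" using L(1) by (simp add: density_1)
  have sL: "sets L = sets (\<Omega> \<Otimes>\<^sub>M \<Omega>)"
  proof -
    have "sets L = sets (density \<Omega> h \<Otimes>\<^sub>M \<Omega>)" using L1 by (simp add: couplings_def)
    also have "\<dots> = sets (\<Omega> \<Otimes>\<^sub>M \<Omega>)" by (intro sets_pair_measure_cong) auto
    finally show ?thesis .
  qed
  have "transport_dist (\<lambda>x y. (\<Sum>i\<in>I. d i (x i) (y i)) / real (card I)) (density \<Omega> h) \<Omega>
      \<le> (\<integral>\<^sup>+w. (case w of (x, y) \<Rightarrow> ennreal ((\<Sum>i\<in>I. d i (x i) (y i)) / real (card I))) \<partial>L)"
    unfolding transport_dist_def by (rule INF_lower[OF L1])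
  also have "\<dots> = (\<integral>\<^sup>+w. ennreal (1 / real (card I)) * C w \<partial>L)"
    by (intro nn_integral_cong) (simp add: C_def split_beta' ennreal_mult'[symmetric])
  also have "\<dots> = ennreal (1 / real (card I)) * (\<integral>\<^sup>+w. C w \<partial>L)"
    using Cm measurable_cong_sets[OF sL refl] by (intro nn_integral_cmult) blast
  also have "\<dots> \<le> ennreal (1 / real (card I)) * ennreal b"
    using L(3) by (rule mult_left_mono) simp
  also have "\<dots> = ennreal (b / real (card I))"
    using L(2) by (simp add: ennreal_mult'[symmetric])
  also have "\<dots> \<le> ennreal (c / 2 + Ent h / (4 * c * real (card I)))"
  proof (rule ennreal_leI)
    have "b / real (card I) \<le> (real (card I) * (c / 2) + Ent h / (4 * c)) / real (card I)"
      using L(4) Ev card by (intro divide_right_mono) auto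
    also have "\<dots> = c / 2 + Ent h / (4 * c * real (card I))"
      using card c by (simp add: field_simps)
    finally show "b / real (card I) \<le> c / 2 + Ent h / (4 * c * real (card I))" .
  qed
  finally show ?thesis .
qed

end

subsection \<open>Borel sets of products of separable metric spaces\<close>

lemma space_borel_of[simp]: "space (borel_of X) = topspace X"
  and sets_borel_of: "sets (borel_of X) = sigma_sets (topspace X) {U. openin X U}"
  using openin_subset by (auto simp: borel_of_def intro!: sets_measure_of space_measure_of)

lemma openin_borel_of: "openin X U \<Longrightarrow> U \<in> sets (borel_of X)"
  by (simp add: sets_borel_of)

lemma separable_metric_dense:
  assumes "separable_space (mtopology_of K)"
  obtains D where "countable D" "D \<subseteq> mspace K"
    "\<And>x e. x \<in> mspace K \<Longrightarrow> e > 0 \<Longrightarrow> \<exists>d\<in>D. mdist K x d < e"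
proof -
  obtain D where D: "countable D" "D \<subseteq> mspace K" "mtopology_of K closure_of D = mspace K"
    using assms by (auto simp: separable_space_def)
  interpret Metric_space "mspace K" "mdist K" by simp
  have "\<exists>d\<in>D. mdist K x d < e" if "x \<in> mspace K" "e > 0" for x e
    using D(3) that unfolding mtopology_of_def metric_closure_of by (auto simp: in_mball)
  then show thesis using that D by blast
qed

lemma second_countable_separable_metric:
  assumes "separable_space (mtopology_of K)"
  shows "second_countable (mtopology_of K)"
proof -
  interpret Metric_space "mspace K" "mdist K" by simp
  obtain D where D: "countable D" "D \<subseteq> mspace K"
    "\<And>x e. x \<in> mspace K \<Longrightarrow> e > 0 \<Longrightarrow> \<exists>d\<in>D. mdist K x d < e"
    using separable_metric_dense[OF assms] by metis
  define B where "B = (\<lambda>(d, n). mball d (1 / real (Suc n))) ` (D \<times> (UNIV :: nat set))"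
  show ?thesis
    unfolding second_countable_def
  proof (intro exI conjI allI impI ballI)
    show "countable B" unfolding B_def using D(1) by auto
    show "openin (mtopology_of K) V" if "V \<in> B" for V
      using that unfolding B_def mtopology_of_def by auto
    fix U x assume U: "openin (mtopology_of K) U \<and> x \<in> U"
    then obtain r where r: "r > 0" "mball x r \<subseteq> U" "x \<in> mspace K"
      unfolding mtopology_of_def openin_mtopology by blast
    obtain n where n: "1 / real (Suc n) < r / 2"
      using reals_Archimedean[of "r / 2"] r(1) by (auto simp: inverse_eq_divide)
    obtain d where d: "d \<in> D" "mdist K x d < 1 / real (Suc n)"
      using D(3)[OF r(3), of "1 / real (Suc n)"] by auto
    have dM: "d \<in> mspace K" using d D(2) by auto
    have "mball d (1 / real (Suc n)) \<subseteq> mball x r"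
    proof
      fix y assume y: "y \<in> mball d (1 / real (Suc n))"
      then have "mdist K x y \<le> mdist K x d + mdist K d y" using r(3) dM by (intro triangle) auto
      then show "y \<in> mball x r" using y d(2) n r(3) by auto
    qed
    moreover have "x \<in> mball d (1 / real (Suc n))" using d(2) dM r(3) by (simp add: commute)
    ultimately show "\<exists>V\<in>B. x \<in> V \<and> V \<subseteq> U"
      using r(2) d(1) unfolding B_def by (intro bexI[of _ "mball d (1 / real (Suc n))"]) auto
  qed
qed

text \<open>Second countability of the factors makes every open set of the product a countable union
  of open boxes. The inclusion transfers measurability of \<open>f\<close> and of the parts to the
  product sigma-algebra.\<close>

lemma sets_borel_of_product_subset:
  assumes I: "finite I" and T: "\<And>i. i \<in> I \<Longrightarrow> second_countable (T i)"
    and M: "\<And>i. i \<in> I \<Longrightarrow> sets (M i) = sets (borel_of (T i))"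
  shows "sets (borel_of (product_topology T I)) \<subseteq> sets (PiM I M)"
proof -
  have sp: "space (M i) = topspace (T i)" if "i \<in> I" for i
    using sets_eq_imp_space_eq[OF M[OF that]] by simp
  have spP: "space (PiM I M) = topspace (product_topology T I)"
    using sp by (auto simp: space_PiM topspace_product_topology intro!: PiE_cong)
  obtain \<B> where \<B>: "\<And>i. i \<in> I \<Longrightarrow> countable (\<B> i)" "\<And>i V. i \<in> I \<Longrightarrow> V \<in> \<B> i \<Longrightarrow> openin (T i) V"
    "\<And>i U x. i \<in> I \<Longrightarrow> openin (T i) U \<Longrightarrow> x \<in> U \<Longrightarrow> \<exists>V\<in>\<B> i. x \<in> V \<and> V \<subseteq> U"
    using T unfolding second_countable_def by metis
  have "U \<in> sets (PiM I M)" if U: "openin (product_topology T I) U" for U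
  proof -
    define \<C> where "\<C> = {B \<in> PiE I \<B>. PiE I B \<subseteq> U}"
    have "countable \<C>"
      unfolding \<C>_def by (rule countable_subset[OF _ countable_PiE[OF I \<B>(1)]]) auto
    moreover have "PiE I B \<in> sets (PiM I M)" if "B \<in> \<C>" for B
      using that \<B>(2) M unfolding \<C>_def by (intro sets_PiM_I_finite I) (auto simp: openin_borel_of PiE_iff)
    ultimately have "(\<Union>B\<in>\<C>. PiE I B) \<in> sets (PiM I M)" by (intro sets.countable_UN'') auto
    moreover have "U = (\<Union>B\<in>\<C>. PiE I B)"
    proof (intro equalityI subsetI)
      fix x assume x: "x \<in> U"
      obtain W where W: "\<And>i. i \<in> I \<Longrightarrow> openin (T i) (W i)" "x \<in> PiE I W" "PiE I W \<subseteq> U"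
        using U x unfolding openin_product_topology_alt by metis
      have "\<exists>V\<in>\<B> i. x i \<in> V \<and> V \<subseteq> W i" if "i \<in> I" for i
        using \<B>(3)[OF that W(1)[OF that]] W(2) that by (auto simp: PiE_iff)
      then obtain B where B: "\<And>i. i \<in> I \<Longrightarrow> B i \<in> \<B> i \<and> x i \<in> B i \<and> B i \<subseteq> W i" by metis
      have "restrict B I \<in> \<C>"
        unfolding \<C>_def using B W(3) PiE_mono[of I "restrict B I" W] by auto
      moreover have "x \<in> PiE I (restrict B I)" using B W(2) by (auto simp: PiE_iff)
      ultimately show "x \<in> (\<Union>B\<in>\<C>. PiE I B)" by blast
    qed (auto simp: \<C>_def)
    ultimately show ?thesis by simp
  qed
  then have "{U. openin (product_topology T I) U} \<subseteq> sets (PiM I M)" by auto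
  then show ?thesis
    unfolding sets_borel_of spP[symmetric] by (rule sets.sigma_sets_subset)
qed

lemma continuous_map_borel_of:
  assumes "continuous_map X euclideanreal f"
  shows "f \<in> borel_measurable (borel_of X)"
proof (rule borel_measurableI)
  fix S :: "real set" assume "open S"
  then have "openin X {x \<in> topspace X. f x \<in> S}"
    using assms by (auto simp: continuous_map_def)
  moreover have "f -` S \<inter> space (borel_of X) = {x \<in> topspace X. f x \<in> S}" by auto
  ultimately show "f -` S \<inter> space (borel_of X) \<in> sets (borel_of X)"
    by (simp add: openin_borel_of)
qed

text \<open>With a countable dense \<open>D\<close>, the distance is below \<open>a\<close> exactly
  when some detour through a point of \<open>D\<close> is shorter than \<open>a\<close>. This gives
  a countable union built from functions of one variable.\<close>

lemma measurable_mdist: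
  assumes sep: "separable_space (mtopology_of K)" and N: "sets N = sets (borel_of (mtopology_of K))"
  shows "(\<lambda>w. mdist K (fst w) (snd w)) \<in> borel_measurable (N \<Otimes>\<^sub>M N)"
proof -
  interpret Metric_space "mspace K" "mdist K" by simp
  have sp: "space N = mspace K" using sets_eq_imp_space_eq[OF N] by simp
  obtain D where D: "countable D" "D \<subseteq> mspace K"
    "\<And>x e. x \<in> mspace K \<Longrightarrow> e > 0 \<Longrightarrow> \<exists>d\<in>D. mdist K x d < e"
    using separable_metric_dense[OF sep] by metis
  have md: "(\<lambda>x. mdist K x d) \<in> borel_measurable N" if "d \<in> D" for d
    unfolding borel_measurable_iff_less
  proof
    fix a
    have "{x \<in> space N. mdist K x d < a} = mball d a"
      using that D(2) by (auto simp: sp commute)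
    then show "{x \<in> space N. mdist K x d < a} \<in> sets N"
      unfolding N by (simp add: openin_borel_of mtopology_of_def)
  qed
  show ?thesis
    unfolding borel_measurable_iff_less
  proof
    fix a
    have eq: "{w \<in> space (N \<Otimes>\<^sub>M N). mdist K (fst w) (snd w) < a}
      = (\<Union>d\<in>D. {w \<in> space (N \<Otimes>\<^sub>M N). mdist K (fst w) d + mdist K (snd w) d < a})"
    proof (intro equalityI subsetI)
      fix w assume w: "w \<in> {w \<in> space (N \<Otimes>\<^sub>M N). mdist K (fst w) (snd w) < a}"
      then have wM: "fst w \<in> mspace K" "snd w \<in> mspace K" by (auto simp: space_pair_measure sp)
      \<comment> \<open>Half of the slack, because a detour through \<open>d\<close> pays the
        distance from \<open>snd w\<close> to \<open>d\<close> twice.\<close>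
      define e where "e = (a - mdist K (fst w) (snd w)) / 2"
      have "e > 0" using w by (auto simp: e_def)
      then obtain d where d: "d \<in> D" "mdist K (snd w) d < e" using D(3)[OF wM(2)] by blast
      have "mdist K (fst w) d \<le> mdist K (fst w) (snd w) + mdist K (snd w) d"
        using wM d D(2) by (intro triangle) auto
      then have "mdist K (fst w) d + mdist K (snd w) d < a" using d(2) by (simp add: e_def)
      then show "w \<in> (\<Union>d\<in>D. {w \<in> space (N \<Otimes>\<^sub>M N). mdist K (fst w) d + mdist K (snd w) d < a})"
        using d(1) w by blast
    next
      fix w assume "w \<in> (\<Union>d\<in>D. {w \<in> space (N \<Otimes>\<^sub>M N). mdist K (fst w) d + mdist K (snd w) d < a})"
      then obtain d where d: "d \<in> D" "w \<in> space (N \<Otimes>\<^sub>M N)" "mdist K (fst w) d + mdist K (snd w) d < a" by blast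
      then have "mdist K (fst w) (snd w) \<le> mdist K (fst w) d + mdist K (snd w) d"
        using triangle[of "fst w" d "snd w"] D(2) by (auto simp: space_pair_measure sp commute)
      then show "w \<in> {w \<in> space (N \<Otimes>\<^sub>M N). mdist K (fst w) (snd w) < a}" using d by simp
    qed
    have "{w \<in> space (N \<Otimes>\<^sub>M N). mdist K (fst w) d + mdist K (snd w) d < a} \<in> sets (N \<Otimes>\<^sub>M N)" if "d \<in> D" for d
    proof -
      note md[OF that, measurable]
      show ?thesis by measurable
    qed
    then show "{w \<in> space (N \<Otimes>\<^sub>M N). mdist K (fst w) (snd w) < a} \<in> sets (N \<Otimes>\<^sub>M N)"
      unfolding eq using D(1) by (intro sets.countable_UN'') auto
  qed
qed

section \<open>Product densities\<close>

context finite_product_prob_space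
begin

text \<open>The family falls back to \<open>M i\<close> outside \<open>I\<close> because the locale
  asks for a probability measure at every index.\<close>

lemma finite_product_prob_space_density:
  assumes q: "\<And>i. i \<in> I \<Longrightarrow> q i \<in> borel_measurable (M i)" "\<And>i. i \<in> I \<Longrightarrow> (\<integral>\<^sup>+s. ennreal (q i s) \<partial>M i) = 1"
  shows "finite_product_prob_space (\<lambda>i. if i \<in> I then density (M i) (\<lambda>s. ennreal (q i s)) else M i) I"
proof -
  let ?N = "\<lambda>i. if i \<in> I then density (M i) (\<lambda>s. ennreal (q i s)) else M i"
  have "prob_space (?N i)" for i
  proof (cases "i \<in> I")
    case True
    have "emeasure (density (M i) (\<lambda>s. ennreal (q i s))) (space (M i)) = (\<integral>\<^sup>+s. ennreal (q i s) \<partial>M i)"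
      using q(1)[OF True] by (subst emeasure_density) (auto intro!: nn_integral_cong)
    then show ?thesis using True q(2)[OF True] by (auto intro!: prob_spaceI)
  qed (simp add: M.prob_space_axioms)
  then interpret N: product_prob_space ?N by (intro product_prob_spaceI)
  show ?thesis
    by standard (rule finite_index)
qed

text \<open>Both measures agree on boxes. Absorbing the density into the factors allows everything
  proved about \<open>\<Omega>\<close> to be reused with \<open>\<xi>\<close> as reference
  measure.\<close>

lemma density_prod_PiM:
  assumes q: "\<And>i. i \<in> I \<Longrightarrow> q i \<in> borel_measurable (M i)" "\<And>i. i \<in> I \<Longrightarrow> (\<integral>\<^sup>+s. ennreal (q i s) \<partial>M i) = 1"
    "\<And>i s. i \<in> I \<Longrightarrow> q i s \<ge> 0"
  shows "density \<Omega> (\<lambda>x. ennreal (\<Prod>i\<in>I. q i (x i)))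
    = PiM I (\<lambda>i. if i \<in> I then density (M i) (\<lambda>s. ennreal (q i s)) else M i)"
proof -
  let ?N = "\<lambda>i. if i \<in> I then density (M i) (\<lambda>s. ennreal (q i s)) else M i"
  interpret N: finite_product_prob_space ?N I
    by (rule finite_product_prob_space_density) (fact q)+
  show ?thesis
  proof (rule N.PiM_eqI[OF finite_index])
    show "sets (density \<Omega> (\<lambda>x. ennreal (\<Prod>i\<in>I. q i (x i)))) = sets (PiM I ?N)"
      unfolding sets_density by (rule sets_PiM_cong) auto
    fix A assume A: "\<And>i. i \<in> I \<Longrightarrow> A i \<in> sets (?N i)"
    then have A': "\<And>i. i \<in> I \<Longrightarrow> A i \<in> sets (M i)" by auto
    have qm: "(\<lambda>x. \<Prod>i\<in>I. q i (x i)) \<in> borel_measurable \<Omega>"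
    proof (rule borel_measurable_prod)
      fix i assume i: "i \<in> I"
      show "(\<lambda>x. q i (x i)) \<in> borel_measurable \<Omega>"
        by (rule measurable_compose[OF measurable_component_singleton[OF i, of M] q(1)[OF i]])
    qed
    have "emeasure (density \<Omega> (\<lambda>x. ennreal (\<Prod>i\<in>I. q i (x i)))) (PiE I A)
        = (\<integral>\<^sup>+x. ennreal (\<Prod>i\<in>I. q i (x i)) * indicator (PiE I A) x \<partial>\<Omega>)"
      by (intro emeasure_density measurable_compose[OF qm measurable_ennreal] sets_PiM_I_finite finite_index A')
    also have "\<dots> = (\<integral>\<^sup>+x. (\<Prod>i\<in>I. ennreal (q i (x i)) * indicator (A i) (x i)) \<partial>\<Omega>)"
    proof (rule nn_integral_cong)
      fix x assume x: "x \<in> space \<Omega>"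
      have "indicator (PiE I A) x = (\<Prod>i\<in>I. indicator (A i) (x i) :: ennreal)"
      proof (cases "x \<in> PiE I A")
        case False
        then obtain i where "i \<in> I" "x i \<notin> A i" using x by (auto simp: space_PiM PiE_iff)
        then have "(\<Prod>i\<in>I. indicator (A i) (x i) :: ennreal) = 0" using finite_index by (intro prod_zero) (auto intro!: bexI[of _ i])
        then show ?thesis using False by simp
      qed (auto simp: PiE_iff)
      then show "ennreal (\<Prod>i\<in>I. q i (x i)) * indicator (PiE I A) x
          = (\<Prod>i\<in>I. ennreal (q i (x i)) * indicator (A i) (x i))"
        using q(3) by (simp add: prod.distrib prod_ennreal)
    qed
    also have "\<dots> = (\<Prod>i\<in>I. \<integral>\<^sup>+s. ennreal (q i s) * indicator (A i) s \<partial>M i)"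
      by (intro product_nn_integral_prod finite_index borel_measurable_times_ennreal
        measurable_compose[OF q(1) measurable_ennreal] borel_measurable_indicator A')
    also have "\<dots> = (\<Prod>i\<in>I. emeasure (?N i) (A i))"
    proof (rule prod.cong[OF refl])
      fix i assume i: "i \<in> I"
      have "(\<integral>\<^sup>+s. ennreal (q i s) * indicator (A i) s \<partial>M i) = emeasure (density (M i) (\<lambda>s. ennreal (q i s))) (A i)"
        by (intro emeasure_density[symmetric] measurable_compose[OF q(1)[OF i] measurable_ennreal] A' i)
      then show "(\<integral>\<^sup>+s. ennreal (q i s) * indicator (A i) s \<partial>M i) = emeasure (?N i) (A i)" using i by simp
    qed
    finally show "emeasure (density \<Omega> (\<lambda>x. ennreal (\<Prod>i\<in>I. q i (x i)))) (PiE I A) = (\<Prod>i\<in>I. emeasure (?N i) (A i))" .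
  qed
qed

end

subsection \<open>Gibbs measures\<close>

locale gibbs_product = finite_product_prob_space M I
  for M :: "'i \<Rightarrow> 'a measure" and I +
  fixes f :: "('i \<Rightarrow> 'a) \<Rightarrow> real" and pt :: "'i \<Rightarrow> 'a" and b :: real
  assumes f_measurable: "f \<in> borel_measurable (PiM I M)"
    and f_bound: "\<And>x. x \<in> space (PiM I M) \<Longrightarrow> \<bar>f x\<bar> \<le> b"
    and pt_space: "\<And>i. i \<in> I \<Longrightarrow> pt i \<in> space (M i)"
    and nonempty: "I \<noteq> {}"
begin

definition "Z = (\<integral>x. exp (f x) \<partial>\<Omega>)"
definition "p x = exp (f x) / Z"
text \<open>The first argument is the base point: this is the gradient of \<open>f\<close> at
  \<open>y\<close>, evaluated at \<open>x\<close>. Below, \<open>site i y\<close> is its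
  \<open>i\<close>-th summand, and \<open>log_Z y\<close> will be the log-normalizer of
  \<open>\<xi>\<close> at \<open>y\<close>.\<close>

definition "grad y x = (\<Sum>i\<in>I. f (y(i := x i)) - f (y(i := pt i)))"
definition "site i y s = f (y(i := s)) - f (y(i := pt i))"
definition "site_Z i y = (\<integral>s. exp (site i y s) \<partial>M i)"
definition "log_Z y = (\<Sum>i\<in>I. ln (site_Z i y))"

lemma f_bmeas: "f \<in> bmeas \<Omega>"
  using f_measurable f_bound by (rule bmeasI)

lemma exp_f_range: "x \<in> space \<Omega> \<Longrightarrow> exp (f x) \<in> {exp (- b)..exp b}"
  using f_bound[of x] by auto

lemma Z_pos: "Z > 0"
proof -
  have "Z \<in> {exp (- b)..exp b}"
    unfolding Z_def by (rule integral_in_interval) (use f_measurable exp_f_range in auto)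
  then show ?thesis by (auto intro: less_le_trans[OF exp_gt_zero])
qed

sublocale product_density M I p "exp (- b) / Z" "exp b / Z"
proof
  show "p \<in> borel_measurable \<Omega>" unfolding p_def using f_measurable by measurable
  show "p x \<in> {exp (- b) / Z..exp b / Z}" if "x \<in> space \<Omega>" for x
    using exp_f_range[OF that] Z_pos by (auto simp: p_def divide_right_mono)
  show "(\<integral>x. p x \<partial>\<Omega>) = 1" using Z_pos unfolding p_def by (simp add: Z_def)
qed (use Z_pos in auto)

lemma gibbs_eq: "gibbs \<Omega> f = \<mu>"
  unfolding gibbs_def \<mu>_def p_def Z_def ..

lemma site_bmeas:
  assumes "y \<in> space \<Omega>" "i \<in> I"
  shows "site i y \<in> bmeas (M i)"
  unfolding site_def[abs_def] by (intro bmeas_diff bmeas_section f_bmeas assms bmeas_const)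

lemma site_Z_pos:
  assumes "y \<in> space \<Omega>" "i \<in> I"
  shows "site_Z i y > 0"
proof -
  obtain B where B: "site i y \<in> borel_measurable (M i)" "\<And>s. s \<in> space (M i) \<Longrightarrow> \<bar>site i y s\<bar> \<le> B"
    using bmeasE[OF site_bmeas[OF assms]] by metis
  have "site_Z i y \<in> {exp (- B)..exp B}"
    unfolding site_Z_def by (rule M.integral_in_interval) (use B in \<open>fastforce simp: abs_le_iff\<close>)+
  then show ?thesis by (auto intro: less_le_trans[OF exp_gt_zero])
qed

lemma site_Z_eq: "site_Z i y = exp (- f (y(i := pt i))) * marg i (\<lambda>x. exp (f x)) y"
  unfolding site_Z_def site_def marg_def by (simp add: exp_diff exp_minus field_simps)

text \<open>The summand \<open>site i y\<close> differs from \<open>f\<close> along the fibre by the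
  value at the reference point only, so up to this value and \<open>Z\<close> its normalizer is the
  marginal of \<open>p\<close>. This is what identifies the factors of \<open>\<xi>\<close> with
  one-site conditional laws.\<close>

lemma ln_site_Z:
  assumes "y \<in> space \<Omega>" "i \<in> I"
  shows "ln (site_Z i y) = - f (y(i := pt i)) + ln (marg i p y) + ln Z"
proof -
  have "marg i (\<lambda>x. exp (f x)) y = Z * marg i p y"
    using Z_pos by (simp add: p_def[abs_def] marg_def)
  then have "site_Z i y = exp (- f (y(i := pt i))) * (Z * marg i p y)"
    by (simp add: site_Z_eq)
  moreover have "marg i p y > 0"
    using site_Z_pos[OF assms] Z_pos calculation by (simp add: zero_less_mult_iff)
  ultimately show ?thesis using Z_pos by (simp add: ln_mult)
qed

lemma grad_eq_site: "grad y x = (\<Sum>i\<in>I. site i y (x i))"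
  by (simp add: grad_def site_def)

text \<open>The product form serves as reference measure in the transport inequality; the
  exponential form gives the log-density for the divergence.\<close>

lemma gibbs_grad:
  assumes y: "y \<in> space \<Omega>"
  defines "N \<equiv> \<lambda>i. if i \<in> I then density (M i) (\<lambda>s. ennreal (exp (site i y s) / site_Z i y)) else M i"
  shows "finite_product_prob_space N I" "gibbs \<Omega> (grad y) = PiM I N"
    "gibbs \<Omega> (grad y) = density \<Omega> (\<lambda>x. ennreal (exp (grad y x - log_Z y)))"
proof -
  note sb = site_bmeas[OF y] and sp = site_Z_pos[OF y]
  have eb: "(\<lambda>s. exp (site i y s)) \<in> bmeas (M i)" if "i \<in> I" for i
    using bmeas_exp[OF sb[OF that]] .
  have q: "(\<lambda>s. exp (site i y s) / site_Z i y) \<in> bmeas (M i)" if "i \<in> I" for i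
    unfolding divide_inverse by (intro bmeas_mult eb that bmeas_const)
  have qi: "(\<integral>\<^sup>+s. ennreal (exp (site i y s) / site_Z i y) \<partial>M i) = 1" if i: "i \<in> I" for i
  proof -
    have "(\<integral>\<^sup>+s. ennreal (exp (site i y s) / site_Z i y) \<partial>M i) = ennreal (\<integral>s. exp (site i y s) / site_Z i y \<partial>M i)"
      using sp[OF i] by (intro nn_integral_eq_integral M.integrable_bmeas q i AE_I2) (simp add: less_imp_le)
    also have "(\<integral>s. exp (site i y s) / site_Z i y \<partial>M i) = 1"
      using sp[OF i] by (simp add: site_Z_def)
    finally show ?thesis by simp
  qed
  show "finite_product_prob_space N I"
    unfolding N_def by (rule finite_product_prob_space_density) (fact bmeas_measurable[OF q], fact qi)
  have prodZ: "(\<integral>x. exp (grad y x) \<partial>\<Omega>) = (\<Prod>i\<in>I. site_Z i y)"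
    unfolding grad_eq_site exp_sum[OF finite_index] site_Z_def
    by (intro product_integral_prod finite_index M.integrable_bmeas eb)
  have "gibbs \<Omega> (grad y) = density \<Omega> (\<lambda>x. ennreal (\<Prod>i\<in>I. exp (site i y (x i)) / site_Z i y))"
    unfolding gibbs_def prodZ unfolding grad_eq_site exp_sum[OF finite_index] prod_dividef ..
  also have "\<dots> = PiM I N"
    unfolding N_def
    by (rule density_prod_PiM) (fact bmeas_measurable[OF q], fact qi, use sp in \<open>simp add: less_imp_le\<close>)
  finally show "gibbs \<Omega> (grad y) = PiM I N" .
  have "exp (log_Z y) = (\<Prod>i\<in>I. site_Z i y)"
    unfolding log_Z_def exp_sum[OF finite_index] using sp by (intro prod.cong) auto
  then show "gibbs \<Omega> (grad y) = density \<Omega> (\<lambda>x. ennreal (exp (grad y x - log_Z y)))"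
    unfolding gibbs_def prodZ by (simp add: exp_diff)
qed

lemma update_comp_measurable:
  assumes "i \<in> I"
  shows "(\<lambda>w. (fst w)(i := snd w i)) \<in> measurable (\<Omega> \<Otimes>\<^sub>M \<Omega>) \<Omega>"
  by (rule measurable_update[OF assms measurable_fst
    measurable_compose[OF measurable_snd measurable_component_singleton[OF assms, of M]]])

lemma update_pt_measurable:
  assumes "i \<in> I"
  shows "(\<lambda>x. x(i := pt i)) \<in> measurable \<Omega> \<Omega>"
  by (rule measurable_update[OF assms measurable_ident_sets[OF refl] measurable_const[OF pt_space[OF assms]]])

lemma grad_bmeas: "(\<lambda>w. grad (fst w) (snd w)) \<in> bmeas (\<Omega> \<Otimes>\<^sub>M \<Omega>)"
  unfolding grad_def
  by (intro bmeas_sum bmeas_diff bmeas_compose[OF f_bmeas] update_comp_measurable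
    measurable_compose[OF measurable_fst update_pt_measurable])

lemma grad_section: "y \<in> space \<Omega> \<Longrightarrow> grad y \<in> bmeas \<Omega>"
  using bmeas_compose[OF grad_bmeas measurable_Pair1'] by simp

lemma marg_p_range: "x \<in> space \<Omega> \<Longrightarrow> i \<in> I \<Longrightarrow> marg i p x \<in> {exp (- b) / Z..exp b / Z}"
  using avg_interval[OF p_measurable p_bounds] by (simp add: marg_eq_avg)

lemma ln_marg_p_bmeas: "i \<in> I \<Longrightarrow> (\<lambda>x. ln (marg i p x)) \<in> bmeas \<Omega>"
  by (rule bmeas_ln[OF bmeas_measurable[OF marg_bmeas[OF p_bmeas]] m_pos marg_p_range])

lemma log_Z_bmeas: "log_Z \<in> bmeas \<Omega>"
proof -
  have "(\<lambda>y. \<Sum>i\<in>I. - f (y(i := pt i)) + ln (marg i p y) + ln Z) \<in> bmeas \<Omega>"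
    by (intro bmeas_sum bmeas_add bmeas_uminus bmeas_compose[OF f_bmeas] update_pt_measurable
      ln_marg_p_bmeas bmeas_const)
  then show ?thesis
    by (rule bmeas_cong) (simp add: log_Z_def ln_site_Z)
qed

lemma ln_p: "ln (p x) = f x - ln Z"
  using Z_pos by (simp add: p_def ln_div)

text \<open>The integrand is log(d\<mu>/d\<xi>) at \<open>x\<close> with gradient taken at the same
  \<open>x\<close>. The reference-point values cancel between \<open>grad x x\<close> and
  \<open>log_Z x\<close>, leaving logarithms of \<open>p\<close> and its marginals;
  \<open>marg_adjoint\<close> turns their \<open>\<mu>\<close>-integrals into entropies.\<close>

lemma integral_diagonal:
  "(\<integral>x. f x - ln Z - grad x x + log_Z x \<partial>\<mu>) = - dtc p"
proof -
  have lp: "(\<lambda>x. ln (p x)) \<in> bmeas \<Omega>" by (rule bmeas_ln[OF p_measurable m_pos p_bounds])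
  have eq: "f x - ln Z - grad x x + log_Z x = (1 - real (card I)) * ln (p x) + (\<Sum>i\<in>I. ln (marg i p x))"
    if x: "x \<in> space \<Omega>" for x
  proof -
    have "grad x x = (\<Sum>i\<in>I. f x - f (x(i := pt i)))" by (simp add: grad_def)
    then show ?thesis
      using x by (simp add: log_Z_def ln_site_Z ln_p sum.distrib sum_subtractf sum_negf algebra_simps)
  qed
  have "(\<integral>x. f x - ln Z - grad x x + log_Z x \<partial>\<mu>)
      = (\<integral>x. (1 - real (card I)) * ln (p x) + (\<Sum>i\<in>I. ln (marg i p x)) \<partial>\<mu>)"
    by (intro Bochner_Integration.integral_cong refl) (simp add: eq)
  also have "\<dots> = (1 - real (card I)) * (\<integral>x. ln (p x) \<partial>\<mu>) + (\<Sum>i\<in>I. \<integral>x. ln (marg i p x) \<partial>\<mu>)"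
  proof -
    have "integrable \<mu> (\<lambda>x. ln (p x))" "\<And>i. i \<in> I \<Longrightarrow> integrable \<mu> (\<lambda>x. ln (marg i p x))"
      using lp ln_marg_p_bmeas unfolding bmeas_\<mu>[symmetric] by (auto intro: \<mu>.integrable_bmeas)
    then show ?thesis by simp
  qed
  also have "(\<integral>x. ln (p x) \<partial>\<mu>) = Ent p"
    unfolding integral_\<mu>[OF bmeas_measurable[OF lp]] Ent_def ..
  also have "(\<Sum>i\<in>I. \<integral>x. ln (marg i p x) \<partial>\<mu>) = (\<Sum>i\<in>I. Ent (marg i p))"
  proof (rule sum.cong[OF refl])
    fix i assume i: "i \<in> I"
    show "(\<integral>x. ln (marg i p x) \<partial>\<mu>) = Ent (marg i p)"
      unfolding integral_\<mu>[OF bmeas_measurable[OF ln_marg_p_bmeas[OF i]]] Ent_def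
      by (rule marg_adjoint[OF p_bmeas ln_marg_p_bmeas[OF i] i invariant_ln[OF marg_invariant], symmetric])
  qed
  finally show ?thesis by (simp add: dtc_def algebra_simps)
qed

text \<open>Density of \<open>\<mu>\<close> conditioned on \<open>P\<close> with respect to
  \<open>\<xi>\<close> at \<open>y\<close>.\<close>

definition "cond_dens P y x =
  indicator P x * exp (f x - ln Z - ln (measure \<mu> P) - (grad y x - log_Z y))"

text \<open>The divergence as a real number. Its integrand is the exponent of
  \<open>cond_dens\<close> without the indicator, hence bounded and explicit in both
  variables.\<close>

definition "kl P y = (\<integral>x. f x - ln Z - ln (measure \<mu> P) - (grad y x - log_Z y) \<partial>uniform_measure \<mu> P)"

context
  fixes P assumes P: "P \<in> sets \<Omega>" and P_pos: "measure \<mu> P > 0"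
begin

lemma P_uniform: "prob_space (uniform_measure \<mu> P)"
  using P_pos by (intro prob_space_uniform_measure) (auto simp: \<mu>.emeasure_eq_measure)

lemma bmeas_P: "bmeas (uniform_measure \<mu> P) = bmeas \<Omega>"
  by (rule bmeas_sets_cong) simp

lemma kl_integrand_bmeas:
  "y \<in> space \<Omega> \<Longrightarrow> (\<lambda>x. f x - ln Z - ln (measure \<mu> P) - (grad y x - log_Z y)) \<in> bmeas \<Omega>"
  by (intro bmeas_diff f_bmeas bmeas_const grad_section)

lemma conditional_density:
  assumes y: "y \<in> space \<Omega>"
  defines "h \<equiv> cond_dens P y"
  shows "h \<in> bmeas \<Omega>" "uniform_measure \<mu> P = density (gibbs \<Omega> (grad y)) (\<lambda>x. ennreal (h x))"
    "(\<integral>x. h x * ln (h x) \<partial>gibbs \<Omega> (grad y)) = kl P y"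
proof -
  let ?e = "\<lambda>x. f x - ln Z - ln (measure \<mu> P) - (grad y x - log_Z y)"
  note h_def = h_def[unfolded cond_dens_def[abs_def]]
  show h: "h \<in> bmeas \<Omega>"
    unfolding h_def by (intro bmeas_mult bmeas_indicator P bmeas_exp kl_integrand_bmeas y)
  have hm: "h \<in> borel_measurable \<Omega>" and gm: "grad y \<in> borel_measurable \<Omega>"
    using h grad_section[OF y] by (auto dest: bmeas_measurable)
  have h0: "h x \<ge> 0" for x by (simp add: h_def cond_dens_def)
  have "uniform_measure \<mu> P = density \<mu> (\<lambda>x. ennreal (indicator P x / measure \<mu> P))"
    by (rule uniform_measure_eq_density[OF P_pos])
  also have "\<dots> = density \<Omega> (\<lambda>x. ennreal (p x) * ennreal (indicator P x / measure \<mu> P))"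
    using P p_measurable
    by (subst density_density_eq[symmetric]) (auto simp: \<mu>_def)
  also have "\<dots> = density \<Omega> (\<lambda>x. ennreal (exp (grad y x - log_Z y)) * ennreal (h x))"
  proof (intro density_cong AE_I2)
    fix x assume x: "x \<in> space \<Omega>"
    have "exp (grad y x - log_Z y) * h x = p x * (indicator P x / measure \<mu> P)"
      using Z_pos P_pos by (simp add: h_def p_def exp_diff)
    then show "ennreal (p x) * ennreal (indicator P x / measure \<mu> P) = ennreal (exp (grad y x - log_Z y)) * ennreal (h x)"
      using p_pos[OF x] h0 P_pos by (simp add: ennreal_mult'[symmetric])
  qed (use P p_measurable hm gm in \<open>auto\<close>)
  also have "\<dots> = density (gibbs \<Omega> (grad y)) (\<lambda>x. ennreal (h x))"
    unfolding gibbs_grad(3)[OF y] using hm gm by (intro density_density_eq[symmetric]) auto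
  finally show u: "uniform_measure \<mu> P = density (gibbs \<Omega> (grad y)) (\<lambda>x. ennreal (h x))" .
  have sg: "sets (gibbs \<Omega> (grad y)) = sets \<Omega>" by (simp add: gibbs_def)
  have em: "?e \<in> borel_measurable \<Omega>" using kl_integrand_bmeas[OF y] by (rule bmeas_measurable)
  have "kl P y = (\<integral>x. h x * ?e x \<partial>gibbs \<Omega> (grad y))"
    unfolding kl_def u using hm em h0 measurable_cong_sets[OF sg refl, of borel]
    by (subst integral_density) auto
  \<comment> \<open>On \<open>P\<close> the logarithm of \<open>h\<close> is the exponent; off
    \<open>P\<close> the factor \<open>h\<close> is zero on both sides.\<close>
  also have "\<dots> = (\<integral>x. h x * ln (h x) \<partial>gibbs \<Omega> (grad y))"
    by (intro Bochner_Integration.integral_cong refl) (simp add: h_def indicator_def)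
  finally show "(\<integral>x. h x * ln (h x) \<partial>gibbs \<Omega> (grad y)) = kl P y" by simp
qed

text \<open>Absolute continuity and integrability must be verified, as otherwise \<open>KL\<close>
  is infinite. Both follow from the bounded density \<open>h\<close>, once it is identified with the
  Radon-Nikodym derivative, which holds almost everywhere.\<close>

lemma KL_eq_kl:
  assumes y: "y \<in> space \<Omega>"
  shows "KL (uniform_measure \<mu> P) (gibbs \<Omega> (grad y)) = ennreal (kl P y)" "kl P y \<ge> 0"
proof -
  define h where "h = cond_dens P y"
  note cd = conditional_density[OF y, folded h_def]
  let ?G = "gibbs \<Omega> (grad y)"
  interpret N: finite_product_prob_space "\<lambda>i. if i \<in> I then density (M i) (\<lambda>s. ennreal (exp (site i y s) / site_Z i y)) else M i" I
    by (rule gibbs_grad(1)[OF y])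
  interpret G: prob_space ?G
    unfolding gibbs_grad(2)[OF y] by (rule N.P.prob_space_axioms)
  have sg: "sets ?G = sets \<Omega>" by (simp add: gibbs_def)
  have hG: "h \<in> bmeas ?G" using cd(1) bmeas_sets_cong[OF sg] by simp
  have hm: "h \<in> borel_measurable ?G" using hG by (rule bmeas_measurable)
  have h0: "h x \<ge> 0" for x by (simp add: h_def cond_dens_def)
  have hl: "(\<lambda>x. h x * ln (h x)) \<in> bmeas ?G" by (rule bmeas_xlnx[OF hG h0])
  have kl: "KL_divergence (exp 1) ?G (uniform_measure \<mu> P) = kl P y"
    unfolding cd(2) cd(3)[symmetric]
    using G.KL_density[of "exp 1" h] hm h0 by (simp add: log_def)
  have ac: "absolutely_continuous ?G (uniform_measure \<mu> P)"
    unfolding cd(2) using hm by (intro absolutely_continuousI_density) simp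
  have int: "integrable (uniform_measure \<mu> P) (entropy_density (exp 1) ?G (uniform_measure \<mu> P))"
  proof -
    let ?E = "entropy_density (exp 1) ?G (uniform_measure \<mu> P)"
    have "AE x in ?G. ennreal (h x) = RN_deriv ?G (density ?G h) x"
      using hm by (intro G.RN_deriv_unique) auto
    then have ae: "AE x in ?G. h x * ln (h x) = h x * ?E x"
      unfolding cd(2)
    proof eventually_elim
      case (elim x)
      show ?case
        unfolding entropy_density_def comp_def elim[symmetric] using h0[of x] by (simp add: log_def)
    qed
    have Em: "?E \<in> borel_measurable ?G" by (rule measurable_entropy_density)
    have "integrable ?G (\<lambda>x. h x * ?E x)"
      using integrable_cong_AE[THEN iffD1, OF _ _ ae G.integrable_bmeas[OF hl]] hm Em by simp
    then have "integrable (density ?G h) ?E"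
      using hm Em h0 by (subst integrable_real_density) auto
    then show ?thesis unfolding cd(2) .
  qed
  show "KL (uniform_measure \<mu> P) ?G = ennreal (kl P y)"
    unfolding KL_def using ac int kl by simp
  have ih: "(\<integral>x. h x \<partial>?G) = 1"
  proof -
    interpret U: prob_space "density ?G h" unfolding cd(2)[symmetric] by (rule P_uniform)
    have "(\<integral>\<^sup>+x. ennreal (h x) \<partial>?G) = emeasure (density ?G h) (space ?G)"
      using hm by (subst emeasure_density) (auto intro!: nn_integral_cong)
    also have "\<dots> = 1" using U.emeasure_space_1 by simp
    finally show ?thesis
      using G.integrable_bmeas[OF hG] h0 by (simp add: integral_eq_nn_integral)
  qed
  \<comment> \<open>Gibbs' inequality: the left-hand side is zero because \<open>h\<close> has
    integral one.\<close>
  have "(\<integral>x. h x - 1 \<partial>?G) \<le> (\<integral>x. h x * ln (h x) \<partial>?G)"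
  proof (rule integral_mono)
    fix x
    show "h x - 1 \<le> h x * ln (h x)"
    proof (cases "h x = 0")
      case False
      then have hp: "h x > 0" using h0[of x] by simp
      have "ln (1 / h x) \<le> 1 / h x - 1" using hp by (intro ln_le_minus_one) simp
      then have "h x * (1 - 1 / h x) \<le> h x * ln (h x)" using hp by (intro mult_left_mono) (auto simp: ln_div)
      then show ?thesis using hp by (simp add: algebra_simps)
    qed simp
  qed (intro G.integrable_bmeas bmeas_diff hG bmeas_const hl)+
  then show "kl P y \<ge> 0"
    using cd(3) ih G.integrable_bmeas[OF hG] by (simp add: G.prob_space)
qed

text \<open>The transport inequality is applied with the product measure \<open>\<xi>\<close> in the
  role of \<open>\<Omega>\<close>; relative to it, the entropy of \<open>cond_dens\<close> is the
  divergence.\<close>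

lemma transport_le_kl:
  fixes d :: "'i \<Rightarrow> 'a \<Rightarrow> 'a \<Rightarrow> real"
  assumes y: "y \<in> space \<Omega>" and c: "c > 0"
    and d: "\<And>i. i \<in> I \<Longrightarrow> (\<lambda>w. d i (fst w) (snd w)) \<in> borel_measurable (M i \<Otimes>\<^sub>M M i)"
    and d_range: "\<And>i s t. i \<in> I \<Longrightarrow> s \<in> space (M i) \<Longrightarrow> t \<in> space (M i) \<Longrightarrow> 0 \<le> d i s t \<and> d i s t \<le> 1"
    and d_diag: "\<And>i s. i \<in> I \<Longrightarrow> s \<in> space (M i) \<Longrightarrow> d i s s = 0"
  shows "transport_dist (\<lambda>x y. (\<Sum>i\<in>I. d i (x i) (y i)) / real (card I)) (uniform_measure \<mu> P) (gibbs \<Omega> (grad y))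
    \<le> ennreal (c / 2 + kl P y / (4 * c * real (card I)))"
proof -
  define h where "h = cond_dens P y"
  note cd = conditional_density[OF y, folded h_def]
  let ?N = "\<lambda>i. if i \<in> I then density (M i) (\<lambda>s. ennreal (exp (site i y s) / site_Z i y)) else M i"
  note G = gibbs_grad(2)[OF y]
  interpret N: finite_product_prob_space ?N I
    by (rule gibbs_grad(1)[OF y])
  have sg: "sets (PiM I ?N) = sets \<Omega>" by (rule sets_PiM_cong) auto
  have hG: "h \<in> bmeas (PiM I ?N)" using cd(1) bmeas_sets_cong[OF sg] by simp
  have hm: "h \<in> borel_measurable (PiM I ?N)" using hG by (rule bmeas_measurable)
  have "\<exists>B. \<forall>x\<in>space (PiM I ?N). \<bar>h x\<bar> \<le> B"
    using hG unfolding bmeas_def by blast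
  then obtain B where B: "\<forall>x\<in>space (PiM I ?N). \<bar>h x\<bar> \<le> B" by blast
  have h0: "h x \<ge> 0" for x by (simp add: h_def cond_dens_def)
  have ih: "(\<integral>x. h x \<partial>PiM I ?N) = 1"
  proof -
    interpret U: prob_space "density (PiM I ?N) h"
      using P_uniform unfolding cd(2) G .
    have "(\<integral>\<^sup>+x. ennreal (h x) \<partial>PiM I ?N) = emeasure (density (PiM I ?N) h) (space (PiM I ?N))"
      using hm by (subst emeasure_density) (auto intro!: nn_integral_cong)
    also have "\<dots> = 1" using U.emeasure_space_1 by simp
    finally show ?thesis
      using N.P.integrable_bmeas[OF hG] h0 by (simp add: integral_eq_nn_integral)
  qed
  have "transport_dist (\<lambda>x y. (\<Sum>i\<in>I. d i (x i) (y i)) / real (card I)) (density (PiM I ?N) h) (PiM I ?N)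
    \<le> ennreal (c / 2 + N.Ent h / (4 * c * real (card I)))"
  proof (rule N.transport_dist_le[where B=B])
    show "(\<lambda>w. d i (fst w) (snd w)) \<in> borel_measurable (?N i \<Otimes>\<^sub>M ?N i)" if "i \<in> I" for i
      using d[OF that] that measurable_cong_sets[OF sets_pair_measure_cong refl, of "?N i" "M i" "?N i" "M i"] by simp
    show "0 \<le> d i s t \<and> d i s t \<le> 1" if "i \<in> I" "s \<in> space (?N i)" "t \<in> space (?N i)" for i s t
      using d_range[of i s t] that by simp
    show "d i s s = 0" if "i \<in> I" "s \<in> space (?N i)" for i s
      using d_diag[of i s] that by simp
    show "h x \<in> {0..B}" if "x \<in> space (PiM I ?N)" for x
      using bspec[OF B that] h0[of x] by simp
  qed (use hm ih c nonempty in auto)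
  moreover have "N.Ent h = kl P y"
    unfolding N.Ent_def using cd(3) unfolding G .
  ultimately show ?thesis unfolding cd(2) G by simp
qed

lemma kl_bmeas: "kl P \<in> bmeas \<Omega>"
proof -
  interpret U: prob_space "uniform_measure \<mu> P" by (rule P_uniform)
  have sU: "sets (uniform_measure \<mu> P) = sets \<Omega>" by simp
  have "(\<lambda>w. f (snd w) - ln Z - ln (measure \<mu> P) - (grad (fst w) (snd w) - log_Z (fst w))) \<in> bmeas (\<Omega> \<Otimes>\<^sub>M \<Omega>)"
    by (intro bmeas_diff grad_bmeas bmeas_const bmeas_compose[OF f_bmeas measurable_snd]
      bmeas_compose[OF log_Z_bmeas measurable_fst])
  then have F: "(\<lambda>w. f (snd w) - ln Z - ln (measure \<mu> P) - (grad (fst w) (snd w) - log_Z (fst w))) \<in> bmeas (\<Omega> \<Otimes>\<^sub>M uniform_measure \<mu> P)"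
    using bmeas_sets_cong[OF sets_pair_measure_cong[OF refl sU]] by blast
  have "\<exists>B. \<forall>w\<in>space (\<Omega> \<Otimes>\<^sub>M uniform_measure \<mu> P).
      \<bar>f (snd w) - ln Z - ln (measure \<mu> P) - (grad (fst w) (snd w) - log_Z (fst w))\<bar> \<le> B"
    using F unfolding bmeas_def by blast
  then obtain B where B: "\<forall>w\<in>space (\<Omega> \<Otimes>\<^sub>M uniform_measure \<mu> P).
      \<bar>f (snd w) - ln Z - ln (measure \<mu> P) - (grad (fst w) (snd w) - log_Z (fst w))\<bar> \<le> B"
    by blast
  show ?thesis
  proof (rule bmeas_intervalI)
    show "kl P \<in> borel_measurable \<Omega>"
      unfolding kl_def[abs_def]
      by (rule U.borel_measurable_lebesgue_integral) (use bmeas_measurable[OF F] in \<open>simp add: split_beta'\<close>)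
    show "kl P y \<in> {-B..B}" if "y \<in> space \<Omega>" for y
      unfolding kl_def
    proof (rule U.integral_in_interval)
      show "(\<lambda>x. f x - ln Z - ln (measure \<mu> P) - (grad y x - log_Z y)) \<in> borel_measurable (uniform_measure \<mu> P)"
        using kl_integrand_bmeas[OF that] unfolding bmeas_P[symmetric] by (rule bmeas_measurable)
      show "f x - ln Z - ln (measure \<mu> P) - (grad y x - log_Z y) \<in> {-B..B}"
        if "x \<in> space (uniform_measure \<mu> P)" for x
        using bspec[OF B, of "(y, x)"] that \<open>y \<in> space \<Omega>\<close> by (simp add: space_pair_measure abs_le_iff)
    qed
  qed
qed

text \<open>Exchanging \<open>grad y x\<close> for \<open>grad x x\<close> costs less than
  \<open>e\<close> pointwise, and what remains is a function of \<open>x\<close> plus a function of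
  \<open>y\<close>. Averaging both over the same law merges them into the diagonal
  integrand.\<close>

lemma average_kl_less:
  assumes \<delta>: "\<And>x y. x \<in> P \<Longrightarrow> y \<in> P \<Longrightarrow> \<bar>grad x x - grad y x\<bar> < e"
  shows "(\<integral>y. kl P y \<partial>uniform_measure \<mu> P)
    < - ln (measure \<mu> P) + (\<integral>x. f x - ln Z - grad x x + log_Z x \<partial>uniform_measure \<mu> P) + e"
proof -
  interpret U: prob_space "uniform_measure \<mu> P" by (rule P_uniform)
  have AEP: "AE x in uniform_measure \<mu> P. x \<in> P"
    using P by (intro AE_uniform_measureI) auto
  define chi where "chi = (\<lambda>x. f x - ln Z - grad x x)"
  have diag: "(\<lambda>x. grad x x) \<in> bmeas \<Omega>"
    using bmeas_compose[OF grad_bmeas, of "\<lambda>x. (x, x)" \<Omega>] measurable_Pair[OF measurable_ident_sets[OF refl] measurable_ident_sets[OF refl]] by simp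
  have chi: "chi \<in> bmeas \<Omega>" unfolding chi_def by (intro bmeas_diff f_bmeas bmeas_const diag)
  note int = U.integrable_bmeas[unfolded bmeas_P]
  have 1: "kl P y < (\<integral>x. chi x \<partial>uniform_measure \<mu> P) + (log_Z y - ln (measure \<mu> P) + e)" if y: "y \<in> P" for y
  proof -
    have y': "y \<in> space \<Omega>" using y P sets.sets_into_space by blast
    have "kl P y < (\<integral>x. chi x + (log_Z y - ln (measure \<mu> P) + e) \<partial>uniform_measure \<mu> P)"
      unfolding kl_def
    \<comment> \<open>Strictness survives integration because the pointwise inequality is strict
      almost everywhere for a probability measure.\<close>
    proof (rule U.integral_less_AE_space)
      show "AE x in uniform_measure \<mu> P. f x - ln Z - ln (measure \<mu> P) - (grad y x - log_Z y)
          < chi x + (log_Z y - ln (measure \<mu> P) + e)"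
        using AEP
      proof eventually_elim
        case (elim x)
        then show ?case using \<delta>[OF elim y] unfolding chi_def by linarith
      qed
    qed (use int[OF kl_integrand_bmeas[OF y']] int[OF bmeas_add[OF chi bmeas_const]] U.emeasure_space_1 in auto)
    also have "\<dots> = (\<integral>x. chi x \<partial>uniform_measure \<mu> P) + (log_Z y - ln (measure \<mu> P) + e)"
      using int[OF chi] by (simp add: U.prob_space[simplified])
    finally show ?thesis .
  qed
  have "(\<integral>y. kl P y \<partial>uniform_measure \<mu> P)
      < (\<integral>y. log_Z y + ((\<integral>x. chi x \<partial>uniform_measure \<mu> P) - ln (measure \<mu> P) + e) \<partial>uniform_measure \<mu> P)"
  proof (rule U.integral_less_AE_space)
    show "AE y in uniform_measure \<mu> P. kl P y < log_Z y + ((\<integral>x. chi x \<partial>uniform_measure \<mu> P) - ln (measure \<mu> P) + e)"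
      using AEP
    proof eventually_elim
      case (elim y)
      then show ?case using 1[OF elim] by linarith
    qed
  qed (use int[OF kl_bmeas] int[OF bmeas_add[OF log_Z_bmeas bmeas_const]] U.emeasure_space_1 in auto)
  also have "\<dots> = (\<integral>y. log_Z y \<partial>uniform_measure \<mu> P) + ((\<integral>x. chi x \<partial>uniform_measure \<mu> P) - ln (measure \<mu> P) + e)"
    using int[OF log_Z_bmeas] by (simp add: U.prob_space[simplified])
  also have "\<dots> = - ln (measure \<mu> P) + (\<integral>x. chi x + log_Z x \<partial>uniform_measure \<mu> P) + e"
    using int[OF log_Z_bmeas] int[OF chi] by simp
  finally show ?thesis unfolding chi_def .
qed

end

end

section \<open>Summation over the parts\<close>

context gibbs_product
begin

context
  fixes Q :: "('i \<Rightarrow> 'a) set set" and e :: real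
  assumes Q: "finite Q" "Q \<subseteq> sets \<Omega>" "partition_on (space \<Omega>) Q"
    and e: "\<And>P x y. P \<in> Q \<Longrightarrow> x \<in> P \<Longrightarrow> y \<in> P \<Longrightarrow> \<bar>grad x x - grad y x\<bar> < e"
begin

definition "S = {P \<in> Q. measure \<mu> P > 0}"
text \<open>The left-hand side of (b) as a real number.\<close>

definition "A = (\<Sum>P\<in>S. measure \<mu> P * (\<integral>y. kl P y \<partial>uniform_measure \<mu> P))"

lemma S: "finite S" "P \<in> S \<Longrightarrow> P \<in> sets \<Omega>" "P \<in> S \<Longrightarrow> measure \<mu> P > 0" "P \<in> S \<Longrightarrow> P \<in> Q"
  using Q by (auto simp: S_def)

lemma sum_integral_parts:
  assumes "g \<in> bmeas \<Omega>"
  shows "(\<Sum>P\<in>S. \<integral>x. indicator P x * g x \<partial>\<mu>) = (\<integral>x. g x \<partial>\<mu>)"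
proof -
  have g: "g \<in> bmeas \<mu>" using assms unfolding bmeas_\<mu> .
  have "(\<Sum>P\<in>S. \<integral>x. indicator P x * g x \<partial>\<mu>) = (\<Sum>P\<in>Q. \<integral>x. indicator P x * g x \<partial>\<mu>)"
  proof (rule sum.mono_neutral_left[OF Q(1)])
    show "S \<subseteq> Q" by (auto simp: S_def)
    show "\<forall>P\<in>Q - S. (\<integral>x. indicator P x * g x \<partial>\<mu>) = 0"
    proof
      fix P assume P: "P \<in> Q - S"
      then have PM: "P \<in> sets \<mu>" and "measure \<mu> P = 0"
        using Q(2) by (auto simp: S_def zero_less_measure_iff)
      then have "P \<in> null_sets \<mu>" by (auto simp: null_sets_def \<mu>.emeasure_eq_measure)
      then have "AE x in \<mu>. x \<notin> P" by (rule AE_not_in)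
      then have "(\<integral>x. indicator P x * g x \<partial>\<mu>) = (\<integral>x. 0 \<partial>\<mu>)"
        using bmeas_measurable[OF g] PM by (intro integral_cong_AE) (auto simp: indicator_def)
      then show "(\<integral>x. indicator P x * g x \<partial>\<mu>) = 0" by simp
    qed
  qed
  also have "\<dots> = (\<integral>x. (\<Sum>P\<in>Q. indicator P x * g x) \<partial>\<mu>)"
    using Q(2) by (intro Bochner_Integration.integral_sum[symmetric] \<mu>.integrable_bmeas bmeas_mult g bmeas_indicator) auto
  also have "\<dots> = (\<integral>x. g x \<partial>\<mu>)"
    using Q by (intro Bochner_Integration.integral_cong refl, subst partition_sum_indicator) auto
  finally show ?thesis .
qed

lemma sum_parts: "(\<Sum>P\<in>S. measure \<mu> P) = 1"
proof -
  have "(\<Sum>P\<in>S. measure \<mu> P) = (\<Sum>P\<in>S. \<integral>x. indicator P x * 1 \<partial>\<mu>)"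
    using S(2) sets.sets_into_space by (intro sum.cong refl) (force simp: Int_absorb2)
  also have "\<dots> = 1" using sum_integral_parts[of "\<lambda>_. 1"] \<mu>.prob_space by simp
  finally show ?thesis .
qed

lemma sum_kl_add_dtc_less: "A + dtc p < partition_entropy \<mu> Q + e"
proof -
  define G where "G = (\<lambda>x. f x - ln Z - grad x x + log_Z x)"
  have diag: "(\<lambda>x. grad x x) \<in> bmeas \<Omega>"
    using bmeas_compose[OF grad_bmeas, of "\<lambda>x. (x, x)" \<Omega>]
      measurable_Pair[OF measurable_ident_sets[OF refl] measurable_ident_sets[OF refl]] by simp
  have G: "G \<in> bmeas \<Omega>" unfolding G_def by (intro bmeas_add bmeas_diff f_bmeas bmeas_const diag log_Z_bmeas)
  have "A < (\<Sum>P\<in>S. - (measure \<mu> P * ln (measure \<mu> P)) + (\<integral>x. indicator P x * G x \<partial>\<mu>) + measure \<mu> P * e)"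
    unfolding A_def
  proof (rule sum_strict_mono[OF S(1)])
    \<comment> \<open>A strict sum needs at least one part of positive measure; the parts in
      \<open>S\<close> have total mass one.\<close>
    show "S \<noteq> {}" using sum_parts by auto
    fix P assume P: "P \<in> S"
    note P' = S(2,3)[OF P]
    have "(\<integral>y. kl P y \<partial>uniform_measure \<mu> P) < - ln (measure \<mu> P) + (\<integral>x. G x \<partial>uniform_measure \<mu> P) + e"
      unfolding G_def by (rule average_kl_less[OF P' e[OF S(4)[OF P]]])
    then have "measure \<mu> P * (\<integral>y. kl P y \<partial>uniform_measure \<mu> P)
        < measure \<mu> P * (- ln (measure \<mu> P) + (\<integral>x. G x \<partial>uniform_measure \<mu> P) + e)"
      using P'(2) by (rule mult_strict_left_mono)
    also have "(\<integral>x. G x \<partial>uniform_measure \<mu> P) = (\<integral>x. indicator P x * G x \<partial>\<mu>) / measure \<mu> P"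
      using P' bmeas_measurable[OF G] by (intro integral_uniform_measure) auto
    finally show "measure \<mu> P * (\<integral>y. kl P y \<partial>uniform_measure \<mu> P)
        < - (measure \<mu> P * ln (measure \<mu> P)) + (\<integral>x. indicator P x * G x \<partial>\<mu>) + measure \<mu> P * e"
      using P'(2) by (simp add: algebra_simps)
  qed
  also have "\<dots> = (\<Sum>P\<in>S. - (measure \<mu> P * ln (measure \<mu> P))) + (\<integral>x. G x \<partial>\<mu>) + e"
    by (simp only: sum.distrib sum_integral_parts[OF G] sum_distrib_right[symmetric] sum_parts mult_1_left)
  also have "(\<Sum>P\<in>S. - (measure \<mu> P * ln (measure \<mu> P))) = partition_entropy \<mu> Q"
    unfolding partition_entropy_def sum_negf[symmetric]
    using Q(1) by (intro sum.mono_neutral_left) (auto simp: S_def zero_less_measure_iff)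
  also have "(\<integral>x. G x \<partial>\<mu>) = - dtc p" unfolding G_def by (rule integral_diagonal)
  finally show ?thesis by simp
qed

lemma nn_integral_kl:
  assumes P: "P \<in> S" and a: "a \<ge> 0" "c \<ge> 0"
  shows "(\<integral>\<^sup>+y. ennreal (a + c * kl P y) \<partial>uniform_measure \<mu> P)
    = ennreal (a + c * (\<integral>y. kl P y \<partial>uniform_measure \<mu> P))"
proof -
  note P' = S(2,3)[OF P]
  interpret U: prob_space "uniform_measure \<mu> P" by (rule P_uniform[OF P'])
  have k: "kl P \<in> bmeas (uniform_measure \<mu> P)" unfolding bmeas_P[OF P'] by (rule kl_bmeas[OF P'])
  have "(\<integral>\<^sup>+y. ennreal (a + c * kl P y) \<partial>uniform_measure \<mu> P) = ennreal (\<integral>y. a + c * kl P y \<partial>uniform_measure \<mu> P)"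
    using a KL_eq_kl(2)[OF P']
    by (intro nn_integral_eq_integral U.integrable_bmeas bmeas_add bmeas_mult k bmeas_const AE_I2) auto
  also have "(\<integral>y. a + c * kl P y \<partial>uniform_measure \<mu> P) = a + c * (\<integral>y. kl P y \<partial>uniform_measure \<mu> P)"
    using U.integrable_bmeas[OF k] U.prob_space by simp
  finally show ?thesis .
qed

lemma average_kl_nonneg:
  assumes P: "P \<in> S"
  shows "(\<integral>y. kl P y \<partial>uniform_measure \<mu> P) \<ge> 0"
  using KL_eq_kl(2)[OF S(2,3)[OF P]] by (intro integral_nonneg_AE AE_I2) auto

lemma A_nonneg: "A \<ge> 0"
  unfolding A_def using average_kl_nonneg by (intro sum_nonneg mult_nonneg_nonneg) auto

text \<open>Affine functions of the divergence cover both remaining claims: \<open>a = 0\<close> and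
  \<open>c = 1\<close> for (b), the linearized transport bound for (c).\<close>

lemma sum_nn_integral_kl:
  assumes a: "a \<ge> 0" "c \<ge> 0"
  shows "(\<Sum>P\<in>S. emeasure \<mu> P * (\<integral>\<^sup>+y. ennreal (a + c * kl P y) \<partial>uniform_measure \<mu> P)) = ennreal (a + c * A)"
proof -
  have "(\<Sum>P\<in>S. emeasure \<mu> P * (\<integral>\<^sup>+y. ennreal (a + c * kl P y) \<partial>uniform_measure \<mu> P))
      = (\<Sum>P\<in>S. ennreal (measure \<mu> P * (a + c * (\<integral>y. kl P y \<partial>uniform_measure \<mu> P))))"
    by (intro sum.cong refl) (simp add: nn_integral_kl[OF _ a] \<mu>.emeasure_eq_measure ennreal_mult')
  also have "\<dots> = ennreal (\<Sum>P\<in>S. measure \<mu> P * (a + c * (\<integral>y. kl P y \<partial>uniform_measure \<mu> P)))"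
    using average_kl_nonneg a by (intro sum_ennreal) auto
  also have "(\<Sum>P\<in>S. measure \<mu> P * (a + c * (\<integral>y. kl P y \<partial>uniform_measure \<mu> P))) = (\<Sum>P\<in>S. measure \<mu> P) * a + c * A"
    unfolding A_def by (simp add: distrib_left sum.distrib sum_distrib_left sum_distrib_right mult.left_commute)
  finally show ?thesis by (simp add: sum_parts)
qed

lemma sum_KL: "(\<Sum>P\<in>S. emeasure \<mu> P * (\<integral>\<^sup>+y. KL (uniform_measure \<mu> P) (gibbs \<Omega> (grad y)) \<partial>uniform_measure \<mu> P)) = ennreal A"
proof -
  have "(\<integral>\<^sup>+y. KL (uniform_measure \<mu> P) (gibbs \<Omega> (grad y)) \<partial>uniform_measure \<mu> P)
      = (\<integral>\<^sup>+y. ennreal (0 + 1 * kl P y) \<partial>uniform_measure \<mu> P)" if P: "P \<in> S" for P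
    by (intro nn_integral_cong) (simp add: KL_eq_kl(1)[OF S(2,3)[OF P]])
  then show ?thesis using sum_nn_integral_kl[of 0 1] by simp
qed

lemma sum_transport_less:
  fixes d :: "'i \<Rightarrow> 'a \<Rightarrow> 'a \<Rightarrow> real"
  assumes R: "A < R"
    and d: "\<And>i. i \<in> I \<Longrightarrow> (\<lambda>w. d i (fst w) (snd w)) \<in> borel_measurable (M i \<Otimes>\<^sub>M M i)"
    and d_range: "\<And>i s t. i \<in> I \<Longrightarrow> s \<in> space (M i) \<Longrightarrow> t \<in> space (M i) \<Longrightarrow> 0 \<le> d i s t \<and> d i s t \<le> 1"
    and d_diag: "\<And>i s. i \<in> I \<Longrightarrow> s \<in> space (M i) \<Longrightarrow> d i s s = 0"
  shows "(\<Sum>P\<in>S. emeasure \<mu> P * (\<integral>\<^sup>+y. transport_dist (\<lambda>x y. (\<Sum>i\<in>I. d i (x i) (y i)) / real (card I))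
      (uniform_measure \<mu> P) (gibbs \<Omega> (grad y)) \<partial>uniform_measure \<mu> P))
    < ennreal (sqrt (R / (2 * real (card I))))"
proof -
  define n where "n = real (card I)"
  have n: "n > 0" using nonempty finite_index by (simp add: n_def card_gt_0_iff)
  have R0: "R > 0" using R A_nonneg by simp
  \<comment> \<open>The minimizer of c / 2 + R / (4 c n), with minimum c itself. Using
    \<open>R\<close> instead of \<open>A\<close> keeps it positive even when \<open>A\<close> is
    zero, and A < R makes the final bound strict.\<close>
  define c where "c = sqrt (R / (2 * n))"
  have c: "c > 0" using R0 n by (simp add: c_def)
  have c2: "c * c = R / (2 * n)" using R0 n by (simp add: c_def)
  have "(\<Sum>P\<in>S. emeasure \<mu> P * (\<integral>\<^sup>+y. transport_dist (\<lambda>x y. (\<Sum>i\<in>I. d i (x i) (y i)) / n)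
      (uniform_measure \<mu> P) (gibbs \<Omega> (grad y)) \<partial>uniform_measure \<mu> P))
    \<le> (\<Sum>P\<in>S. emeasure \<mu> P * (\<integral>\<^sup>+y. ennreal (c / 2 + (1 / (4 * c * n)) * kl P y) \<partial>uniform_measure \<mu> P))"
  proof (intro sum_mono mult_left_mono nn_integral_mono)
    fix P y assume P: "P \<in> S" and y: "y \<in> space (uniform_measure \<mu> P)"
    have y': "y \<in> space \<Omega>" using y by simp
    show "transport_dist (\<lambda>x y. (\<Sum>i\<in>I. d i (x i) (y i)) / n) (uniform_measure \<mu> P) (gibbs \<Omega> (grad y))
        \<le> ennreal (c / 2 + (1 / (4 * c * n)) * kl P y)"
      using transport_le_kl[where d=d, OF S(2,3)[OF P] y' c d d_range d_diag] by (simp add: n_def)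
  qed simp
  also have "\<dots> = ennreal (c / 2 + (1 / (4 * c * n)) * A)"
    using c n by (intro sum_nn_integral_kl) auto
  also have "\<dots> < ennreal c"
  proof (rule ennreal_lessI[OF c])
    have "(1 / (4 * c * n)) * A < (1 / (4 * c * n)) * R"
      using R c n by (intro mult_strict_left_mono) auto
    also have "\<dots> = (c * c) / (2 * c)" using c n by (simp add: c2 field_simps)
    also have "\<dots> = c / 2" using c by simp
    finally show "c / 2 + (1 / (4 * c * n)) * A < c" by simp
  qed
  finally show ?thesis unfolding c_def n_def .
qed

end

end

section \<open>Gibbs measures on products of metric spaces\<close>

theorem theoremA:
  fixes n :: nat
    and K :: "nat \<Rightarrow> 'a metric"
    and lam :: "nat \<Rightarrow> 'a measure"
    and pt :: "nat \<Rightarrow> 'a"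
    and f :: "(nat \<Rightarrow> 'a) \<Rightarrow> real"
    and \<delta> :: real
    and \<P> :: "(nat \<Rightarrow> 'a) set set"
  defines "X \<equiv> product_topology (\<lambda>i. mtopology_of (K i)) {1..n}"
  defines "\<mu> \<equiv> gibbs (PiM {1..n} lam) f"
  defines "\<xi> \<equiv> \<lambda>g. gibbs (PiM {1..n} lam) g"
  defines "grad \<equiv> discrete_gradient n pt f"
  assumes "n \<ge> 1"
    and "\<And>i. i \<in> {1..n} \<Longrightarrow> mcomplete_of (K i)"
    and "\<And>i. i \<in> {1..n} \<Longrightarrow> separable_space (mtopology_of (K i))"
    and "\<And>i x y. i \<in> {1..n} \<Longrightarrow> x \<in> mspace (K i) \<Longrightarrow> y \<in> mspace (K i) \<Longrightarrow> mdist (K i) x y \<le> 1"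
    and "\<And>i. i \<in> {1..n} \<Longrightarrow> prob_space (lam i)"
    and "\<And>i. i \<in> {1..n} \<Longrightarrow> sets (lam i) = sets (borel_of (mtopology_of (K i)))"
    and "\<And>i. i \<in> {1..n} \<Longrightarrow> pt i \<in> mspace (K i)"
    and "continuous_map X euclideanreal f"
    and "bounded (f ` topspace X)"
    and "finite_measurable_partition (borel_of X) \<P>"
    and "\<And>P x y. P \<in> \<P> \<Longrightarrow> x \<in> P \<Longrightarrow> y \<in> P \<Longrightarrow>
           (SUP z\<in>topspace X. \<bar>grad x z - grad y z\<bar>) < \<delta> * real n"
  shows "(DTC \<mu> {1..n} lam (\<lambda>i x. x i) < ereal (partition_entropy \<mu> \<P> + \<delta> * real n)) \<and>
         ((\<Sum>P \<in> {P\<in>\<P>. emeasure \<mu> P > 0}.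
            emeasure \<mu> P * (\<integral>\<^sup>+ y. KL (uniform_measure \<mu> P) (\<xi> (grad y)) \<partial>uniform_measure \<mu> P))
          < ennreal (partition_entropy \<mu> \<P> + \<delta> * real n)) \<and>
         ((\<Sum>P \<in> {P\<in>\<P>. emeasure \<mu> P > 0}.
            emeasure \<mu> P *
            (\<integral>\<^sup>+ y. transport_dist (avg_dist n K) (uniform_measure \<mu> P) (\<xi> (grad y)) \<partial>uniform_measure \<mu> P))
          < ennreal (sqrt (1 / 2 * (partition_entropy \<mu> \<P> / real n + \<delta>))))"
proof -
  note n = assms(5) and sep = assms(7) and diam = assms(8) and prob = assms(9) and sets_lam = assms(10)
    and pt = assms(11) and cont = assms(12) and bdd = assms(13) and part = assms(14) and small = assms(15)
  \<comment> \<open>Extends the family by \<open>lam 1\<close> beyond the indices in use, so that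
    every \<open>M i\<close> is a probability measure; index 1 is available as
    \<open>n \<ge> 1\<close>.\<close>
  define M where "M = (\<lambda>i. if i \<in> {1..n} then lam i else lam 1)"
  have M: "M i = lam i" if "i \<in> {1..n}" for i using that by (simp add: M_def)
  have PM: "PiM {1..n} lam = PiM {1..n} M" by (rule PiM_cong) (simp_all add: M)
  have "prob_space (M i)" for i using prob n by (simp add: M_def)
  then interpret M: product_prob_space M by (intro product_prob_spaceI)
  have space_M: "space (M i) = mspace (K i)" if "i \<in> {1..n}" for i
    using sets_eq_imp_space_eq[OF sets_lam[OF that]] M[OF that] by simp
  have space_PM: "space (PiM {1..n} M) = topspace X"
    unfolding X_def space_PiM topspace_product_topology by (intro PiE_cong) (simp add: space_M)
  have sets_X: "sets (borel_of X) \<subseteq> sets (PiM {1..n} M)"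
    unfolding X_def
    by (rule sets_borel_of_product_subset)
      (use sep sets_lam M in \<open>auto intro: second_countable_separable_metric\<close>)
  have f_meas: "f \<in> borel_measurable (PiM {1..n} M)"
  proof (rule measurableI)
    fix B :: "real set" assume "B \<in> sets borel"
    then have "f -` B \<inter> space (borel_of X) \<in> sets (borel_of X)"
      by (rule measurable_sets[OF continuous_map_borel_of[OF cont]])
    then show "f -` B \<inter> space (PiM {1..n} M) \<in> sets (PiM {1..n} M)"
      using sets_X space_PM by auto
  qed simp
  obtain b where b: "\<And>x. x \<in> topspace X \<Longrightarrow> \<bar>f x\<bar> \<le> b"
    using bdd by (auto simp: bounded_real)
  interpret gibbs_product M "{1..n}" f pt b
    by unfold_locales (use f_meas b space_PM pt n in \<open>auto simp: space_M\<close>)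
  have grad_eq: "discrete_gradient n pt f y x = local.grad y x" for x y
    unfolding discrete_gradient_def discrete_partial_def grad_def ..
  then have grad: "grad = local.grad" unfolding assms(4) by (intro ext)
  have \<mu>: "\<mu> = local.\<mu>" unfolding assms(2) PM by (rule gibbs_eq)
  have \<xi>: "\<xi> g = gibbs (PiM {1..n} M) g" for g unfolding assms(3) PM ..
  note part' = finite_measurable_partitionD[OF part]
  have Q: "finite \<P>" "\<P> \<subseteq> sets (PiM {1..n} M)" "partition_on (space (PiM {1..n} M)) \<P>"
    using part' sets_X space_PM by auto
  have e: "\<bar>local.grad x x - local.grad y x\<bar> < \<delta> * real n" if P: "P \<in> \<P>" "x \<in> P" "y \<in> P" for P x y
  proof -
    have xy: "x \<in> topspace X" "y \<in> topspace X"
      using P Q(3) space_PM by (auto simp: partition_on_def)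
    have "(\<lambda>z. local.grad x z - local.grad y z) \<in> bmeas (PiM {1..n} M)"
      by (intro bmeas_diff grad_section) (simp_all only: space_PM xy)
    then obtain B where B: "\<forall>z\<in>topspace X. \<bar>local.grad x z - local.grad y z\<bar> \<le> B"
      unfolding bmeas_def space_PM by blast
    \<comment> \<open>The supremum is evaluated at z = x. Being a real supremum, it dominates this
      value only because the gradients are bounded.\<close>
    have "\<bar>local.grad x x - local.grad y x\<bar> \<le> (SUP z\<in>topspace X. \<bar>local.grad x z - local.grad y z\<bar>)"
      by (rule cSUP_upper[OF xy(1)]) (use B in \<open>auto intro: bdd_aboveI2\<close>)
    also have "\<dots> < \<delta> * real n" using small[OF P] unfolding grad .
    finally show ?thesis .
  qed
  define R where "R = partition_entropy local.\<mu> \<P> + \<delta> * real n"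
  define AA where "AA = A \<P>"
  have main: "AA + dtc p < R"
    unfolding R_def AA_def by (rule sum_kl_add_dtc_less[OF Q e])
  have A0: "AA \<ge> 0" unfolding AA_def by (rule A_nonneg[OF Q e])
  have S_eq: "{P \<in> \<P>. emeasure local.\<mu> P > 0} = S \<P>"
  proof -
    have "S \<P> = {P \<in> \<P>. measure local.\<mu> P > 0}" by (rule S_def[OF Q e])
    then show ?thesis by (simp only: \<mu>.emeasure_eq_measure ennreal_less_zero_iff)
  qed
  have "DTC local.\<mu> {1..n} lam (\<lambda>i x. x i) \<le> ereal (dtc p)"
    unfolding DTC_def
  proof (rule SUP_least)
    fix q assume "q \<in> {q. \<forall>i\<in>{1..n}. finite_measurable_partition (lam i) (q i)}"
    then have "finite_measurable_partition (M i) (q i)" if "i \<in> {1..n}" for i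
      using M[OF that] that by auto
    then show "ereal (DTC_finite local.\<mu> {1..n} (\<lambda>i \<omega>. cell (q i) (\<omega> i))) \<le> ereal (dtc p)"
      unfolding ereal_less_eq by (rule DTC_finite_le_dtc)
  qed
  also have "\<dots> < ereal R" using main A0 by simp
  finally have a: "DTC local.\<mu> {1..n} lam (\<lambda>i x. x i) < ereal R" .
  have AR: "AA < R" using main dtc_nonneg by simp
  have b: "(\<Sum>P\<in>S \<P>. emeasure local.\<mu> P * (\<integral>\<^sup>+y. KL (uniform_measure local.\<mu> P) (gibbs (PiM {1..n} M) (local.grad y))
      \<partial>uniform_measure local.\<mu> P)) < ennreal R"
    using sum_KL[OF Q e] AR A0 unfolding AA_def[symmetric] by (simp add: ennreal_lessI)
  have avg: "avg_dist n K = (\<lambda>x y. (\<Sum>i\<in>{1..n}. mdist (K i) (x i) (y i)) / real (card {1..n}))"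
    by (simp add: avg_dist_def fun_eq_iff)
  have c: "(\<Sum>P\<in>S \<P>. emeasure local.\<mu> P * (\<integral>\<^sup>+y. transport_dist (avg_dist n K) (uniform_measure local.\<mu> P)
      (gibbs (PiM {1..n} M) (local.grad y)) \<partial>uniform_measure local.\<mu> P)) < ennreal (sqrt (R / (2 * real (card {1..n}))))"
    unfolding avg
  proof (rule sum_transport_less[OF Q e])
    show "A \<P> < R" using AR unfolding AA_def .
    show "(\<lambda>w. mdist (K i) (fst w) (snd w)) \<in> borel_measurable (M i \<Otimes>\<^sub>M M i)" if "i \<in> {1..n}" for i
      unfolding M[OF that] by (rule measurable_mdist[OF sep[OF that] sets_lam[OF that]])
    show "0 \<le> mdist (K i) s t \<and> mdist (K i) s t \<le> 1"
      if "i \<in> {1..n}" "s \<in> space (M i)" "t \<in> space (M i)" for i s t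
      using diam[OF that(1)] that by (simp add: space_M)
    show "mdist (K i) s s = 0" if "i \<in> {1..n}" "s \<in> space (M i)" for i s
      using that by (simp add: space_M)
  qed
  have R_eq: "R / (2 * real (card {1..n})) = 1 / 2 * (partition_entropy local.\<mu> \<P> / real n + \<delta>)"
    using n by (simp add: R_def field_simps)
  show ?thesis
    using a b c unfolding \<mu> S_eq \<xi> grad R_eq unfolding R_def by blast
qed

end
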